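(* Let $d\ge 2$ and suppose that $\tilde A\in \mathrm{SL}_d(\mathbb{Z})$ has irreducible characteristic polynomial (over $\mathbb{Q}$) and that its eigenvalues of largest magnitude are a complex conjugate pair $\xi_{\max},\bar\xi_{\max}$ with $\xi_{\max}^j\notin\mathbb{R}$ for every non-zero $j\in\mathbb{Z}$. If $A=\tilde A^N$ for large enough $N\in\mathbb{Z}_{\geq 0}$, and $f=g\circ h_A\colon\mathbb{P}^d\dashrightarrow\mathbb{P}^d$, then the first dynamical degree $\lambda=\lambda(f)$ satisfies $$\sum_{j=1}^\infty \Psi_{\mathcal{U},\mathcal{V}}(A^j)\,\lambda^{-j}=1,$$ where $\mathcal{U},\mathcal{V}\subset\mathbb{Z}^d$ are the finite sets of vectors, depending only on the dimension $d$, specified in the context.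
   Context: Work over an algebraically closed field $\Bbbk$ of characteristic different from $2$. Monomial maps: for $A=(a_{ij})\in\mathrm{GL}_d(\mathbb{Z})$, $h_A\colon\mathbb{P}^d\dashrightarrow\mathbb{P}^d$ is the birational map given in affine coordinates $y_j=x_j/x_0$ by $h_A(y_1,\dots,y_d)=(y_1^{a_{11}}\cdots y_d^{a_{1d}},\dots,y_1^{a_{d1}}\cdots y_d^{a_{dd}})$. The involution $g$: let $B=(B_{i,j})_{0\le i,j\le d}$ be the matrix with $B_{i,j}=(-1)^{i-j}$ for $i\le j$ and $B_{i,j}=(-1)^{i-j-1}$ for $i>j$. It is invertible and defines an automorphism $B$ of $\mathbb{P}^d$, $[x_0,\dots,x_d]\mapsto[b_0,\dots,b_d]$, where $b_i=\sum_j B_{i,j}x_j$. Let $h_{-I}$ be the Cremona involution $[x_0,\dots,x_d]\mapsto[\prod_{i\ne0}x_i,\dots,\prod_{i\ne d}x_i]$. Set $g:=B^{-1}\circ h_{-I}\circ B$. Writing $g=[g_0,\dots,g_d]$, up to sign one has $g_k=x_k\prod_{i\ne k,k+1}b_i$ for $k<d$ and $g_d=x_d\prod_{i\ne 0,d}b_i$. The sets: $\mathcal{U}=\{0,-\mathbf e_1,\dots,-\mathbf e_d\}$, where $\mathbf e_1,\dots,\mathbf e_d$ is the standard basis of $\mathbb{Z}^d$; $\mathcal{V}=\{v_0,\dots,v_d\}\subset\mathbb{Z}^d$, where the $k$th entry of $v_j$ ($1\le k\le d$) is the order of $b_j$ in $g_k/g_0$. (Explicitly, $(v_j)_k=\varepsilon(j,0)-\varepsilon(j,k)$,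 where $\varepsilon(j,k)=1$ if $j\equiv k$ or $j\equiv k+1 \bmod (d+1)$, and $\varepsilon(j,k)=0$ otherwise.) For a $d\times d$ integer matrix $A$, $\Psi_{\mathcal{U},\mathcal{V}}(A):=\sum_{v\in\mathcal{V}}\max_{u\in\mathcal{U}}\langle u,Av\rangle$, with $\langle\cdot,\cdot\rangle$ the standard bilinear pairing on $\mathbb{Z}^d$. The degree of a rational map $f=[f_0,\dots,f_d]$ of $\mathbb{P}^d$, with the $f_j$ homogeneous polynomials of the same degree without common factor, is $\deg f=\deg f_j$; the first dynamical degree is $\lambda(f)=\lim_{n\to\infty}(\deg f^n)^{1/n}$. *)

theory Defs
  imports
    Complex_Main
    "HOL-Library.Poly_Mapping"
    "HOL-Computational_Algebra.Computational_Algebra"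
    "Jordan_Normal_Form.Char_Poly"
    "Jordan_Normal_Form.Gauss_Jordan_Elimination"
begin

section \<open>Rational self-maps of projective space\<close>

text \<open>
  A polynomial is a finitely supported map from exponent vectors to coefficients. The
  homogeneous coordinates of \<open>P\<^sup>d\<close> are the variables \<open>X 0, \<dots>, X d\<close>; all other variables are
  excluded by \<open>is_form\<close>.
\<close>

type_synonym 'k mpoly = "(nat \<Rightarrow>\<^sub>0 nat) \<Rightarrow>\<^sub>0 'k"

definition X :: "nat \<Rightarrow> 'k::comm_ring_1 mpoly" where
  "X i = Poly_Mapping.single (Poly_Mapping.single i 1) 1"

definition C :: "'k \<Rightarrow> 'k::comm_ring_1 mpoly" where
  "C c = Poly_Mapping.single 0 c"

definition mpoly_subst :: "(nat \<Rightarrow> 'k mpoly) \<Rightarrow> 'k mpoly \<Rightarrow> 'k::comm_ring_1 mpoly" where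
  "mpoly_subst G p =
     (\<Sum>m\<in>Poly_Mapping.keys p. C (Poly_Mapping.lookup p m) *
        (\<Prod>i\<in>Poly_Mapping.keys m. G i ^ Poly_Mapping.lookup m i))"

text \<open>Forms of degree \<open>n\<close>; the zero polynomial is a form of every degree.\<close>

definition is_form :: "nat \<Rightarrow> nat \<Rightarrow> 'k::comm_ring_1 mpoly \<Rightarrow> bool" where
  "is_form d n p \<longleftrightarrow> (\<forall>m\<in>Poly_Mapping.keys p.
     Poly_Mapping.keys m \<subseteq> {..d} \<and> (\<Sum>i\<in>Poly_Mapping.keys m. Poly_Mapping.lookup m i) = n)"

text \<open>
  Tuples \<open>[F 0, \<dots>, F d]\<close> of forms of a common degree that are not all zero. Values of \<open>F\<close> at
  indices above \<open>d\<close> are irrelevant throughout.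
\<close>

definition form_tuples :: "nat \<Rightarrow> (nat \<Rightarrow> 'k::comm_ring_1 mpoly) set" where
  "form_tuples d = {F. (\<exists>n. \<forall>j\<le>d. is_form d n (F j)) \<and> (\<exists>j\<le>d. F j \<noteq> 0)}"

text \<open>A rational map is the class of all tuples that are proportional to a given one.\<close>

type_synonym 'k ratmap = "(nat \<Rightarrow> 'k mpoly) set"

definition ratmap_of :: "nat \<Rightarrow> (nat \<Rightarrow> 'k mpoly) \<Rightarrow> 'k::comm_ring_1 ratmap" where
  "ratmap_of d F = {G \<in> form_tuples d. \<forall>i\<le>d. \<forall>j\<le>d. F i * G j = F j * G i}"

definition rat_id :: "nat \<Rightarrow> 'k::comm_ring_1 ratmap" where
  "rat_id d = ratmap_of d X"

text \<open>
  Composition. All pairs of representatives whose composite is not identically zero give the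
  same class. If there is no such pair, that is, if the image of the second map lies in the
  indeterminacy locus of the first, the composite is undefined and the result is empty; this
  does not occur for dominant maps.
\<close>

definition rat_comp :: "nat \<Rightarrow> 'k ratmap \<Rightarrow> 'k ratmap \<Rightarrow> 'k::comm_ring_1 ratmap" where
  "rat_comp d f g =
     \<Union>{ratmap_of d (\<lambda>j. mpoly_subst G (F j)) | F G.
          F \<in> f \<and> G \<in> g \<and> (\<exists>j\<le>d. mpoly_subst G (F j) \<noteq> 0)}"

definition rat_iterate :: "nat \<Rightarrow> 'k ratmap \<Rightarrow> nat \<Rightarrow> 'k::comm_ring_1 ratmap" where
  "rat_iterate d f n = (rat_comp d f ^^ n) (rat_id d)"

definition no_common_factor :: "nat \<Rightarrow> (nat \<Rightarrow> 'k::comm_ring_1 mpoly) \<Rightarrow> bool" where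
  "no_common_factor d F \<longleftrightarrow> (\<forall>p. (\<forall>j\<le>d. p dvd F j) \<longrightarrow> p dvd 1)"

definition rat_degree :: "nat \<Rightarrow> 'k::comm_ring_1 ratmap \<Rightarrow> nat" where
  "rat_degree d f = (THE n. \<exists>F\<in>f. no_common_factor d F \<and> (\<forall>j\<le>d. is_form d n (F j)))"

definition degree_growth :: "nat \<Rightarrow> 'k::comm_ring_1 ratmap \<Rightarrow> nat \<Rightarrow> real" where
  "degree_growth d f n = root n (real (rat_degree d (rat_iterate d f n)))"

definition dynamical_degree :: "nat \<Rightarrow> 'k::comm_ring_1 ratmap \<Rightarrow> real" where
  "dynamical_degree d f = lim (degree_growth d f)"


section \<open>Monomial maps and the involution\<close>

text \<open>
  The map \<open>h\<^sub>A\<close>, given by the equations \<open>F\<^sub>i / F\<^sub>0 = (\<Prod>j. (x\<^sub>j / x\<^sub>0)^(a\<^sub>i\<^sub>j))\<close> in the field of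
  rational functions. Matrix indices start at \<open>0\<close>, affine coordinates at \<open>1\<close>.
\<close>

definition monomial_map :: "nat \<Rightarrow> int mat \<Rightarrow> 'k::idom ratmap" where
  "monomial_map d A = {F \<in> form_tuples d. F 0 \<noteq> 0 \<and>
     (\<forall>i\<in>{1..d}. Fraction_Field.Fract (F i) (F 0) =
        (\<Prod>j=1..d. Fraction_Field.Fract (X j) (X 0) powi (A $$ (i - 1, j - 1))))}"

definition linear_map :: "nat \<Rightarrow> 'k mat \<Rightarrow> 'k::comm_ring_1 ratmap" where
  "linear_map d M = ratmap_of d (\<lambda>i. \<Sum>j\<le>d. C (M $$ (i, j)) * X j)"

definition cremona :: "nat \<Rightarrow> 'k::comm_ring_1 ratmap" where
  "cremona d = ratmap_of d (\<lambda>k. \<Prod>i\<in>{..d} - {k}. X i)"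

definition B_mat :: "nat \<Rightarrow> 'k::field mat" where
  "B_mat d = mat (d + 1) (d + 1) (\<lambda>(i, j).
     if i \<le> j then (-1) powi (int i - int j) else (-1) powi (int i - int j - 1))"

definition B_inv :: "nat \<Rightarrow> 'k::field mat" where
  "B_inv d = the (mat_inverse (B_mat d))"

lemma B_mat_invertible:
  assumes "(2 :: 'k::field) \<noteq> 0" and "d \<ge> 1"
  shows "B_inv d * B_mat d = (1\<^sub>m (d + 1) :: 'k mat)"
    and "B_mat d * B_inv d = (1\<^sub>m (d + 1) :: 'k mat)"
proof -
  define B where "B = (B_mat d :: 'k mat)"
  define D where "D = mat (d + 1) (d + 1) (\<lambda>(k, i). (if i = k then 1 / 2
    else if i = k + 1 then 1 / 2 else if k = d \<and> i = 0 then (-1) ^ d / 2 else (0::'k)))"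
  have B: "B \<in> carrier_mat (d + 1) (d + 1)" and D: "D \<in> carrier_mat (d + 1) (d + 1)"
    by (simp_all add: B_def D_def B_mat_def)
  have pi: "(-1 :: 'k) powi n = (if even n then 1 else -1)" for n :: int
    by (simp add: power_int_minus_left)
  have "D * B = 1\<^sub>m (d + 1)"
  proof (rule eq_matI)
    fix k j assume "k < dim_row (1\<^sub>m (d + 1) :: 'k mat)" and "j < dim_col (1\<^sub>m (d + 1) :: 'k mat)"
    hence k: "k < d + 1" and j: "j < d + 1" by auto
    have eq: "(D * B) $$ (k, j) = (\<Sum>i = 0..<d + 1. D $$ (k, i) * B $$ (i, j))"
      using k j B D by (simp add: scalar_prod_def)
    show "(D * B) $$ (k, j) = 1\<^sub>m (d + 1) $$ (k, j)"
    proof (cases "k = d")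
      case False
      have "(\<Sum>i = 0..<d + 1. D $$ (k, i) * B $$ (i, j)) = (\<Sum>i\<in>{k, k + 1}. D $$ (k, i) * B $$ (i, j))"
        using k False by (intro sum.mono_neutral_right) (auto simp: D_def)
      also have "\<dots> = (B $$ (k, j) + B $$ (k + 1, j)) / 2"
        using k False by (simp add: D_def add_divide_distrib)
      also have "\<dots> = 1\<^sub>m (d + 1) $$ (k, j)"
        using k j False assms by (auto simp: B_def B_mat_def pi)
      finally show ?thesis using eq by simp
    next
      case True
      have "(\<Sum>i = 0..<d + 1. D $$ (k, i) * B $$ (i, j)) = (\<Sum>i\<in>{0, d}. D $$ (k, i) * B $$ (i, j))"
        using True by (intro sum.mono_neutral_right) (auto simp: D_def)
      also have "\<dots> = ((-1) ^ d * B $$ (0, j) + B $$ (d, j)) / 2"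
        using True assms by (simp add: D_def add_divide_distrib)
      also have "\<dots> = 1\<^sub>m (d + 1) $$ (k, j)"
        using True j assms by (auto simp: B_def B_mat_def pi minus_one_power_iff)
      finally show ?thesis using eq by simp
    qed
  qed (use B D in auto)
  hence "B * D = 1\<^sub>m (d + 1)" using mat_mult_left_right_inverse[OF D B] by simp
  hence "B \<in> Units (ring_mat TYPE('k) (d + 1) ())"
    using \<open>D * B = 1\<^sub>m (d + 1)\<close> B D by (auto simp: Units_def ring_mat_simps)
  hence "mat_inverse B \<noteq> None" using mat_inverse(1)[OF B, where b = "()"] by blast
  hence "mat_inverse B = Some (B_inv d)" by (auto simp: B_inv_def B_def)
  thus "B_inv d * B_mat d = (1\<^sub>m (d + 1) :: 'k mat)" "B_mat d * B_inv d = (1\<^sub>m (d + 1) :: 'k mat)"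
    using mat_inverse(2)[OF B] by (auto simp: B_def)
qed

definition g_map :: "nat \<Rightarrow> 'k::field ratmap" where
  "g_map d = rat_comp d (linear_map d (B_inv d)) (rat_comp d (cremona d) (linear_map d (B_mat d)))"


section \<open>The vectors and the function \<open>\<Psi>\<close>\<close>

definition U_set :: "nat \<Rightarrow> int vec set" where
  "U_set d = insert (0\<^sub>v d) ((\<lambda>i. - unit_vec d i) ` {..<d})"

text \<open>
  Write \<open>b\<^sub>j\<close> for the coordinates of \<open>B\<close>. Up to sign and a common factor, the coordinates
  of \<open>g\<close> are \<open>g\<^sub>k = x\<^sub>k / (b\<^sub>k b\<^sub>k\<^sub>+\<^sub>1)\<close>, indices of \<open>b\<close> taken modulo \<open>d + 1\<close>. So \<open>b\<^sub>j\<close> has order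
  \<open>- epsilon d j k\<close> in \<open>g\<^sub>k\<close>, and the entry of \<open>v\<^sub>j\<close> belonging to \<open>k \<in> {1..d}\<close> is the order of
  \<open>b\<^sub>j\<close> in \<open>g\<^sub>k / g\<^sub>0\<close>. That entry has position \<open>k - 1\<close> in the vector.
\<close>

definition epsilon :: "nat \<Rightarrow> nat \<Rightarrow> nat \<Rightarrow> int" where
  "epsilon d j k =
     (if j mod (d + 1) = k mod (d + 1) \<or> j mod (d + 1) = (k + 1) mod (d + 1) then 1 else 0)"

definition v_vec :: "nat \<Rightarrow> nat \<Rightarrow> int vec" where
  "v_vec d j = vec d (\<lambda>k. epsilon d j 0 - epsilon d j (k + 1))"

definition V_set :: "nat \<Rightarrow> int vec set" where
  "V_set d = v_vec d ` {..d}"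

definition Psi :: "int vec set \<Rightarrow> int vec set \<Rightarrow> int mat \<Rightarrow> int" where
  "Psi U V A = (\<Sum>v\<in>V. Max ((\<lambda>u. u \<bullet> (A *\<^sub>v v)) ` U))"

end

(*
  Write f^n in coordinates that are monomials in "atoms": the coordinate functions x_i (level 0) and,
  for m > 0, the strict transforms Q_{m,i} of the hyperplanes b_i = 0 under h_A o f^(m-1). Since g maps
  b_i = 0 to a point whose blow-up is governed by v_i, the exponent of Q_{m,i} in the k-th coordinate
  of h_A o f^(n-1) is the k-th entry of A^(n-m) v_i, normalised to have minimum 0. If this minimum is
  always attained only once, then the atoms are pairwise coprime, so the coordinates have no common
  factor and deg f^n = d * D_n with
    D_n = c_n + sum_{0<m<n} D_m P_{n-m},   P_j = Psi(A^j),
  where c_n is the degree of the monomial map h_{A^n}. A tie of two entries for A = At^N is a zero of a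
  linear functional along an orbit of At. By the Skolem-Mahler-Lech argument infinitely many zeros would
  fill an arithmetic progression; as no power of xi is real, irreducibility of the characteristic
  polynomial then makes the functional vanish on the whole orbit, which spans. So ties do not occur for
  large N. Finally P is submultiplicative up to a constant, and c_n is at most a multiple of P_n;
  hence D_n^(1/n) tends to the root lambda of sum_j P_j lambda^(-j) = 1.
*)

theory Submission
  imports Defs "HOL-Computational_Algebra.Field_as_Ring"
begin

section \<open>Substitution and homogeneity\<close>

text \<open>The shape of \<open>Psi\<close> comes from homogeneity: the rays of projective space sum
  to zero, and so do the \<open>v_i\<close>; hence the normalised exponents of all atoms of one
  level add up, in every coordinate, to minus the sum of the minima, and a maximum over
  \<open>U_set\<close> is minus such a minimum. The factor d is the degree of the forms of g. The
  obstacle is to show that nothing cancels. Instead of factoring atoms into primes, coprimality is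
  carried as a cancellation property: across levels it comes from the unique minimum, within a level
  from an inverse of h_A o f^(n-1) whose spurious factors consist of earlier atoms only. The prime
  in the Skolem-Mahler-Lech argument is 3 because 3^i / i! tends to zero 3-adically, while 2^i / i!
  does not tend to zero 2-adically; determinant 1 makes the matrix invertible modulo 3.
  Submultiplicativity of P is inherited from a matrix norm: the orbit of v_0 spans, so P_n and the
  norm of A^n bound each other up to constants.\<close>

abbreviation lk :: "('a \<Rightarrow>\<^sub>0 'b::zero) \<Rightarrow> 'a \<Rightarrow> 'b" where "lk \<equiv> Poly_Mapping.lookup"
abbreviation keys :: "('a \<Rightarrow>\<^sub>0 'b::zero) \<Rightarrow> 'a set" where "keys \<equiv> Poly_Mapping.keys"

lemma sum_single: fixes p :: "_ \<Rightarrow>\<^sub>0 _ :: comm_monoid_add" shows "(\<Sum>m\<in>keys p. Poly_Mapping.single m (lk p m)) = p"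
proof (rule poly_mapping_eqI)
  fix k
  show "lk (\<Sum>m\<in>keys p. Poly_Mapping.single m (lk p m)) k = lk p k"
    by (cases "k \<in> keys p")
      (auto simp: lookup_sum lookup_single when_def sum.delta in_keys_iff)
qed

lemma mpoly_induct [case_names zero single add]:
  fixes p :: "_ \<Rightarrow>\<^sub>0 _ :: comm_monoid_add"
  assumes "P 0" "\<And>m c. P (Poly_Mapping.single m c)" "\<And>p q. P p \<Longrightarrow> P q \<Longrightarrow> P (p + q)"
  shows "P p"
proof -
  have "finite S \<Longrightarrow> P (\<Sum>m\<in>S. Poly_Mapping.single m (lk p m))" for S
    by (induction S rule: finite_induct) (auto intro: assms)
  thus ?thesis using sum_single[of p] by (metis finite_keys)
qed

definition mon_subst :: "(nat \<Rightarrow> 'a::comm_monoid_mult) \<Rightarrow> (nat \<Rightarrow>\<^sub>0 nat) \<Rightarrow> 'a" where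
  "mon_subst G m = (\<Prod>i\<in>keys m. G i ^ lk m i)"

lemma mon_subst_superset: "finite S \<Longrightarrow> keys m \<subseteq> S \<Longrightarrow> mon_subst G m = (\<Prod>i\<in>S. G i ^ lk m i)"
  unfolding mon_subst_def by (rule prod.mono_neutral_left) (auto simp: in_keys_iff)

lemma mon_subst_add: "mon_subst G (m + n) = mon_subst G m * mon_subst G n"
proof -
  let ?S = "keys m \<union> keys n"
  have "mon_subst G (m + n) = (\<Prod>i\<in>?S. G i ^ lk (m + n) i)"
    by (rule mon_subst_superset) (auto simp: keys_add)
  also have "\<dots> = (\<Prod>i\<in>?S. G i ^ lk m i) * (\<Prod>i\<in>?S. G i ^ lk n i)"
    by (simp add: lookup_add power_add prod.distrib)
  finally show ?thesis by (simp add: mon_subst_superset[of ?S])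
qed

lemma C_0 [simp]: "C 0 = 0" and C_1 [simp]: "C 1 = 1"
  and C_add: "C (a + b) = C a + C b" and C_mult: "C (a * b) = C a * C b"
  by (simp_all add: C_def single_add mult_single)

lemma C_uminus: "C (- a) = - C a"
  by (simp add: C_def single_uminus)

lemma subst_superset:
  "finite S \<Longrightarrow> keys p \<subseteq> S \<Longrightarrow> mpoly_subst G p = (\<Sum>m\<in>S. C (lk p m) * mon_subst G m)"
  unfolding mpoly_subst_def mon_subst_def
  by (rule sum.mono_neutral_left) (auto simp: in_keys_iff)

lemma subst_add [simp]: "mpoly_subst G (p + q) = mpoly_subst G p + mpoly_subst G q"
proof -
  let ?S = "keys p \<union> keys q"
  have "mpoly_subst G (p + q) = (\<Sum>m\<in>?S. C (lk (p + q) m) * mon_subst G m)"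
    by (rule subst_superset) (auto simp: keys_add)
  thus ?thesis by (simp add: subst_superset[of ?S] lookup_add C_add ring_distribs sum.distrib)
qed

lemma subst_0 [simp]: "mpoly_subst G 0 = 0"
  by (simp add: mpoly_subst_def)

lemma subst_single: "mpoly_subst G (Poly_Mapping.single m c) = C c * mon_subst G m"
  by (subst subst_superset[of "{m}"]) auto

lemma subst_C [simp]: "mpoly_subst G (C c) = C c"
  by (simp add: C_def subst_single mon_subst_def)

lemma subst_1 [simp]: "mpoly_subst G 1 = 1"
  using subst_C[of G 1] by simp

lemma subst_X [simp]: "mpoly_subst G (X i) = G i"
  by (simp add: X_def subst_single mon_subst_def)

lemma subst_mult [simp]: "mpoly_subst G (p * q) = mpoly_subst G p * mpoly_subst G q"
proof (induction p rule: mpoly_induct)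
  case (single m c)
  show ?case
    by (induction q rule: mpoly_induct)
      (auto simp: mult_single subst_single mon_subst_add C_mult ring_distribs)
qed (auto simp: ring_distribs)

lemma subst_sum [simp]: "mpoly_subst G (sum f S) = (\<Sum>x\<in>S. mpoly_subst G (f x))"
  by (induction S rule: infinite_finite_induct) auto

lemma subst_prod [simp]: "mpoly_subst G (prod f S) = (\<Prod>x\<in>S. mpoly_subst G (f x))"
  by (induction S rule: infinite_finite_induct) auto

lemma subst_power [simp]: "mpoly_subst G (p ^ n) = mpoly_subst G p ^ n"
  by (induction n) auto

lemma subst_subst: "mpoly_subst G (mpoly_subst H p) = mpoly_subst (\<lambda>i. mpoly_subst G (H i)) p"
  by (simp add: mpoly_subst_def[of H p] mpoly_subst_def[of "\<lambda>i. mpoly_subst G (H i)" p])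

lemma subst_id: "mpoly_subst X p = p"
proof (induction p rule: mpoly_induct)
  case (single m c)
  have p: "X i ^ n = (Poly_Mapping.single (Poly_Mapping.single i n) 1 :: 'a mpoly)" for i n
    by (induction n) (auto simp: X_def mult_single simp flip: single_add)
  have *: "finite S \<Longrightarrow> (\<Prod>i\<in>S. X i ^ lk m i)
      = (Poly_Mapping.single (\<Sum>i\<in>S. Poly_Mapping.single i (lk m i)) 1 :: 'a mpoly)" for S
    by (induction S rule: finite_induct) (auto simp: p mult_single)
  show ?case
    by (simp add: subst_single mon_subst_def * sum_single C_def mult_single)
qed auto

lemma subst_cong:
  assumes "\<And>m i. m \<in> keys p \<Longrightarrow> i \<in> keys m \<Longrightarrow> G i = H i"
  shows "mpoly_subst G p = mpoly_subst H p"
  unfolding mpoly_subst_def using assms by (intro sum.cong arg_cong2[where f = "(*)"] prod.cong) auto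

section \<open>Homogeneous polynomials and forms\<close>

definition mdeg :: "nat \<Rightarrow> (nat \<Rightarrow>\<^sub>0 nat) \<Rightarrow> nat" where
  "mdeg d m = (\<Sum>i\<le>d. lk m i)"

text \<open>
  Homogeneity in \<open>X 0, \<dots>, X d\<close> alone; the remaining variables count as constants. This is needed
  because \<open>no_common_factor\<close> quantifies over polynomials in all variables.
\<close>

definition hform :: "nat \<Rightarrow> nat \<Rightarrow> 'k::comm_ring_1 mpoly \<Rightarrow> bool" where
  "hform d n p \<longleftrightarrow> (\<forall>m\<in>keys p. mdeg d m = n)"

definition in_vars :: "nat \<Rightarrow> 'k::comm_ring_1 mpoly \<Rightarrow> bool" where
  "in_vars d p \<longleftrightarrow> (\<forall>m\<in>keys p. keys m \<subseteq> {..d})"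

lemma is_form_iff: "is_form d n p \<longleftrightarrow> in_vars d p \<and> hform d n p"
proof -
  have "(\<Sum>i\<in>keys m. lk m i) = mdeg d m" if "keys m \<subseteq> {..d}" for m
    unfolding mdeg_def using that by (intro sum.mono_neutral_left) (auto simp: in_keys_iff)
  thus ?thesis unfolding is_form_def in_vars_def hform_def by auto
qed

lemma mdeg_add: "mdeg d (m + n) = mdeg d m + mdeg d n"
  by (simp add: mdeg_def lookup_add sum.distrib)

lemma hform_0 [simp]: "hform d n 0" and in_vars_0 [simp]: "in_vars d 0"
  by (auto simp: hform_def in_vars_def)

lemma hform_add: "hform d n p \<Longrightarrow> hform d n q \<Longrightarrow> hform d n (p + q)"
  unfolding hform_def using keys_add[of p q] by (meson UnE subsetD)

lemma in_vars_add: "in_vars d p \<Longrightarrow> in_vars d q \<Longrightarrow> in_vars d (p + q)"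
  unfolding in_vars_def using keys_add[of p q] by (meson UnE subsetD)

lemma hform_mult: "hform d n p \<Longrightarrow> hform d k q \<Longrightarrow> hform d (n + k) (p * q)"
  unfolding hform_def
proof
  fix m assume *: "\<forall>m\<in>keys p. mdeg d m = n" "\<forall>m\<in>keys q. mdeg d m = k" and "m \<in> keys (p * q)"
  then obtain a b where "m = a + b" "a \<in> keys p" "b \<in> keys q"
    using keys_mult[of p q] by auto
  thus "mdeg d m = n + k" using * by (simp add: mdeg_add)
qed

lemma in_vars_mult: "in_vars d p \<Longrightarrow> in_vars d q \<Longrightarrow> in_vars d (p * q)"
  unfolding in_vars_def
proof
  fix m assume *: "\<forall>m\<in>keys p. keys m \<subseteq> {..d}" "\<forall>m\<in>keys q. keys m \<subseteq> {..d}" and "m \<in> keys (p * q)"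
  then obtain a b where "m = a + b" "a \<in> keys p" "b \<in> keys q"
    using keys_mult[of p q] by auto
  thus "keys m \<subseteq> {..d}" using * keys_add[of a b] by blast
qed

lemma hform_C [simp]: "hform d 0 (C c)" and in_vars_C [simp]: "in_vars d (C c)"
  by (auto simp: hform_def in_vars_def C_def mdeg_def)

lemma hform_1 [simp]: "hform d 0 1" and in_vars_1 [simp]: "in_vars d 1"
  using hform_C[of d 1] in_vars_C[of d 1] by auto

lemma hform_X: "hform d (if i \<le> d then 1 else 0) (X i)" and in_vars_X: "i \<le> d \<Longrightarrow> in_vars d (X i)"
  by (auto simp: hform_def in_vars_def X_def mdeg_def lookup_single when_def)

lemma hform_sum: "(\<And>x. x \<in> S \<Longrightarrow> hform d n (f x)) \<Longrightarrow> hform d n (sum f S)"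
  by (induction S rule: infinite_finite_induct) (auto intro: hform_add)

lemma in_vars_sum: "(\<And>x. x \<in> S \<Longrightarrow> in_vars d (f x)) \<Longrightarrow> in_vars d (sum f S)"
  by (induction S rule: infinite_finite_induct) (auto intro: in_vars_add)

lemma hform_prod: "(\<And>x. x \<in> S \<Longrightarrow> hform d (n x) (f x)) \<Longrightarrow> hform d (\<Sum>x\<in>S. n x) (prod f S)"
  by (induction S rule: infinite_finite_induct) (auto intro: hform_mult)

lemma in_vars_prod: "(\<And>x. x \<in> S \<Longrightarrow> in_vars d (f x)) \<Longrightarrow> in_vars d (prod f S)"
  by (induction S rule: infinite_finite_induct) (auto intro: in_vars_mult)

lemma hform_power: "hform d n p \<Longrightarrow> hform d (k * n) (p ^ k)"
  by (induction k) (auto intro: hform_mult)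

lemma in_vars_power: "in_vars d p \<Longrightarrow> in_vars d (p ^ k)"
  by (induction k) (auto intro: in_vars_mult)

lemma hform_C_mult: "hform d n p \<Longrightarrow> hform d n (C c * p)"
  using hform_mult[OF hform_C, of d n p c] by simp

lemma is_form_X: "i \<le> d \<Longrightarrow> is_form d 1 (X i)"
  using hform_X[of d i] by (simp add: is_form_iff in_vars_X)

lemma is_form_C_mult: "is_form d n p \<Longrightarrow> is_form d n (C c * p)"
  by (simp add: is_form_iff hform_C_mult in_vars_mult)

lemma is_form_prod: "(\<And>x. x \<in> S \<Longrightarrow> is_form d (n x) (f x)) \<Longrightarrow> is_form d (\<Sum>x\<in>S. n x) (prod f S)"
  by (simp add: is_form_iff hform_prod in_vars_prod)

lemma is_form_sum: "(\<And>x. x \<in> S \<Longrightarrow> is_form d n (f x)) \<Longrightarrow> is_form d n (sum f S)"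
  by (simp add: is_form_iff hform_sum in_vars_sum)

lemma is_form_power: "is_form d n p \<Longrightarrow> is_form d (k * n) (p ^ k)"
  by (simp add: is_form_iff hform_power in_vars_power)

text \<open>Variables above \<open>d\<close> have degree 0, so they must be replaced by elements of
  degree 0. This is one reason why \<open>lin\<close>, \<open>ghat\<close> and
  \<open>mono_tup\<close> are continued by \<open>X k\<close> beyond \<open>d\<close>.\<close>

lemma hform_subst:
  assumes "hform d n p" and "\<And>i. hform d (if i \<le> d then e else 0) (G i)"
  shows "hform d (n * e) (mpoly_subst G p)"
  unfolding mpoly_subst_def
proof (rule hform_sum)
  fix m assume m: "m \<in> keys p"
  have "hform d (\<Sum>i\<in>keys m. lk m i * (if i \<le> d then e else 0)) (\<Prod>i\<in>keys m. G i ^ lk m i)"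
    by (intro hform_prod hform_power assms)
  moreover have "(\<Sum>i\<in>keys m. lk m i * (if i \<le> d then e else 0)) = n * e"
  proof -
    have "(\<Sum>i\<in>keys m. lk m i * (if i \<le> d then e else 0)) = (\<Sum>i\<in>keys m \<inter> {..d}. lk m i * e)"
      by (simp add: if_distrib sum.If_cases Int_def cong: if_cong)
    also have "\<dots> = (\<Sum>i\<le>d. lk m i * e)"
      by (rule sum.mono_neutral_left) (auto simp: in_keys_iff)
    also have "\<dots> = n * e"
      using assms(1) m by (auto simp: hform_def mdeg_def simp flip: sum_distrib_right)
    finally show ?thesis .
  qed
  ultimately show "hform d (n * e) (C (lk p m) * (\<Prod>i\<in>keys m. G i ^ lk m i))"
    using hform_C_mult by metis
qed

lemma in_vars_subst:
  assumes "in_vars d p" and "\<And>i. i \<le> d \<Longrightarrow> in_vars d (G i)"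
  shows "in_vars d (mpoly_subst G p)"
  unfolding mpoly_subst_def
  using assms by (intro in_vars_sum in_vars_mult in_vars_prod in_vars_power) (auto simp: in_vars_def[of d p])

lemma is_form_subst:
  assumes "is_form d n p" and "\<And>i. i \<le> d \<Longrightarrow> is_form d e (G i)"
  shows "is_form d (n * e) (mpoly_subst G p)"
proof -
  let ?G = "\<lambda>i. if i \<le> d then G i else 1"
  have eq: "mpoly_subst G p = mpoly_subst ?G p"
    using assms(1) by (intro subst_cong) (auto simp: is_form_def subset_iff)
  have "hform d (n * e) (mpoly_subst ?G p)"
    using assms by (intro hform_subst) (auto simp: is_form_iff)
  moreover have "in_vars d (mpoly_subst G p)"
    using assms by (intro in_vars_subst) (auto simp: is_form_iff)
  ultimately show ?thesis by (simp add: is_form_iff eq)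
qed

lemma subst_scale:
  assumes "hform d n p" and "\<And>i. i \<le> d \<Longrightarrow> G i = c * H i" and "\<And>i. i > d \<Longrightarrow> G i = H i"
  shows "mpoly_subst G p = c ^ n * mpoly_subst H p"
proof -
  have "(\<Prod>i\<in>keys m. G i ^ lk m i) = c ^ n * (\<Prod>i\<in>keys m. H i ^ lk m i)" if m: "m \<in> keys p" for m
  proof -
    have "(\<Prod>i\<in>keys m. G i ^ lk m i) = (\<Prod>i\<in>keys m. (if i \<le> d then c else 1) ^ lk m i * H i ^ lk m i)"
      using assms by (intro prod.cong) (auto simp: power_mult_distrib)
    also have "\<dots> = (\<Prod>i\<in>keys m. (if i \<le> d then c else 1) ^ lk m i) * (\<Prod>i\<in>keys m. H i ^ lk m i)"
      by (rule prod.distrib)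
    also have "(\<Prod>i\<in>keys m. (if i \<le> d then c else 1) ^ lk m i) = (\<Prod>i\<in>keys m \<inter> {..d}. c ^ lk m i)"
      by (simp add: if_distrib[of "\<lambda>x. x ^ _"] prod.If_cases Int_def cong: if_cong)
    also have "\<dots> = (\<Prod>i\<le>d. c ^ lk m i)"
      by (rule prod.mono_neutral_left) (auto simp: in_keys_iff intro!: gr0I)
    also have "\<dots> = c ^ n"
      using assms(1) m by (auto simp: hform_def mdeg_def power_sum)
    finally show ?thesis .
  qed
  thus ?thesis unfolding mpoly_subst_def by (simp add: sum_distrib_left mult.left_commute)
qed

lemma subst_scale_form:
  assumes "is_form d n p" and "\<And>i. i \<le> d \<Longrightarrow> G i = c * H i"
  shows "mpoly_subst G p = c ^ n * mpoly_subst H p"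
proof -
  let ?G = "\<lambda>i. if i \<le> d then G i else 1" and ?H = "\<lambda>i. if i \<le> d then H i else 1"
  have eq: "mpoly_subst G p = mpoly_subst ?G p" "mpoly_subst H p = mpoly_subst ?H p"
    using assms(1) by (auto intro!: subst_cong simp: is_form_def subset_iff)
  show ?thesis unfolding eq using assms by (intro subst_scale) (auto simp: is_form_iff)
qed

section \<open>Homogeneous components\<close>

definition hcomp :: "nat \<Rightarrow> nat \<Rightarrow> 'k mpoly \<Rightarrow> 'k::comm_ring_1 mpoly" where
  "hcomp d n p = Poly_Mapping.mapp (\<lambda>m c. if mdeg d m = n then c else 0) p"

lemma lookup_hcomp: "lk (hcomp d n p) m = (if mdeg d m = n then lk p m else 0)"
  by (auto simp: hcomp_def lookup_mapp when_def in_keys_iff)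

lemma hform_hcomp: "hform d n (hcomp d n p)"
  by (auto simp: hform_def in_keys_iff lookup_hcomp split: if_splits)

lemma hcomp_add: "hcomp d n (p + q) = hcomp d n p + hcomp d n q"
  by (rule poly_mapping_eqI) (simp add: lookup_hcomp lookup_add)

lemma hcomp_0 [simp]: "hcomp d n 0 = 0"
  by (rule poly_mapping_eqI) (simp add: lookup_hcomp)

lemma hcomp_hform: "hform d k p \<Longrightarrow> hcomp d n p = (if n = k then p else 0)"
  by (rule poly_mapping_eqI) (auto simp: lookup_hcomp hform_def in_keys_iff)

lemma hcomp_mult:
  assumes "hform d k p"
  shows "hcomp d n (p * q) = (if k \<le> n then p * hcomp d (n - k) q else 0)"
proof (induction q rule: mpoly_induct)
  case (single m c)
  have h: "hform d (mdeg d m) (Poly_Mapping.single m c)"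
    by (auto simp: hform_def)
  show ?case
    using hcomp_hform[OF hform_mult[OF assms h], of n] hcomp_hform[OF h, of "n - k"] by auto
qed (auto simp: ring_distribs hcomp_add)

lemma sum_hcomp: "(\<Sum>n\<in>mdeg d ` keys p. hcomp d n p) = p"
proof (rule poly_mapping_eqI)
  fix m
  show "lk (\<Sum>n\<in>mdeg d ` keys p. hcomp d n p) m = lk p m"
    by (cases "m \<in> keys p") (auto simp: lookup_sum lookup_hcomp sum.delta in_keys_iff)
qed

section \<open>Coprimality\<close>

text \<open>
  A substitute for unique factorisation: \<open>q\<close> is a non-zero-divisor modulo \<open>p\<close>.
\<close>

definition cop :: "'a::idom \<Rightarrow> 'a \<Rightarrow> bool" where
  "cop p q \<longleftrightarrow> (\<forall>a. p dvd q * a \<longrightarrow> p dvd a)"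

lemma copD: "cop p q \<Longrightarrow> p dvd q * a \<Longrightarrow> p dvd a"
  unfolding cop_def by blast

lemma cop_1 [simp]: "cop p 1" "cop 1 p"
  unfolding cop_def by simp_all

lemma cop_mult_right: "cop p q \<Longrightarrow> cop p r \<Longrightarrow> cop p (q * r)"
  unfolding cop_def mult.assoc by blast

lemma cop_prod_right: "(\<And>x. x \<in> S \<Longrightarrow> cop p (f x)) \<Longrightarrow> cop p (prod f S)"
  by (induction S rule: infinite_finite_induct) (auto intro: cop_mult_right)

lemma cop_power_right: "cop p q \<Longrightarrow> cop p (q ^ n)"
  by (induction n) (auto intro: cop_mult_right)

text \<open>If \<open>p * a = q * c\<close>, then \<open>p\<close> divides \<open>c\<close>, and
  cancelling \<open>p\<close> leaves a factor \<open>q\<close> in \<open>a\<close>.\<close>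

lemma cop_sym:
  assumes "cop p q" "p \<noteq> 0"
  shows "cop q p"
  unfolding cop_def
proof (intro allI impI)
  fix a assume "q dvd p * a"
  then obtain c where c: "p * a = q * c" by (auto elim: dvdE)
  hence "p dvd c" using assms(1) by (metis copD dvd_triv_left)
  then obtain r where "c = p * r" by (auto elim: dvdE)
  with c assms(2) have "a = q * r" by (metis mult.left_commute mult_left_cancel)
  thus "q dvd a" by simp
qed

lemma cop_mult_dvd: "cop p q \<Longrightarrow> p dvd a \<Longrightarrow> q dvd a \<Longrightarrow> p * q dvd a"
  by (metis copD dvdE dvd_triv_left mult.commute mult_dvd_mono dvd_refl)

lemma cop_power: "cop p q \<Longrightarrow> p \<noteq> 0 \<Longrightarrow> q \<noteq> 0 \<Longrightarrow> cop (p ^ m) (q ^ n)"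
  by (meson cop_power_right cop_sym power_not_zero)

lemma cop_prod_dvd:
  assumes "finite S" and "\<And>x y. x \<in> S \<Longrightarrow> y \<in> S \<Longrightarrow> x \<noteq> y \<Longrightarrow> cop (f x) (f y)"
    and "\<And>x. x \<in> S \<Longrightarrow> f x \<noteq> 0" and "\<And>x. x \<in> S \<Longrightarrow> f x dvd a"
  shows "prod f S dvd a"
  using assms
proof (induction S rule: finite_induct)
  case (insert x S)
  have "cop (f x) (prod f S)"
    using insert by (intro cop_prod_right) auto
  thus ?case using insert by (simp add: cop_mult_dvd)
qed auto

text \<open>Only the residue modulo \<open>q\<close> matters. For atoms, \<open>r\<close> will be
  the one summand that is not divisible by the earlier atom \<open>q\<close>.\<close>

lemma cop_congruent:
  assumes "cop q r" and "p = r + q * s"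
  shows "cop q p"
  unfolding cop_def
proof (intro allI impI)
  fix a assume "q dvd p * a"
  hence "q dvd r * a + q * (s * a)" by (simp add: assms(2) ring_distribs mult.assoc)
  hence "q dvd r * a" by (simp add: dvd_add_left_iff)
  thus "q dvd a" using assms(1) copD by blast
qed

text \<open>As \<open>p\<close> and \<open>q\<close> are homogeneous, \<open>p dvd q * a\<close>
  passes to each homogeneous component of \<open>a\<close>. The reduction is needed because
  proportional tuples rescale only homogeneous polynomials by a common factor.\<close>

lemma cop_hform:
  fixes p q :: "'k::idom mpoly"
  assumes p: "hform d k p" and q: "hform d l q"
    and *: "\<And>n a. hform d n a \<Longrightarrow> p dvd q * a \<Longrightarrow> p dvd a"
  shows "cop p q"
  unfolding cop_def
proof (intro allI impI)
  fix a assume "p dvd q * a"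
  then obtain c where c: "q * a = p * c" by (auto elim: dvdE)
  have "p dvd hcomp d n a" for n
  proof (rule *[OF hform_hcomp])
    have "q * hcomp d n a = hcomp d (n + l) (q * a)"
      by (simp add: hcomp_mult[OF q])
    thus "p dvd q * hcomp d n a"
      by (simp add: c hcomp_mult[OF p])
  qed
  hence "p dvd (\<Sum>n\<in>mdeg d ` keys a. hcomp d n a)" by (intro dvd_sum)
  thus "p dvd a" by (simp add: sum_hcomp)
qed

lemma X_dvd_iff: "X i dvd p \<longleftrightarrow> (\<forall>m\<in>keys p. lk m i \<noteq> 0)"
proof
  assume "X i dvd p"
  then obtain q where q: "p = X i * q" by (auto elim: dvdE)
  show "\<forall>m\<in>keys p. lk m i \<noteq> 0"
  proof
    fix m assume "m \<in> keys p"
    then obtain a b where "m = a + b" "a \<in> keys (X i :: 'a mpoly)"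
      using keys_mult[of "X i" q] unfolding q by blast
    thus "lk m i \<noteq> 0" by (auto simp: X_def lookup_add split: if_splits)
  qed
next
  assume *: "\<forall>m\<in>keys p. lk m i \<noteq> 0"
  have "X i dvd Poly_Mapping.single m (lk p m)" if "m \<in> keys p" for m
  proof -
    let ?m = "m - Poly_Mapping.single i 1"
    have "m = Poly_Mapping.single i 1 + ?m"
      using * that by (intro poly_mapping_eqI) (auto simp: lookup_add lookup_minus lookup_single when_def)
    hence "Poly_Mapping.single m (lk p m) = X i * Poly_Mapping.single ?m (lk p m)"
      by (simp add: X_def mult_single)
    thus ?thesis by simp
  qed
  hence "X i dvd (\<Sum>m\<in>keys p. Poly_Mapping.single m (lk p m))" by (intro dvd_sum)
  thus "X i dvd p" by (simp add: sum_single)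
qed

lemma X_nonzero [simp]: "X i \<noteq> (0 :: 'k::idom mpoly)"
proof
  assume "X i = (0 :: 'k mpoly)"
  hence "lk (X i) (Poly_Mapping.single i 1) = (0 :: 'k)" by simp
  thus False by (simp add: X_def)
qed

lemma lookup_X_mult: "lk (X j * p) (Poly_Mapping.single j 1 + m) = lk (p :: 'k::idom mpoly) m"
proof (induction p rule: mpoly_induct)
  case (single n c)
  show ?case by (simp add: X_def mult_single lookup_single when_def)
qed (auto simp: ring_distribs lookup_add)

lemma cop_X:
  assumes "i \<noteq> j"
  shows "cop (X i) (X j :: 'k::idom mpoly)"
  unfolding cop_def
proof (intro allI impI)
  fix a :: "'k mpoly" assume a: "X i dvd X j * a"
  have "lk m i \<noteq> 0" if "m \<in> keys a" for m
  proof -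
    have "Poly_Mapping.single j 1 + m \<in> keys (X j * a)"
      using that lookup_X_mult[of j a m] by (simp add: in_keys_iff)
    hence "lk (Poly_Mapping.single j 1 + m) i \<noteq> 0" using a X_dvd_iff by blast
    thus ?thesis using assms by (simp add: lookup_add lookup_single)
  qed
  thus "X i dvd a" by (simp add: X_dvd_iff)
qed

lemma X_not_unit: "\<not> X i dvd (1 :: 'k::idom mpoly)"
  by (simp add: X_dvd_iff)

section \<open>Classes of proportional tuples\<close>

definition proportional :: "nat \<Rightarrow> (nat \<Rightarrow> 'a::idom) \<Rightarrow> (nat \<Rightarrow> 'a) \<Rightarrow> bool" where
  "proportional d F G \<longleftrightarrow> (\<forall>i\<le>d. \<forall>j\<le>d. F i * G j = F j * G i)"

lemma proportional_sym: "proportional d F G \<Longrightarrow> proportional d G F"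
  unfolding proportional_def by (metis mult.commute)

lemma proportionalI_base:
  assumes "G 0 \<noteq> 0" and "\<And>i. i \<le> d \<Longrightarrow> F i * G 0 = F 0 * G i"
  shows "proportional d F G"
  unfolding proportional_def
proof (intro allI impI)
  fix i j assume ij: "i \<le> d" "j \<le> d"
  have "F i * G j * G 0 = F 0 * G i * G j"
    using assms(2)[OF ij(1)] by (metis mult.commute mult.assoc)
  also have "\<dots> = F j * G i * G 0"
    using assms(2)[OF ij(2)] by (metis mult.commute mult.left_commute)
  finally show "F i * G j = F j * G i" using assms(1) by simp
qed

text \<open>The zero tuple is proportional to everything, so the middle tuple must have a non-zero
  entry; its square is cancelled at the end.\<close>

lemma proportional_trans:
  assumes "proportional d F G" "proportional d G H" "\<exists>k\<le>d. G k \<noteq> 0"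
  shows "proportional d F H"
  unfolding proportional_def
proof (intro allI impI)
  fix i j assume ij: "i \<le> d" "j \<le> d"
  obtain k where k: "k \<le> d" "G k \<noteq> 0" using assms(3) by blast
  have *: "F i * G k = F k * G i" "F j * G k = F k * G j"
    "G k * H j = G j * H k" "G k * H i = G i * H k"
    using assms(1,2) ij k unfolding proportional_def by blast+
  have "(F i * H j) * (G k * G k) = (F i * G k) * (G k * H j)" by (simp add: algebra_simps)
  also have "\<dots> = (F j * G k) * (G k * H i)" unfolding * by (simp add: algebra_simps)
  also have "\<dots> = (F j * H i) * (G k * G k)" by (simp add: algebra_simps)
  finally show "F i * H j = F j * H i" using k by simp
qed

lemma ratmap_of_iff: "G \<in> ratmap_of d F \<longleftrightarrow> G \<in> form_tuples d \<and> proportional d F (G :: nat \<Rightarrow> 'k::idom mpoly)"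
  by (simp add: ratmap_of_def proportional_def)

lemma ratmap_of_self: "F \<in> form_tuples d \<Longrightarrow> F \<in> ratmap_of d (F :: nat \<Rightarrow> 'k::idom mpoly)"
  by (simp add: ratmap_of_iff proportional_def mult.commute)

lemma ratmap_of_eqI:
  fixes F G :: "nat \<Rightarrow> 'k::idom mpoly"
  assumes "proportional d F G" "\<exists>k\<le>d. F k \<noteq> 0" "\<exists>k\<le>d. G k \<noteq> 0"
  shows "ratmap_of d F = ratmap_of d G"
proof -
  have "proportional d F K \<longleftrightarrow> proportional d G K" for K
    using assms by (meson proportional_trans proportional_sym)
  thus ?thesis by (auto simp: ratmap_of_iff)
qed

lemma form_tuplesI:
  "(\<And>j. j \<le> d \<Longrightarrow> is_form d n (F j)) \<Longrightarrow> i \<le> d \<Longrightarrow> F i \<noteq> 0 \<Longrightarrow> F \<in> form_tuples d"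
  by (auto simp: form_tuples_def)

text \<open>Replacing \<open>G\<close> by a proportional \<open>G'\<close> multiplies a form of
  degree \<open>n\<close> by \<open>(G' l / G l)^n\<close>, the same factor in all coordinates.
  Replacing \<open>F\<close> preserves cross products, since substitution is a ring homomorphism. So
  the union in \<open>rat_comp\<close> consists of a single class.\<close>

lemma rat_comp_ratmap_of:
  fixes F G :: "nat \<Rightarrow> 'k::idom mpoly"
  assumes F: "F \<in> form_tuples d" and G: "G \<in> form_tuples d"
    and nz: "\<exists>j\<le>d. mpoly_subst G (F j) \<noteq> 0"
  shows "rat_comp d (ratmap_of d F) (ratmap_of d G) = ratmap_of d (\<lambda>j. mpoly_subst G (F j))"
proof -
  have eq: "ratmap_of d (\<lambda>j. mpoly_subst G' (F' j)) = ratmap_of d (\<lambda>j. mpoly_subst G (F j))"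
    if F': "F' \<in> ratmap_of d F" and G': "G' \<in> ratmap_of d G"
      and nz': "\<exists>j\<le>d. mpoly_subst G' (F' j) \<noteq> 0" for F' G'
  proof -
    obtain n where n: "\<And>j. j \<le> d \<Longrightarrow> is_form d n (F' j)"
      using F' by (auto simp: ratmap_of_iff form_tuples_def)
    have pr: "proportional d G G'" "proportional d F F'" and "\<exists>k\<le>d. G' k \<noteq> 0"
      using F' G' by (auto simp: ratmap_of_iff form_tuples_def)
    moreover obtain l where l: "l \<le> d" "G l \<noteq> 0"
      using G by (auto simp: form_tuples_def)
    ultimately have l': "G' l \<noteq> 0"
      unfolding proportional_def by (metis mult_eq_0_iff)
    have scale: "G l ^ n * mpoly_subst G' (F' j) = G' l ^ n * mpoly_subst G (F' j)" if j: "j \<le> d" for j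
    proof -
      have "G l ^ n * mpoly_subst G' (F' j) = mpoly_subst (\<lambda>i. G l * G' i) (F' j)"
        by (rule subst_scale_form[OF n[OF j], symmetric]) simp
      also have "\<dots> = mpoly_subst (\<lambda>i. G' l * G i) (F' j)"
      proof (rule subst_cong)
        fix m i assume "m \<in> keys (F' j)" "i \<in> keys m"
        hence "i \<le> d" using n[OF j] by (auto simp: is_form_def)
        thus "G l * G' i = G' l * G i" using pr(1) l(1) unfolding proportional_def
          by (metis mult.commute)
      qed
      also have "\<dots> = G' l ^ n * mpoly_subst G (F' j)"
        by (rule subst_scale_form[OF n[OF j]]) simp
      finally show ?thesis .
    qed
    have "proportional d (\<lambda>j. mpoly_subst G' (F' j)) (\<lambda>j. mpoly_subst G (F' j))"
      unfolding proportional_def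
    proof (intro allI impI)
      fix i j assume ij: "i \<le> d" "j \<le> d"
      have "(mpoly_subst G' (F' i) * mpoly_subst G (F' j)) * (G l ^ n * G' l ^ n)
        = (G l ^ n * mpoly_subst G' (F' i)) * (G' l ^ n * mpoly_subst G (F' j))"
        by (simp add: algebra_simps)
      also have "\<dots> = (mpoly_subst G' (F' j) * mpoly_subst G (F' i)) * (G l ^ n * G' l ^ n)"
        using scale[OF ij(1)] scale[OF ij(2)] by (simp add: algebra_simps)
      finally show "mpoly_subst G' (F' i) * mpoly_subst G (F' j) = mpoly_subst G' (F' j) * mpoly_subst G (F' i)"
        using l l' by simp
    qed
    moreover have "proportional d (\<lambda>j. mpoly_subst G (F' j)) (\<lambda>j. mpoly_subst G (F j))"
      using pr(2) unfolding proportional_def by (metis subst_mult mult.commute)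
    moreover have "\<exists>j\<le>d. mpoly_subst G (F' j) \<noteq> 0"
      using nz' scale l l' by (metis mult_eq_0_iff power_not_zero)
    ultimately show ?thesis using nz nz' by (intro ratmap_of_eqI) (auto intro: proportional_trans)
  qed
  have "F \<in> ratmap_of d F" "G \<in> ratmap_of d G"
    using F G by (auto intro: ratmap_of_self)
  thus ?thesis unfolding rat_comp_def using eq nz by fast
qed

lemma form_tuples_subst:
  fixes F G :: "nat \<Rightarrow> 'k::idom mpoly"
  assumes "F \<in> form_tuples d" "G \<in> form_tuples d" "\<exists>j\<le>d. mpoly_subst G (F j) \<noteq> 0"
  shows "(\<lambda>j. mpoly_subst G (F j)) \<in> form_tuples d"
  using assms unfolding form_tuples_def by (blast intro: is_form_subst)

section \<open>The involution\<close>

definition lin :: "nat \<Rightarrow> 'k::comm_ring_1 mat \<Rightarrow> nat \<Rightarrow> 'k mpoly" where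
  "lin d M i = (if i \<le> d then (\<Sum>j\<le>d. C (M $$ (i, j)) * X j) else X i)"

abbreviation bform :: "nat \<Rightarrow> nat \<Rightarrow> 'k::field mpoly" where
  "bform d \<equiv> lin d (B_mat d)"

definition nxt :: "nat \<Rightarrow> nat \<Rightarrow> nat" where
  "nxt d k = (if k = d then 0 else Suc k)"

text \<open>The sign of \<open>bform d (nxt d k)\<close> in the relation \<open>bform_sum\<close>;
  only the wrap-around from \<open>d\<close> to 0 can produce -1.\<close>

definition sgn_d :: "nat \<Rightarrow> nat \<Rightarrow> 'a::comm_ring_1" where
  "sgn_d d k = (if k = d then (-1) ^ d else 1)"

definition ghat :: "nat \<Rightarrow> nat \<Rightarrow> 'k::field mpoly" where
  "ghat d k = (if k \<le> d then sgn_d d k * X k * (\<Prod>i\<in>{..d} - {k, nxt d k}. bform d i) else X k)"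

lemma ghat_le:
  "k \<le> d \<Longrightarrow> ghat d k = sgn_d d k * X k * (\<Prod>i\<in>{..d} - {k, nxt d k}. bform d i)"
  by (simp add: ghat_def)

lemma is_form_prod_minus:
  assumes "\<And>i. i \<le> d \<Longrightarrow> is_form d 1 (f i)" "k \<le> d"
  shows "is_form d d (\<Prod>i\<in>{..d} - {k}. f i)"
  using is_form_prod[of "{..d} - {k}" d "\<lambda>_. 1" f] assms by (simp add: card_Diff_singleton)

lemma linear_map_eq: "linear_map d M = ratmap_of d (lin d M)"
  by (simp add: linear_map_def ratmap_of_def lin_def)

lemma is_form_lin: "i \<le> d \<Longrightarrow> is_form d 1 (lin d M i)"
  by (auto simp: lin_def intro!: is_form_sum is_form_C_mult is_form_X[simplified])

lemma C_sum: "C (sum f S) = (\<Sum>x\<in>S. C (f x))"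
  by (induction S rule: infinite_finite_induct) (auto simp: C_add)

lemma subst_lin: "i \<le> d \<Longrightarrow> mpoly_subst G (lin d M i) = (\<Sum>j\<le>d. C (M $$ (i, j)) * G j)"
  by (simp add: lin_def)

lemma lin_lin:
  assumes "M \<in> carrier_mat (d + 1) (d + 1)" "N \<in> carrier_mat (d + 1) (d + 1)"
  shows "mpoly_subst (lin d M) (lin d N i) = lin d (N * M) i"
proof (cases "i \<le> d")
  case i: True
  have "(N * M) $$ (i, j) = (\<Sum>k\<le>d. N $$ (i, k) * M $$ (k, j))" if "j \<le> d" for j
    using assms that i by (simp add: scalar_prod_def atLeast0LessThan lessThan_Suc_atMost)
  hence "lin d (N * M) i = (\<Sum>j\<le>d. \<Sum>k\<le>d. C (N $$ (i, k)) * C (M $$ (k, j)) * X j)"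
    using i by (simp add: lin_def C_sum C_mult sum_distrib_right)
  also have "\<dots> = (\<Sum>k\<le>d. \<Sum>j\<le>d. C (N $$ (i, k)) * C (M $$ (k, j)) * X j)"
    by (rule sum.swap)
  finally show ?thesis using i by (simp add: subst_lin) (simp add: lin_def sum_distrib_left mult.assoc)
qed (simp add: lin_def)

lemma lin_one: "lin d (1\<^sub>m (d + 1)) = X"
  by (rule ext)
    (simp add: lin_def if_distrib[of C] if_distrib[of "\<lambda>x. x * _"] sum.delta cong: if_cong)

lemma B_carrier: "B_mat d \<in> carrier_mat (d + 1) (d + 1)"
  by (simp add: B_mat_def)

lemma sgn_d_square: "sgn_d d k * sgn_d d k = 1"
  by (simp add: sgn_d_def flip: power_mult_distrib)

lemma sgn_d_C: "C (sgn_d d k) = sgn_d d k"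
proof -
  have "C ((-1) ^ n) = ((-1) ^ n :: 'a mpoly)" for n by (induction n) (simp_all add: C_mult C_uminus)
  thus ?thesis by (simp add: sgn_d_def)
qed

context
  fixes d :: nat
  assumes two: "(2 :: 'k::field) \<noteq> 0" and d1: "d \<ge> 1"
begin

lemma nxt_neq: "nxt d k \<noteq> k" and nxt_le: "k \<le> d \<Longrightarrow> nxt d k \<le> d"
  using d1 by (auto simp: nxt_def)

text \<open>Cyclically consecutive rows of \<open>B_mat\<close>, the second taken with its sign,
  have opposite entries except in column \<open>k\<close>, where both are 1.\<close>

lemma B_rows:
  assumes "k \<le> d" "j \<le> d"
  shows "B_mat d $$ (k, j) + sgn_d d k * B_mat d $$ (nxt d k, j) = (if k = j then 2 else (0::'k))"
proof -
  have pi: "(-1 :: 'k) powi n = (if even n then 1 else -1)" for n :: int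
    by (simp add: power_int_minus_left)
  show ?thesis
  proof (cases "k = d")
    case True
    thus ?thesis using assms d1 by (auto simp: B_mat_def pi sgn_d_def minus_one_power_iff nxt_def)
  next
    case False
    thus ?thesis using assms by (auto simp: B_mat_def pi sgn_d_def nxt_def)
  qed
qed

text \<open>Half of \<open>B_rows\<close> exhibits a left inverse, and a left inverse agrees with
  the two-sided inverse \<open>B_inv\<close>.\<close>

lemma B_inv_eq:
  "(B_inv d :: 'k mat) = mat (d + 1) (d + 1)
    (\<lambda>(k, i). (if i = k then 1 / 2 else 0) + (if i = nxt d k then sgn_d d k / 2 else 0))" (is "_ = ?D")
proof -
  let ?B = "B_mat d :: 'k mat"
  note car = B_carrier[of d, where ?'a = 'k]
  have D: "?D \<in> carrier_mat (d + 1) (d + 1)" by simp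
  have "?D * ?B = 1\<^sub>m (d + 1)"
  proof (rule eq_matI)
    fix k j assume "k < dim_row (1\<^sub>m (d + 1) :: 'k mat)" and "j < dim_col (1\<^sub>m (d + 1) :: 'k mat)"
    hence k: "k \<le> d" and j: "j \<le> d" by auto
    have "(?D * ?B) $$ (k, j) = (\<Sum>i\<le>d. ?D $$ (k, i) * ?B $$ (i, j))"
      using k j car by (simp add: scalar_prod_def atLeast0LessThan lessThan_Suc_atMost)
    also have "\<dots> = (\<Sum>i\<le>d. (if i = k then ?B $$ (k, j) / 2 else 0)
       + (if i = nxt d k then sgn_d d k * ?B $$ (nxt d k, j) / 2 else 0))"
      using k by (intro sum.cong) (auto simp: ring_distribs)
    also have "\<dots> = (?B $$ (k, j) + sgn_d d k * ?B $$ (nxt d k, j)) / 2"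
      using k nxt_le[of k] by (simp add: sum.distrib sum.delta add_divide_distrib)
    also have "\<dots> = 1\<^sub>m (d + 1) $$ (k, j)"
      using k j two by (simp add: B_rows)
    finally show "(?D * ?B) $$ (k, j) = 1\<^sub>m (d + 1) $$ (k, j)" .
  qed (use car in auto)
  hence DB: "?D * ?B = 1\<^sub>m (d + 1)" .
  note inv = B_mat_invertible[OF two d1]
  have Bi: "(B_inv d :: 'k mat) \<in> carrier_mat (d + 1) (d + 1)"
    using arg_cong[OF inv(1), of dim_col] arg_cong[OF inv(2), of dim_col]
      arg_cong[OF inv(1), of dim_row] by auto
  have "(B_inv d :: 'k mat) = (?D * ?B) * B_inv d"
    unfolding DB using Bi by simp
  also have "\<dots> = ?D * (?B * B_inv d)"
    using D car Bi by (rule assoc_mult_mat)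
  also have "\<dots> = ?D" unfolding inv(2) using D by simp
  finally show ?thesis .
qed

lemma B_inv_carrier: "(B_inv d :: 'k mat) \<in> carrier_mat (d + 1) (d + 1)"
  by (simp add: B_inv_eq)

lemma bform_subst_B_inv: "mpoly_subst (lin d (B_inv d)) (bform d i) = (X i :: 'k mpoly)"
  and B_inv_subst_bform: "mpoly_subst (bform d) (lin d (B_inv d) i) = (X i :: 'k mpoly)"
  by (simp_all only: lin_lin[OF B_carrier B_inv_carrier] lin_lin[OF B_inv_carrier B_carrier]
      B_mat_invertible[OF two d1] lin_one)

lemma bform_nonzero: "bform d i \<noteq> (0 :: 'k mpoly)"
  using bform_subst_B_inv[of i] by (metis X_nonzero subst_0)

text \<open>The linear substitution by \<open>B_inv\<close> carries \<open>bform d i\<close> to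
  \<open>X i\<close> and can be undone, so the claim reduces to \<open>cop_X\<close>.\<close>

lemma bform_cop:
  assumes "i \<noteq> j"
  shows "cop (bform d i) (bform d j :: 'k mpoly)"
  unfolding cop_def
proof (intro allI impI)
  fix a :: "'k mpoly" assume "bform d i dvd bform d j * a"
  then obtain c where "bform d j * a = bform d i * c" by (auto elim: dvdE)
  hence "mpoly_subst (lin d (B_inv d)) (bform d j * a) = mpoly_subst (lin d (B_inv d)) (bform d i * c)"
    by simp
  hence "X i dvd X j * mpoly_subst (lin d (B_inv d)) a"
    by (simp add: bform_subst_B_inv)
  hence "X i dvd mpoly_subst (lin d (B_inv d)) a"
    using cop_X[OF assms] copD by blast
  then obtain r where "mpoly_subst (lin d (B_inv d)) a = X i * r" by (auto elim: dvdE)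
  hence "mpoly_subst (bform d) (mpoly_subst (lin d (B_inv d)) a) = bform d i * mpoly_subst (bform d) r"
    by simp
  hence "a = bform d i * mpoly_subst (bform d) r"
    unfolding subst_subst B_inv_subst_bform subst_id .
  thus "bform d i dvd a" by simp
qed

lemma C_2: "C 2 = (2 :: 'a::comm_ring_1 mpoly)"
  using C_add[of "1 :: 'a" 1] by (simp only: one_add_one C_1)

lemma bform_sum: "k \<le> d \<Longrightarrow> bform d k + sgn_d d k * bform d (nxt d k) = (2 * X k :: 'k mpoly)"
proof -
  assume k: "k \<le> d"
  have "bform d k + sgn_d d k * bform d (nxt d k)
    = (\<Sum>j\<le>d. C (B_mat d $$ (k, j) + sgn_d d k * B_mat d $$ (nxt d k, j)) * X j :: 'k mpoly)"
    using k nxt_le[of k]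
    by (simp add: lin_def C_add C_mult sgn_d_C ring_distribs sum.distrib sum_distrib_left mult.assoc)
  also have "\<dots> = (\<Sum>j\<le>d. if k = j then C 2 * X k else 0)"
    using k by (intro sum.cong) (auto simp: B_rows)
  also have "\<dots> = 2 * X k" using k by (simp add: sum.delta C_2)
  finally show ?thesis .
qed

lemma C_half: "C (1 / 2) * (2 * p) = (p :: 'k mpoly)"
proof -
  have "C (1 / 2) * (C 2 * p) = C (1 / 2 * 2) * p" by (simp only: C_mult mult.assoc)
  also have "1 / 2 * 2 = (1 :: 'k)" using two by simp
  finally show ?thesis by (simp only: C_2 C_1 mult_1)
qed

lemma two_cancel: "2 * p = 2 * q \<Longrightarrow> p = (q :: 'k mpoly)"
  by (metis C_half)

lemma prod_bform_remove:
  fixes f :: "nat \<Rightarrow> 'a::comm_monoid_mult"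
  assumes "k \<le> d"
  defines "S \<equiv> {..d} - {k, nxt d k}"
  shows "(\<Prod>i\<in>{..d} - {k}. f i) = f (nxt d k) * prod f S"
    and "(\<Prod>i\<in>{..d} - {nxt d k}. f i) = f k * prod f S"
proof -
  have S: "{..d} - {k} = insert (nxt d k) S" "{..d} - {nxt d k} = insert k S"
    and "finite S" "k \<notin> S" "nxt d k \<notin> S"
    using assms nxt_le[of k] nxt_neq[of k] by auto
  thus "(\<Prod>i\<in>{..d} - {k}. f i) = f (nxt d k) * prod f S"
    "(\<Prod>i\<in>{..d} - {nxt d k}. f i) = f k * prod f S"
    unfolding S by simp_all
qed

text \<open>A row of \<open>B_inv\<close> combines only two of the products. They share all factors
  but one, and the remaining linear factor is a multiple of \<open>X k\<close> by
  \<open>bform_sum\<close>.\<close>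

lemma B_inv_cremona:
  assumes "k \<le> d"
  shows "(\<Sum>i\<le>d. C (B_inv d $$ (k, i)) * (\<Prod>i'\<in>{..d} - {i}. bform d i')) = (ghat d k :: 'k mpoly)"
proof (rule two_cancel)
  let ?c = "\<lambda>i. \<Prod>i'\<in>{..d} - {i}. bform d i' :: 'k mpoly"
  let ?P = "\<Prod>i\<in>{..d} - {k, nxt d k}. bform d i :: 'k mpoly"
  have h: "2 * C (1 / 2 :: 'k) = 1" using C_half[of 1] by (simp only: mult.commute mult_1 mult_1_right)
  have s: "C (sgn_d d k / 2 :: 'k) = C (1 / 2) * sgn_d d k" by (simp only: C_mult[symmetric] sgn_d_C[symmetric]) simp
  have "(\<Sum>i\<le>d. C (B_inv d $$ (k, i)) * ?c i)
    = (\<Sum>i\<le>d. (if i = k then C (1 / 2) * ?c k else 0) + (if i = nxt d k then C (1 / 2) * sgn_d d k * ?c (nxt d k) else 0))"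
    using assms by (intro sum.cong) (auto simp: B_inv_eq C_add ring_distribs s)
  also have "\<dots> = C (1 / 2) * ?c k + C (1 / 2) * sgn_d d k * ?c (nxt d k)"
    using assms nxt_le[of k] by (simp add: sum.distrib sum.delta)
  finally have "2 * (\<Sum>i\<le>d. C (B_inv d $$ (k, i)) * ?c i)
     = 2 * C (1 / 2) * (?c k + sgn_d d k * ?c (nxt d k))" by (simp add: algebra_simps)
  also have "\<dots> = (bform d (nxt d k) + sgn_d d k * bform d k) * ?P"
    unfolding h using assms by (simp add: prod_bform_remove ring_distribs mult.assoc)
  also have "bform d (nxt d k) + sgn_d d k * bform d k
      = sgn_d d k * (bform d k + sgn_d d k * bform d (nxt d k) :: 'k mpoly)"
    by (simp add: ring_distribs sgn_d_square flip: mult.assoc)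
  also have "\<dots> = sgn_d d k * (2 * X k)" using assms by (simp only: bform_sum)
  finally show "2 * (\<Sum>i\<le>d. C (B_inv d $$ (k, i)) * ?c i) = 2 * ghat d k"
    using assms by (simp add: ghat_def mult_ac)
qed

text \<open>\<open>ghat\<close> is \<open>B_inv\<close> applied to the Cremona tuple in the forms
  \<open>b_i\<close>, and substituting it into \<open>bform d i\<close> undoes
  \<open>B_inv\<close>.\<close>

lemma bform_ghat:
  assumes "i \<le> d"
  shows "mpoly_subst (ghat d) (bform d i) = (\<Prod>i'\<in>{..d} - {i}. bform d i' :: 'k mpoly)"
proof -
  let ?c = "\<lambda>i. if i \<le> d then (\<Prod>i'\<in>{..d} - {i}. bform d i' :: 'k mpoly) else X i"
  have g: "ghat d k = mpoly_subst ?c (lin d (B_inv d) k)" for k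
    by (cases "k \<le> d") (simp add: subst_lin flip: B_inv_cremona, simp add: lin_def ghat_def)
  have "mpoly_subst (ghat d) (bform d i) = mpoly_subst ?c (mpoly_subst (lin d (B_inv d)) (bform d i))"
    unfolding g[abs_def] by (simp add: subst_subst)
  thus ?thesis using assms by (simp add: bform_subst_B_inv)
qed

text \<open>Each of the \<open>d - 1\<close> linear factors of \<open>ghat d k\<close> pulls back to
  a product lacking exactly that factor, while \<open>X k\<close> pulls back to
  \<open>ghat d k\<close>, which supplies the missing factors. The two signs cancel.\<close>

lemma ghat_ghat:
  assumes "k \<le> d"
  shows "mpoly_subst (ghat d) (ghat d k) = (\<Prod>i\<le>d. bform d i) ^ (d - 1) * (X k :: 'k mpoly)"
proof -
  let ?S = "{..d} - {k, nxt d k}"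
  have S: "finite ?S" "card ?S = d - 1"
    using assms nxt_le[of k] nxt_neq[of k] by (auto simp: card_Diff_subset)
  have sg: "mpoly_subst G (sgn_d d k) = (sgn_d d k :: 'k mpoly)" for G
    using subst_C[of G "sgn_d d k :: 'k"] by (simp add: sgn_d_C)
  have "bform d i * (\<Prod>i'\<in>{..d} - {i}. bform d i') = (\<Prod>i\<le>d. bform d i :: 'k mpoly)" if "i \<in> ?S" for i
    using that by (subst prod.remove[of "{..d}" i]) auto
  hence "(\<Prod>i\<in>?S. bform d i) * (\<Prod>i\<in>?S. \<Prod>i'\<in>{..d} - {i}. bform d i') = (\<Prod>i\<le>d. bform d i :: 'k mpoly) ^ (d - 1)"
    by (simp add: S(2) flip: prod.distrib)
  moreover have "mpoly_subst (ghat d) (ghat d k)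
    = (sgn_d d k * sgn_d d k) * X k * ((\<Prod>i\<in>?S. bform d i) * (\<Prod>i\<in>?S. \<Prod>i'\<in>{..d} - {i}. bform d i') :: 'k mpoly)"
  proof -
    note gh = ghat_le[OF assms, where ?'a = 'k]
    have "mpoly_subst (ghat d) (ghat d k)
        = sgn_d d k * ghat d k * (\<Prod>i\<in>?S. \<Prod>i'\<in>{..d} - {i}. bform d i' :: 'k mpoly)"
      using arg_cong[OF gh, of "mpoly_subst (ghat d)"] by (simp add: sg bform_ghat)
    thus ?thesis unfolding gh by (simp only: mult_ac)
  qed
  ultimately show ?thesis by (simp add: sgn_d_square mult.commute)
qed

lemma is_form_ghat: "k \<le> d \<Longrightarrow> is_form d d (ghat d k :: 'k mpoly)"
proof -
  assume k: "k \<le> d"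
  have "is_form d d (\<Prod>i'\<in>{..d} - {i}. bform d i' :: 'k mpoly)" if "i \<le> d" for i
    using that by (intro is_form_prod_minus is_form_lin)
  thus ?thesis unfolding B_inv_cremona[OF k, symmetric]
    by (intro is_form_sum is_form_C_mult) auto
qed

lemma ghat_nonzero: "ghat d k \<noteq> (0 :: 'k mpoly)"
  using sgn_d_square[of d k, where ?'a = "'k mpoly"] bform_nonzero by (auto simp: ghat_def)

lemma g_map_eq: "g_map d = ratmap_of d (ghat d :: nat \<Rightarrow> 'k mpoly)"
proof -
  let ?X = "\<lambda>k. \<Prod>i\<in>{..d} - {k}. X i :: 'k mpoly"
  let ?b = "\<lambda>k. \<Prod>i\<in>{..d} - {k}. bform d i :: 'k mpoly"
  have lin_ft: "lin d M \<in> form_tuples d" if "lin d M 0 \<noteq> (0 :: 'k mpoly)" for M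
    using that by (intro form_tuplesI[of d 1 _ 0] is_form_lin) auto
  have X_ft: "?X \<in> form_tuples d"
    by (rule form_tuplesI[where i = 0]) (auto intro!: is_form_prod_minus is_form_X[simplified])
  have Binv0: "lin d (B_inv d) 0 \<noteq> (0 :: 'k mpoly)"
    using B_inv_subst_bform[of 0] by (metis X_nonzero subst_0)
  have "rat_comp d (cremona d) (linear_map d (B_mat d)) = ratmap_of d ?b"
    unfolding cremona_def linear_map_eq
    using bform_nonzero by (subst rat_comp_ratmap_of[OF X_ft lin_ft]) auto
  moreover have "?b \<in> form_tuples d"
    using form_tuples_subst[OF X_ft lin_ft[of "B_mat d"]] bform_nonzero by auto
  moreover have "(\<lambda>j. mpoly_subst ?b (lin d (B_inv d) j)) j = (ghat d j :: 'k mpoly)" if "j \<le> d" for j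
    using that by (simp add: subst_lin B_inv_cremona)
  ultimately have "g_map d = ratmap_of d (\<lambda>j. mpoly_subst ?b (lin d (B_inv d) j))"
    unfolding g_map_def linear_map_eq
    by (simp only:) (intro rat_comp_ratmap_of lin_ft Binv0 exI[of _ 0], auto simp: ghat_nonzero)
  also have "\<dots> = ratmap_of d (ghat d)"
    unfolding ratmap_of_def by (simp add: subst_lin B_inv_cremona)
  finally show ?thesis .
qed

end

section \<open>Exponent vectors\<close>

text \<open>
  \<open>cd w\<close> extends \<open>w\<close> by the entry \<open>0\<close> at index \<open>0\<close>: these are the orders of \<open>1, y\<^sub>1, \<dots>, y\<^sub>d\<close> under the
  monomial valuation \<open>w\<close>. Clearing common factors subtracts the minimum, leaving \<open>expo\<close>.
\<close>

definition cd :: "int vec \<Rightarrow> nat \<Rightarrow> int" where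
  "cd w k = (if k = 0 then 0 else w $ (k - 1))"

definition cmin :: "nat \<Rightarrow> int vec \<Rightarrow> int" where
  "cmin d w = Min (cd w ` {..d})"

definition expo :: "nat \<Rightarrow> int vec \<Rightarrow> nat \<Rightarrow> nat" where
  "expo d w k = nat (cd w k - cmin d w)"

text \<open>The orders of \<open>y_1, ..., y_d\<close> along the hyperplane \<open>x_i = 0\<close>;
  all of them have a simple pole along \<open>x_0 = 0\<close>. These are the ray generators of the
  fan of projective space.\<close>

definition ray :: "nat \<Rightarrow> nat \<Rightarrow> int vec" where
  "ray d i = (if i = 0 then vec d (\<lambda>_. -1) else unit_vec d (i - 1))"

lemma cd_0 [simp]: "cd w 0 = 0" and cd_Suc [simp]: "cd w (Suc k) = w $ k"
  by (simp_all add: cd_def)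

lemma cmin_le: "k \<le> d \<Longrightarrow> cmin d w \<le> cd w k"
  unfolding cmin_def by (intro Min_le) auto

lemma cmin_attained: "\<exists>k\<le>d. cd w k = cmin d w"
proof -
  have "cmin d w \<in> cd w ` {..d}" unfolding cmin_def by (intro Min_in) auto
  thus ?thesis by force
qed

lemma cmin_eqI: "k \<le> d \<Longrightarrow> cd w k = c \<Longrightarrow> (\<And>l. l \<le> d \<Longrightarrow> c \<le> cd w l) \<Longrightarrow> cmin d w = c"
  unfolding cmin_def by (intro Min_eqI) auto

lemma int_expo: "k \<le> d \<Longrightarrow> int (expo d w k) = cd w k - cmin d w"
  using cmin_le[of k d w] by (simp add: expo_def)

lemma expo_attained: "\<exists>k\<le>d. expo d w k = 0"
  using cmin_attained[of d w] by (auto simp: expo_def)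

lemma ray_carrier [simp]: "ray d i \<in> carrier_vec d" and v_vec_carrier [simp]: "v_vec d i \<in> carrier_vec d"
  by (simp_all add: ray_def v_vec_def)

lemma cd_mult_mat_vec:
  assumes "A \<in> carrier_mat d d" "w \<in> carrier_vec d" "k < d"
  shows "cd (A *\<^sub>v w) (Suc k) = (\<Sum>j<d. A $$ (k, j) * w $ j)"
  using assms by (simp add: scalar_prod_def atLeast0LessThan)

lemma cd_ray:
  assumes "A \<in> carrier_mat d d" "k < d"
  shows "cd (A *\<^sub>v ray d 0) (Suc k) = - (\<Sum>j<d. A $$ (k, j))"
    and "l < d \<Longrightarrow> cd (A *\<^sub>v ray d (Suc l)) (Suc k) = A $$ (k, l)"
proof -
  show "cd (A *\<^sub>v ray d 0) (Suc k) = - (\<Sum>j<d. A $$ (k, j))"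
    using assms by (subst cd_mult_mat_vec) (auto simp: ray_def sum_negf)
  assume l: "l < d"
  have "(\<Sum>j<d. A $$ (k, j) * unit_vec d l $ j) = (\<Sum>j<d. if j = l then A $$ (k, j) else 0)"
    by (intro sum.cong) (auto simp: unit_vec_def)
  thus "cd (A *\<^sub>v ray d (Suc l)) (Suc k) = A $$ (k, l)"
    using assms l by (subst cd_mult_mat_vec) (auto simp: ray_def sum.delta)
qed

text \<open>The rays sum to the zero vector.\<close>

lemma sum_cd_ray:
  assumes "A \<in> carrier_mat d d" "k \<le> d"
  shows "(\<Sum>l\<le>d. cd (A *\<^sub>v ray d l) k) = 0"
  using assms by (cases k) (simp_all add: sum.atMost_shift cd_ray del: cd_Suc)

text \<open>Since \<open>cd w 0 = 0\<close>, the vector \<open>w\<close> is the combination of the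
  rays with coefficients \<open>cd w l\<close>.\<close>

lemma sum_cd_ray_mult:
  assumes "A \<in> carrier_mat d d" "k \<le> d" "w \<in> carrier_vec d"
  shows "(\<Sum>l\<le>d. cd (A *\<^sub>v ray d l) k * cd w l) = cd (A *\<^sub>v w) k"
proof (cases k)
  case (Suc m)
  hence m: "m < d" using assms by simp
  have "(\<Sum>l\<le>d. cd (A *\<^sub>v ray d l) k * cd w l)
      = (\<Sum>l<d. cd (A *\<^sub>v ray d (Suc l)) (Suc m) * cd w (Suc l))"
    by (simp add: sum.atMost_shift Suc)
  also have "\<dots> = (\<Sum>l<d. A $$ (m, l) * w $ l)"
    using assms m by (intro sum.cong) (simp_all only: cd_ray lessThan_iff, simp)
  also have "\<dots> = cd (A *\<^sub>v w) k"
    unfolding Suc using assms m by (subst cd_mult_mat_vec) auto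
  finally show ?thesis .
qed simp

text \<open>Orders transform linearly under a monomial map. The normalisations contribute only terms
  independent of \<open>k\<close>, because the rays sum to zero; \<open>c\<close> is the order of
  the common factor that has to be removed.\<close>

lemma expo_compose:
  assumes A: "A \<in> carrier_mat d d" and w: "w \<in> carrier_vec d"
  shows "\<exists>c. \<forall>k\<le>d. (\<Sum>l\<le>d. expo d (A *\<^sub>v ray d l) k * expo d w l) = expo d (A *\<^sub>v w) k + c"
proof -
  let ?r = "\<lambda>l. A *\<^sub>v ray d l"
  \<comment> \<open>The part of the expanded double sum that does not involve
    \<open>k\<close>.\<close>
  define K where "K = (\<Sum>l\<le>d. cmin d (?r l) * (cd w l - cmin d w))"
  have eq: "int (\<Sum>l\<le>d. expo d (?r l) k * expo d w l) = cd (A *\<^sub>v w) k - K" if k: "k \<le> d" for k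
  proof -
    have "int (\<Sum>l\<le>d. expo d (?r l) k * expo d w l)
        = (\<Sum>l\<le>d. (cd (?r l) k - cmin d (?r l)) * (cd w l - cmin d w))"
      using k by (simp add: int_expo)
    also have "\<dots> = (\<Sum>l\<le>d. cd (?r l) k * cd w l) - cmin d w * (\<Sum>l\<le>d. cd (?r l) k) - K"
      by (simp add: K_def algebra_simps sum.distrib sum_subtractf sum_distrib_left)
    finally show ?thesis using k A w by (simp add: sum_cd_ray sum_cd_ray_mult)
  qed
  obtain k0 where k0: "k0 \<le> d" "cd (A *\<^sub>v w) k0 = cmin d (A *\<^sub>v w)"
    using cmin_attained by blast
  \<comment> \<open>At the minimal entry the shift equals a sum of natural numbers, so it is
    non-negative.\<close>
  have "cmin d (A *\<^sub>v w) - K \<ge> 0"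
    using eq[OF k0(1)] k0(2) by (metis of_nat_0_le_iff)
  then obtain c where c: "int c = cmin d (A *\<^sub>v w) - K" by (metis nonneg_int_cases)
  have "(\<Sum>l\<le>d. expo d (?r l) k * expo d w l) = expo d (A *\<^sub>v w) k + c" if k: "k \<le> d" for k
  proof -
    have "int (\<Sum>l\<le>d. expo d (?r l) k * expo d w l) = int (expo d (A *\<^sub>v w) k + c)"
      unfolding eq[OF k] using k by (simp add: int_expo c)
    thus ?thesis by (simp only: of_nat_eq_iff)
  qed
  thus ?thesis by blast
qed

lemma expo_ray:
  assumes "d \<ge> 1" "i \<le> d" "k \<le> d"
  shows "expo d (ray d i) k = (if i = k then 1 else 0)"
proof (cases "i = 0")
  case True
  have "cmin d (ray d i) = -1"
    using assms True by (intro cmin_eqI[of 1]) (auto simp: ray_def cd_def)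
  thus ?thesis using assms True by (auto simp: expo_def ray_def cd_def)
next
  case False
  have "cmin d (ray d i) = 0"
    using assms False by (intro cmin_eqI[of 0]) (auto simp: ray_def cd_def unit_vec_def)
  thus ?thesis using assms False by (auto simp: expo_def ray_def cd_def unit_vec_def)
qed

lemma cd_v_vec: "k \<le> d \<Longrightarrow> cd (v_vec d i) k = epsilon d i 0 - epsilon d i k"
  by (cases k) (auto simp: v_vec_def)

lemma epsilon_eq: "i \<le> d \<Longrightarrow> k \<le> d \<Longrightarrow> epsilon d i k = (if i = k \<or> i = nxt d k then 1 else 0)"
  by (auto simp: epsilon_def nxt_def)

text \<open>These are the exponents of \<open>bform d i\<close> in the coordinates of
  \<open>ghat\<close>; the minimum is attained at \<open>k = i\<close>, where \<open>epsilon\<close>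
  is 1.\<close>

lemma expo_v_vec:
  assumes "i \<le> d" "k \<le> d"
  shows "expo d (v_vec d i) k = (if i = k \<or> i = nxt d k then 0 else 1)"
proof -
  have "cmin d (v_vec d i) = epsilon d i 0 - 1"
    using assms by (intro cmin_eqI[of i]) (auto simp: cd_v_vec epsilon_eq)
  thus ?thesis using assms by (simp add: expo_def cd_v_vec epsilon_eq)
qed

lemma sum_epsilon:
  assumes "k \<le> d" "d \<ge> 1"
  shows "(\<Sum>i\<le>d. epsilon d i k) = 2"
proof -
  have "nxt d k \<le> d" "nxt d k \<noteq> k" using assms by (auto simp: nxt_def)
  have "(\<Sum>i\<le>d. epsilon d i k) = (\<Sum>i\<le>d. (if i = k then 1 else 0) + (if i = nxt d k then 1 else 0))"
    using assms \<open>nxt d k \<noteq> k\<close> by (intro sum.cong) (auto simp: epsilon_eq)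
  thus ?thesis using assms \<open>nxt d k \<le> d\<close> by (simp add: sum.distrib sum.delta)
qed

text \<open>The vectors \<open>v_i\<close> sum to zero, because \<open>epsilon\<close> summed over
  its first index is 2 for every \<open>k\<close>.\<close>

lemma sum_cd_v_vec:
  assumes "A \<in> carrier_mat d d" "k \<le> d" "d \<ge> 1"
  shows "(\<Sum>i\<le>d. cd (A *\<^sub>v v_vec d i) k) = 0"
proof (cases k)
  case (Suc m)
  have "(\<Sum>i\<le>d. cd (A *\<^sub>v v_vec d i) k) = (\<Sum>i\<le>d. \<Sum>j<d. A $$ (m, j) * v_vec d i $ j)"
    unfolding Suc using assms Suc by (intro sum.cong cd_mult_mat_vec) auto
  also have "\<dots> = (\<Sum>j<d. \<Sum>i\<le>d. A $$ (m, j) * v_vec d i $ j)"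
    by (rule sum.swap)
  also have "\<dots> = (\<Sum>j<d. A $$ (m, j) * (\<Sum>i\<le>d. epsilon d i 0 - epsilon d i (Suc j)))"
    by (simp add: v_vec_def sum_distrib_left)
  also have "\<dots> = 0"
    using assms by (intro sum.neutral) (auto simp: sum_subtractf sum_epsilon)
  finally show ?thesis .
qed simp

text \<open>The orders with which an atom of level \<open>m\<close> starts: the ray of a coordinate
  hyperplane, or \<open>v_i\<close> for a hyperplane contracted by g.\<close>

definition level_vec :: "nat \<Rightarrow> nat \<Rightarrow> nat \<Rightarrow> int vec" where
  "level_vec d m i = (if m = 0 then ray d i else v_vec d i)"

lemma level_vec_carrier [simp]: "level_vec d m i \<in> carrier_vec d"
  by (simp add: level_vec_def)

text \<open>For \<open>m = 0\<close> this is the degree of the monomial map of \<open>A\<close>, for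
  \<open>m > 0\<close> it is \<open>Psi\<close>. The conversion to \<open>nat\<close> is harmless
  because \<open>cmin\<close> is never positive.\<close>

definition weight :: "nat \<Rightarrow> int mat \<Rightarrow> nat \<Rightarrow> nat" where
  "weight d A m = nat (\<Sum>i\<le>d. - cmin d (A *\<^sub>v level_vec d m i))"

lemma cmin_le_0: "cmin d w \<le> 0"
  using cmin_le[of 0 d w] by simp

lemma int_weight: "int (weight d A m) = (\<Sum>i\<le>d. - cmin d (A *\<^sub>v level_vec d m i))"
  unfolding weight_def using cmin_le_0 by (simp add: sum_nonneg del: sum_negf)

text \<open>The level vectors sum to zero, so only the subtracted minima remain. Independence of
  \<open>k\<close> is what makes the tuples homogeneous.\<close>

lemma sum_expo:
  assumes "A \<in> carrier_mat d d" "k \<le> d" "d \<ge> 1"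
  shows "(\<Sum>i\<le>d. expo d (A *\<^sub>v level_vec d m i) k) = weight d A m"
proof -
  have "int (\<Sum>i\<le>d. expo d (A *\<^sub>v level_vec d m i) k)
    = (\<Sum>i\<le>d. cd (A *\<^sub>v level_vec d m i) k) - (\<Sum>i\<le>d. cmin d (A *\<^sub>v level_vec d m i))"
    using assms by (simp add: int_expo sum_subtractf)
  also have "(\<Sum>i\<le>d. cd (A *\<^sub>v level_vec d m i) k) = 0"
    using assms by (cases "m = 0") (simp_all add: level_vec_def sum_cd_ray sum_cd_v_vec)
  finally have "int (\<Sum>i\<le>d. expo d (A *\<^sub>v level_vec d m i) k) = int (weight d A m)"
    by (simp add: int_weight sum_negf)
  thus ?thesis by (simp only: of_nat_eq_iff)
qed

text \<open>The pairings with \<open>U_set\<close> are the negatives of the entries of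
  \<open>cd w\<close>, the vector 0 giving the entry at index 0.\<close>

lemma Max_U_set:
  assumes "w \<in> carrier_vec d"
  shows "Max ((\<lambda>u. u \<bullet> w) ` U_set d) = - cmin d w"
proof -
  have im: "(\<lambda>u. u \<bullet> w) ` U_set d = (\<lambda>k. - cd w k) ` {..d}"
  proof -
    have "{..d} = insert 0 (Suc ` {..<d})" by (metis lessThan_Suc_atMost lessThan_Suc_eq_insert_0)
    moreover have "- unit_vec d i \<bullet> w = - (w $ i)" if "i < d" for i
      using assms that by (simp add: scalar_prod_left_unit)
    ultimately show ?thesis using assms by (simp add: U_set_def image_image)
  qed
  show ?thesis unfolding im
  proof (rule Max_eqI)
    show "- cmin d w \<in> (\<lambda>k. - cd w k) ` {..d}" using cmin_attained[of d w] by force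
  qed (auto intro: cmin_le)
qed

text \<open>\<open>V_set\<close> is a set, so repeated vectors would be counted once in
  \<open>Psi\<close>. For \<open>d = 1\<close> the two vectors coincide.\<close>

lemma inj_v_vec:
  assumes "d \<ge> 2"
  shows "inj_on (v_vec d) {..d}"
proof (rule inj_onI)
  fix i j assume ij: "i \<in> {..d}" "j \<in> {..d}" and eq: "v_vec d i = v_vec d j"
  have e: "expo d (v_vec d i) k = expo d (v_vec d j) k" for k by (simp add: eq)
  have "j = i \<or> j = nxt d i" "i = j \<or> i = nxt d j"
    using ij e[of i] e[of j] by (auto simp: expo_v_vec split: if_splits)
  thus "i = j" using assms ij by (auto simp: nxt_def split: if_splits)
qed

lemma Psi_eq:
  assumes "d \<ge> 2" "A \<in> carrier_mat d d" "m > 0"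
  shows "Psi (U_set d) (V_set d) A = int (weight d A m)"
proof -
  have "Psi (U_set d) (V_set d) A = (\<Sum>i\<le>d. Max ((\<lambda>u. u \<bullet> (A *\<^sub>v v_vec d i)) ` U_set d))"
    unfolding Psi_def V_set_def by (simp add: sum.reindex[OF inj_v_vec[OF assms(1)]])
  also have "\<dots> = int (weight d A m)"
    using assms by (simp add: Max_U_set int_weight level_vec_def mult_mat_vec_carrier[of _ d d])
  finally show ?thesis .
qed

section \<open>Monomial maps as tuples of monomials\<close>

definition mono_tup :: "nat \<Rightarrow> int mat \<Rightarrow> nat \<Rightarrow> 'k::comm_ring_1 mpoly" where
  "mono_tup d A k = (if k \<le> d then (\<Prod>l\<le>d. X l ^ expo d (A *\<^sub>v ray d l) k) else X k)"

lemma mono_tup_le: "k \<le> d \<Longrightarrow> mono_tup d A k = (\<Prod>l\<le>d. X l ^ expo d (A *\<^sub>v ray d l) k)"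
  by (simp add: mono_tup_def)

lemma mono_tup_nonzero: "mono_tup d A k \<noteq> (0 :: 'k::idom mpoly)"
  by (simp add: mono_tup_def)

lemma is_form_mono_tup:
  assumes "A \<in> carrier_mat d d" "d \<ge> 1" "k \<le> d"
  shows "is_form d (weight d A 0) (mono_tup d A k)"
proof -
  have "is_form d (\<Sum>l\<le>d. expo d (A *\<^sub>v ray d l) k * 1) (mono_tup d A k :: 'a mpoly)"
    unfolding mono_tup_le[OF assms(3)] by (intro is_form_prod is_form_power is_form_X) auto
  thus ?thesis using sum_expo[OF assms(1,3,2), of 0] by (simp add: level_vec_def)
qed

text \<open>In a quotient of two coordinates the shifts by the minima cancel. The exponent left on
  \<open>x_0\<close> is minus a row sum of \<open>A\<close>, which distributes over the powers of
  \<open>x_j / x_0\<close>.\<close>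

lemma monomial_map_eq:
  assumes A: "A \<in> carrier_mat d d" and d: "d \<ge> 1"
  shows "monomial_map d A = ratmap_of d (mono_tup d A :: nat \<Rightarrow> 'k::idom mpoly)"
proof -
  let ?m = "mono_tup d A :: nat \<Rightarrow> 'k mpoly"
  let ?f = "\<lambda>p :: 'k mpoly. Fract p 1"
  have f_mult: "?f (p * q) = ?f p * ?f q" for p q by simp
  have f_prod: "?f (prod g S) = (\<Prod>x\<in>S. ?f (g x))" for g and S :: "nat set"
    by (induction S rule: infinite_finite_induct) (simp_all add: One_fract_def f_mult del: mult_fract)
  have f_pow: "?f (p ^ n) = ?f p ^ n" for p n
    by (induction n) (simp_all add: One_fract_def f_mult del: mult_fract)
  have f_div: "Fract p q = ?f p / ?f q" if "q \<noteq> 0" for p q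
    using that by (simp add: divide_fract)
  have x0: "?f (X l) \<noteq> 0" for l by (simp add: Zero_fract_def eq_fract)
  have quot: "Fract (?m i) (?m 0) = (\<Prod>j=1..d. Fract (X j) (X 0) powi (A $$ (i - 1, j - 1)))"
    if i: "i \<in> {1..d}" for i
  proof -
    obtain k where k: "i = Suc k" "k < d" using i by (cases i) auto
    let ?x = "\<lambda>l. ?f (X l)"
    have m: "?f (?m j) = (\<Prod>l\<le>d. ?x l powi (cd (A *\<^sub>v ray d l) j - cmin d (A *\<^sub>v ray d l)))"
      if "j \<le> d" for j
      using that by (simp add: mono_tup_le f_prod f_pow flip: int_expo)
    have "Fract (?m i) (?m 0) = ?f (?m i) / ?f (?m 0)"
      by (rule f_div[OF mono_tup_nonzero])
    also have "\<dots> = (\<Prod>l\<le>d. ?x l powi cd (A *\<^sub>v ray d l) i)"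
    proof -
      have "a powi (c - e) / a powi (0 - e) = a powi c" if "a \<noteq> 0" for a :: "'k mpoly fract" and c e
        using that by (simp add: power_int_diff power_int_minus)
      thus ?thesis using i x0 by (simp add: m del: diff_0 flip: prod_dividef)
    qed
    also have "\<dots> = ?x 0 powi (- (\<Sum>j<d. A $$ (k, j))) * (\<Prod>j<d. ?x (Suc j) powi (A $$ (k, j)))"
    proof -
      have "(\<Prod>j<d. ?x (Suc j) powi cd (A *\<^sub>v ray d (Suc j)) (Suc k)) = (\<Prod>j<d. ?x (Suc j) powi (A $$ (k, j)))"
        by (intro prod.cong) (simp_all only: lessThan_iff cd_ray[OF A k(2)])
      thus ?thesis by (simp only: prod.atMost_shift k(1) cd_ray(1)[OF A k(2)])
    qed
    also have "\<dots> = (\<Prod>j<d. inverse (?x 0 powi (A $$ (k, j)))) * (\<Prod>j<d. ?x (Suc j) powi (A $$ (k, j)))"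
    proof -
      have "?x 0 powi (- sum g S) = (\<Prod>j\<in>S. inverse (?x 0 powi g j))" if "finite S" for g and S :: "nat set"
        using that x0 by (induction S) (simp_all add: power_int_add power_int_diff power_int_minus field_simps)
      thus ?thesis by (simp only: finite_lessThan)
    qed
    also have "\<dots> = (\<Prod>j<d. Fract (X (Suc j)) (X 0) powi (A $$ (k, j)))"
    proof -
      have "inverse (?x 0 powi e) * ?x (Suc j) powi e = Fract (X (Suc j)) (X 0) powi e" for e j
        by (simp only: f_div[OF X_nonzero] power_int_divide_distrib divide_inverse power_int_mult_distrib
            power_int_inverse mult.commute)
      thus ?thesis by (simp only: flip: prod.distrib)
    qed
    also have "\<dots> = (\<Prod>j=1..d. Fract (X j) (X 0) powi (A $$ (i - 1, j - 1)))"
      by (rule prod.reindex_bij_witness[of _ "\<lambda>j. j - 1" Suc]) (auto simp: k)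
    finally show ?thesis .
  qed
  have "F \<in> monomial_map d A \<longleftrightarrow> F \<in> ratmap_of d ?m" for F :: "nat \<Rightarrow> 'k mpoly"
  proof
    assume F: "F \<in> monomial_map d A"
    hence "F 0 \<noteq> 0" "F \<in> form_tuples d" by (auto simp: monomial_map_def)
    moreover have "?m i * F 0 = ?m 0 * F i" if "i \<le> d" for i
    proof (cases "i = 0")
      case False
      hence "Fract (F i) (F 0) = Fract (?m i) (?m 0)"
        using F that by (subst quot) (auto simp: monomial_map_def)
      thus ?thesis using \<open>F 0 \<noteq> 0\<close> mono_tup_nonzero[of d A 0, where ?'k = 'k] by (simp add: eq_fract mult.commute)
    qed simp
    ultimately show "F \<in> ratmap_of d ?m"
      by (auto simp: ratmap_of_iff intro: proportionalI_base)
  next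
    assume F: "F \<in> ratmap_of d ?m"
    hence pr: "?m i * F j = ?m j * F i" if "i \<le> d" "j \<le> d" for i j
      using that by (auto simp: ratmap_of_iff proportional_def)
    obtain j where "j \<le> d" "F j \<noteq> 0" using F by (auto simp: ratmap_of_iff form_tuples_def)
    hence F0: "F 0 \<noteq> 0" using pr[of 0 j] mono_tup_nonzero[of d A 0, where ?'k = 'k] by auto
    have "Fract (F i) (F 0) = Fract (?m i) (?m 0)" if "i \<le> d" for i
      using pr[of i 0] that F0 mono_tup_nonzero[of d A 0, where ?'k = 'k] by (simp add: eq_fract mult.commute)
    thus "F \<in> monomial_map d A"
      using F F0 quot by (simp add: monomial_map_def ratmap_of_iff)
  qed
  thus ?thesis by blast
qed

section \<open>Birational inverses up to monomial factors\<close>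

definition tuple_ext :: "nat \<Rightarrow> (nat \<Rightarrow> 'k::comm_ring_1 mpoly) \<Rightarrow> bool" where
  "tuple_ext d T \<longleftrightarrow> (\<exists>e. \<forall>k\<le>d. is_form d e (T k)) \<and> (\<forall>k>d. T k = X k)"

text \<open>
  \<open>T\<close> is birational with inverse \<open>H\<close>. The composition \<open>H \<circ> T\<close> is the identity up to factors from
  the multiplicative set \<open>M\<close>; for \<open>T \<circ> H\<close> no such control is needed.
\<close>

definition pseudo_inv :: "nat \<Rightarrow> ('k::idom mpoly \<Rightarrow> bool) \<Rightarrow> (nat \<Rightarrow> 'k mpoly) \<Rightarrow> (nat \<Rightarrow> 'k mpoly) \<Rightarrow> bool" where
  "pseudo_inv d M T H \<longleftrightarrow> tuple_ext d T \<and> tuple_ext d H \<and>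
     (\<exists>K E. M K \<and> M E \<and> (\<forall>k\<le>d. K * mpoly_subst T (H k) = E * X k)) \<and>
     mpoly_subst H (T 0) \<noteq> 0 \<and> (\<forall>k\<le>d. mpoly_subst H (T k) * X 0 = mpoly_subst H (T 0) * X k)"

lemma subst_scale_eq:
  assumes "hform d n p" "\<And>k. k \<le> d \<Longrightarrow> a * T k = b * S k" "\<And>k. k > d \<Longrightarrow> T k = S k"
  shows "a ^ n * mpoly_subst T p = b ^ n * mpoly_subst S p"
proof -
  let ?T = "\<lambda>k. if k \<le> d then a * T k else T k"
  have "a ^ n * mpoly_subst T p = mpoly_subst ?T p"
    by (rule subst_scale[OF assms(1), symmetric]) auto
  also have "\<dots> = b ^ n * mpoly_subst S p"
    by (rule subst_scale[OF assms(1)]) (auto simp: assms(2,3))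
  finally show ?thesis .
qed

lemma subst_scale_eq_form:
  assumes "is_form d n p" "\<And>k. k \<le> d \<Longrightarrow> a * T k = b * S k"
  shows "a ^ n * mpoly_subst T p = b ^ n * mpoly_subst S p"
proof -
  let ?e = "\<lambda>T k. if k \<le> d then T k else 1"
  have "mpoly_subst R p = mpoly_subst (?e R) p" for R
    using assms(1) by (intro subst_cong) (auto simp: is_form_def subset_iff)
  thus ?thesis using assms subst_scale_eq[of d n p a "?e T" b "?e S"] by (simp add: is_form_iff)
qed

lemma tuple_ext_subst:
  assumes "tuple_ext d S" "tuple_ext d H"
  shows "tuple_ext d (\<lambda>k. mpoly_subst S (H k))"
  using assms unfolding tuple_ext_def by (metis is_form_subst subst_X)

text \<open>If \<open>p\<close> vanished on \<open>H\<close>, substituting \<open>T\<close> would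
  give \<open>E ^ n * p = 0\<close>.\<close>

lemma subst_left_inverse_nonzero:
  fixes p :: "'k::idom mpoly"
  assumes "is_form d n p" "p \<noteq> 0" "E \<noteq> 0" and "\<And>k. k \<le> d \<Longrightarrow> K * mpoly_subst T (H k) = E * X k"
  shows "mpoly_subst H p \<noteq> 0"
proof
  assume "mpoly_subst H p = 0"
  moreover have "K ^ n * mpoly_subst (\<lambda>k. mpoly_subst T (H k)) p = E ^ n * mpoly_subst X p"
    by (rule subst_scale_eq_form[OF assms(1,4)])
  ultimately have "E ^ n * p = 0" by (simp add: subst_id flip: subst_subst)
  thus False using assms by simp
qed

text \<open>\<open>T'\<close> is \<open>S\<close> after \<open>T\<close> with a common factor
  \<open>\<kappa>\<close> removed, and \<open>S'\<close> inverts \<open>S\<close> up to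
  \<open>\<sigma>\<close> and \<open>\<sigma>'\<close>; the new inverse is \<open>H\<close> after
  \<open>S'\<close>. Only \<open>\<kappa>\<close> and the pullback of \<open>\<sigma>\<close> enter
  the controlled identity, so only they must lie in \<open>M\<close>.\<close>

lemma pseudo_inv_step:
  fixes T :: "nat \<Rightarrow> 'k::idom mpoly"
  assumes inv: "pseudo_inv d M T H"
    and M: "\<And>p q. M p \<Longrightarrow> M q \<Longrightarrow> M (p * q)" "\<And>p. M p \<Longrightarrow> p \<noteq> 0" "M 1"
    and T': "tuple_ext d T'" and S: "tuple_ext d S" "tuple_ext d S'"
    and rel: "\<And>k. k \<le> d \<Longrightarrow> \<kappa> * T' k = mpoly_subst T (S k)" "M \<kappa>" "is_form d r \<kappa>"
    and \<sigma>: "\<And>k. k \<le> d \<Longrightarrow> mpoly_subst S (S' k) = \<sigma> * X k" "\<sigma> \<noteq> 0" "M (mpoly_subst T \<sigma>)"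
    and \<sigma>': "\<And>k. k \<le> d \<Longrightarrow> mpoly_subst S' (S k) = \<sigma>' * X k" "\<sigma>' \<noteq> 0"
    and S0: "S' 0 \<noteq> 0"
  shows "pseudo_inv d M T' (\<lambda>k. mpoly_subst S' (H k))"
proof -
  let ?H = "\<lambda>k. mpoly_subst S' (H k)"
  have Mpow: "M p \<Longrightarrow> M (p ^ n)" for p n by (induction n) (auto intro: M)
  obtain K E where KE: "M K" "M E" "\<And>k. k \<le> d \<Longrightarrow> K * mpoly_subst T (H k) = E * X k"
    and T: "tuple_ext d T" and H: "tuple_ext d H"
    and y: "mpoly_subst H (T 0) \<noteq> 0" "\<And>k. k \<le> d \<Longrightarrow> mpoly_subst H (T k) * X 0 = mpoly_subst H (T 0) * X k"
    using inv unfolding pseudo_inv_def by (elim conjE exE) auto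
  obtain eH where eH: "\<And>k. k \<le> d \<Longrightarrow> is_form d eH (H k)" using H unfolding tuple_ext_def by blast
  obtain eT where eT: "\<And>k. k \<le> d \<Longrightarrow> is_form d eT (T k)" using T unfolding tuple_ext_def by blast
  obtain eS where eS: "\<And>k. k \<le> d \<Longrightarrow> is_form d eS (S k)" using S unfolding tuple_ext_def by blast
  have H': "tuple_ext d ?H" by (rule tuple_ext_subst[OF S(2) H])
  obtain h where h: "\<And>k. k \<le> d \<Longrightarrow> is_form d h (?H k)" using H' unfolding tuple_ext_def by blast
  \<comment> \<open>Forms of degree \<open>h\<close> turn the removed factor \<open>\<kappa>\<close>
    into \<open>\<kappa> ^ h\<close>, and \<open>S\<close> after \<open>S'\<close> contributes
    \<open>\<sigma>\<close> to the degree \<open>eH\<close> of \<open>H\<close>.\<close>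
  define K' where "K' = K * \<kappa> ^ h"
  define E' where "E' = E * mpoly_subst T \<sigma> ^ eH"
  have KE': "K' * mpoly_subst T' (?H k) = E' * X k" if k: "k \<le> d" for k
  proof -
    have "\<kappa> ^ h * mpoly_subst T' (?H k) = 1 ^ h * mpoly_subst (\<lambda>i. mpoly_subst T (S i)) (?H k)"
      using rel(1) by (intro subst_scale_eq_form[OF h[OF k]]) simp
    also have "\<dots> = mpoly_subst T (mpoly_subst (\<lambda>i. mpoly_subst S (S' i)) (H k))"
      by (simp add: subst_subst)
    also have "1 ^ eH * mpoly_subst (\<lambda>i. mpoly_subst S (S' i)) (H k) = \<sigma> ^ eH * mpoly_subst X (H k)"
      using \<sigma>(1) by (intro subst_scale_eq_form[OF eH[OF k]]) simp
    hence "mpoly_subst (\<lambda>i. mpoly_subst S (S' i)) (H k) = \<sigma> ^ eH * H k" by (simp add: subst_id)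
    finally have "K' * mpoly_subst T' (?H k) = mpoly_subst T \<sigma> ^ eH * (K * mpoly_subst T (H k))"
      by (simp add: K'_def mult_ac)
    thus ?thesis using KE(3)[OF k] by (simp add: E'_def mult_ac)
  qed
  have M': "M K'" "M E'" unfolding K'_def E'_def by (intro M(1) Mpow KE rel \<sigma>)+
  let ?y = "\<lambda>k. mpoly_subst H (T k)"
  have y0: "is_form d (eT * eH) (?y 0)" using eT eH by (intro is_form_subst) auto
  have Sy: "mpoly_subst S' (?y 0) \<noteq> 0"
    by (rule subst_left_inverse_nonzero[OF y0 y(1) \<sigma>(2), of 1 S]) (simp add: \<sigma>(1))
  have \<kappa>0: "mpoly_subst ?H \<kappa> \<noteq> 0"
    by (rule subst_left_inverse_nonzero[OF rel(3) M(2)[OF rel(2)] M(2)[OF M'(2)] KE'])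
  \<comment> \<open>Both factors clear denominators for the composition in the other order, where it
    suffices that they are non-zero.\<close>
  define a where "a = S' 0 ^ eS * mpoly_subst ?H \<kappa>"
  define b where "b = mpoly_subst S' (?y 0) ^ eS * \<sigma>'"
  have ab: "a * mpoly_subst ?H (T' k) = b * X k" if k: "k \<le> d" for k
  proof -
    have "mpoly_subst ?H \<kappa> * mpoly_subst ?H (T' k) = mpoly_subst ?H (mpoly_subst T (S k))"
      by (simp flip: rel(1)[OF k])
    also have "\<dots> = mpoly_subst S' (mpoly_subst ?y (S k))"
      by (simp add: subst_subst)
    finally have "a * mpoly_subst ?H (T' k) = mpoly_subst S' (X 0 ^ eS * mpoly_subst ?y (S k))"
      by (simp add: a_def)
    also have "X 0 ^ eS * mpoly_subst ?y (S k) = ?y 0 ^ eS * mpoly_subst X (S k)"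
      using y(2) by (intro subst_scale_eq_form[OF eS[OF k]]) (simp add: mult.commute)
    finally show ?thesis using \<sigma>'(1)[OF k] by (simp add: b_def subst_id)
  qed
  have nz: "a \<noteq> 0" "b \<noteq> 0" using S0 \<kappa>0 Sy \<sigma>' by (auto simp: a_def b_def)
  have "mpoly_subst ?H (T' 0) \<noteq> 0"
    using ab[of 0] nz by (metis X_nonzero le0 mult_eq_0_iff)
  moreover have "mpoly_subst ?H (T' k) * X 0 = mpoly_subst ?H (T' 0) * X k" if k: "k \<le> d" for k
  proof -
    have "a * (mpoly_subst ?H (T' k) * X 0) = b * X k * X 0"
      by (simp only: ab[OF k] mult.assoc[symmetric])
    also have "\<dots> = (b * X 0) * X k" by (simp only: mult_ac)
    also have "\<dots> = a * (mpoly_subst ?H (T' 0) * X k)"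
      by (simp only: ab[OF le0, symmetric] mult.assoc)
    finally show ?thesis using nz(1) by simp
  qed
  ultimately have "mpoly_subst ?H (T' 0) \<noteq> 0 \<and> (\<forall>k\<le>d. mpoly_subst ?H (T' k) * X 0 = mpoly_subst ?H (T' 0) * X k)"
    by simp
  moreover have "\<exists>K E. M K \<and> M E \<and> (\<forall>k\<le>d. K * mpoly_subst T' (?H k) = E * X k)"
    using M' KE' by (intro exI[of _ K'] exI[of _ E'] conjI allI impI)
  ultimately show ?thesis
    unfolding pseudo_inv_def using T' H' by (intro conjI) simp_all
qed

text \<open>Substituting \<open>H\<close> into a relation \<open>b'(T) * a = b(T) * c\<close> gives
  one between \<open>b'\<close> and \<open>b\<close> themselves, so \<open>b\<close> divides
  \<open>a(H)\<close>. Substituting \<open>T\<close> again shows that \<open>b(T)\<close> divides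
  \<open>E ^ n * a\<close>, and \<open>E\<close> is coprime to \<open>b(T)\<close>.\<close>

lemma pseudo_inv_cop:
  fixes T :: "nat \<Rightarrow> 'k::idom mpoly"
  assumes inv: "pseudo_inv d M T H"
    and b: "is_form d 1 b" "is_form d 1 b'" "cop b b'"
    and M: "\<And>E. M E \<Longrightarrow> cop (mpoly_subst T b) E"
  shows "cop (mpoly_subst T b) (mpoly_subst T b')"
proof -
  obtain K E where KE: "M K" "M E" "\<And>k. k \<le> d \<Longrightarrow> K * mpoly_subst T (H k) = E * X k"
    and T: "tuple_ext d T" and H: "tuple_ext d H"
    and y: "mpoly_subst H (T 0) \<noteq> 0" "\<And>k. k \<le> d \<Longrightarrow> mpoly_subst H (T k) * X 0 = mpoly_subst H (T 0) * X k"
    using inv unfolding pseudo_inv_def by (elim conjE exE) auto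
  obtain eT where eT: "\<And>k. k \<le> d \<Longrightarrow> is_form d eT (T k)" using T unfolding tuple_ext_def by blast
  have hf: "hform d (1 * eT) (mpoly_subst T b)" "hform d (1 * eT) (mpoly_subst T b')"
    using is_form_subst[OF b(1) eT] is_form_subst[OF b(2) eT] by (simp_all add: is_form_iff)
  show ?thesis
  proof (rule cop_hform[OF hf])
    fix n and a :: "'k mpoly"
    assume a: "hform d n a" and "mpoly_subst T b dvd mpoly_subst T b' * a"
    then obtain c where c: "mpoly_subst T b' * a = mpoly_subst T b * c" by (auto elim: dvdE)
    let ?y = "\<lambda>k. mpoly_subst H (T k)"
    \<comment> \<open>For linear forms the composition \<open>T\<close> after \<open>H\<close> is a
      scaling by the same fraction \<open>?y 0 / X 0\<close>, which then cancels.\<close>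
    have lin: "X 0 * mpoly_subst H (mpoly_subst T p) = ?y 0 * p" if "is_form d 1 p" for p
    proof -
      have "X 0 ^ 1 * mpoly_subst ?y p = ?y 0 ^ 1 * mpoly_subst X p"
        by (rule subst_scale_eq_form[OF that]) (simp only: mult.commute[of "X 0"] y(2))
      thus ?thesis by (simp add: subst_subst subst_id)
    qed
    have "(X 0 * mpoly_subst H (mpoly_subst T b')) * mpoly_subst H a = (X 0 * mpoly_subst H (mpoly_subst T b)) * mpoly_subst H c"
      using arg_cong[OF c, of "mpoly_subst H"] by (simp add: mult.assoc)
    hence "?y 0 * (b' * mpoly_subst H a) = ?y 0 * (b * mpoly_subst H c)"
      unfolding lin[OF b(1)] lin[OF b(2)] by (simp only: mult.assoc)
    hence "b' * mpoly_subst H a = b * mpoly_subst H c"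
      using mult_left_cancel[OF y(1)] by blast
    hence "b dvd mpoly_subst H a" using b(3) copD by (metis dvd_triv_left)
    then obtain q where q: "mpoly_subst H a = b * q" by (auto elim: dvdE)
    \<comment> \<open>Here \<open>a\<close> may contain variables beyond \<open>d\<close>; both
      tuples fix them by \<open>tuple_ext\<close>.\<close>
    have "K ^ n * mpoly_subst (\<lambda>k. mpoly_subst T (H k)) a = E ^ n * mpoly_subst X a"
      using KE(3) H T by (intro subst_scale_eq[OF a]) (auto simp: tuple_ext_def)
    hence "E ^ n * a = K ^ n * mpoly_subst T (mpoly_subst H a)" by (simp add: subst_subst subst_id)
    hence "mpoly_subst T b dvd E ^ n * a" by (simp add: q)
    thus "mpoly_subst T b dvd a" using M[OF KE(2)] cop_power_right copD by blast
  qed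
qed

text \<open>Apply \<open>expo_compose\<close> with \<open>w = A (ray j)\<close>: then
  \<open>A' w\<close> is \<open>ray j\<close> again, whose exponents select \<open>X j\<close> for
  \<open>k = j\<close>, and the shift \<open>c j\<close> yields the monomial factor.\<close>

lemma mono_tup_inverse:
  assumes "A \<in> carrier_mat d d" "A' \<in> carrier_mat d d" "A' * A = 1\<^sub>m d" "d \<ge> 1"
  shows "\<exists>c. \<forall>k\<le>d. mpoly_subst (mono_tup d A) (mono_tup d A' k) = (\<Prod>j\<le>d. X j ^ c j) * (X k :: 'k::idom mpoly)"
proof -
  have "\<forall>j. \<exists>c. \<forall>k\<le>d. (\<Sum>l\<le>d. expo d (A' *\<^sub>v ray d l) k * expo d (A *\<^sub>v ray d j) l) = expo d (ray d j) k + c"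
  proof
    fix j
    have "A' *\<^sub>v (A *\<^sub>v ray d j) = ray d j"
      using assms by (simp flip: assoc_mult_mat_vec)
    thus "\<exists>c. \<forall>k\<le>d. (\<Sum>l\<le>d. expo d (A' *\<^sub>v ray d l) k * expo d (A *\<^sub>v ray d j) l) = expo d (ray d j) k + c"
      using expo_compose[OF assms(2), of "A *\<^sub>v ray d j"] assms(1) by (simp add: mult_mat_vec_carrier[of _ d d])
  qed
  then obtain c where c: "\<And>j k. k \<le> d \<Longrightarrow>
      (\<Sum>l\<le>d. expo d (A' *\<^sub>v ray d l) k * expo d (A *\<^sub>v ray d j) l) = expo d (ray d j) k + c j" by metis
  have "mpoly_subst (mono_tup d A) (mono_tup d A' k) = (\<Prod>j\<le>d. X j ^ c j) * (X k :: 'k mpoly)" if k: "k \<le> d" for k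
  proof -
    have "mpoly_subst (mono_tup d A) (mono_tup d A' k)
      = (\<Prod>l\<le>d. (\<Prod>j\<le>d. X j ^ expo d (A *\<^sub>v ray d j) l) ^ expo d (A' *\<^sub>v ray d l) k :: 'k mpoly)"
      using k by (simp add: mono_tup_le)
    also have "\<dots> = (\<Prod>l\<le>d. \<Prod>j\<le>d. X j ^ (expo d (A' *\<^sub>v ray d l) k * expo d (A *\<^sub>v ray d j) l))"
      by (simp add: prod_power_distrib mult.commute flip: power_mult)
    also have "\<dots> = (\<Prod>j\<le>d. \<Prod>l\<le>d. X j ^ (expo d (A' *\<^sub>v ray d l) k * expo d (A *\<^sub>v ray d j) l))"
      by (rule prod.swap)
    also have "\<dots> = (\<Prod>j\<le>d. X j ^ c j * (if j = k then X j else 1))"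
    proof (rule prod.cong)
      fix j assume "j \<in> {..d}"
      hence "expo d (ray d j) k = (if j = k then 1 else 0)" using k assms(4) by (simp add: expo_ray)
      moreover have "(\<Prod>l\<le>d. X j ^ (expo d (A' *\<^sub>v ray d l) k * expo d (A *\<^sub>v ray d j) l) :: 'k mpoly)
          = X j ^ (expo d (ray d j) k + c j)"
        by (simp only: c[OF k] flip: power_sum)
      ultimately show "(\<Prod>l\<le>d. X j ^ (expo d (A' *\<^sub>v ray d l) k * expo d (A *\<^sub>v ray d j) l))
          = X j ^ c j * (if j = k then X j else 1 :: 'k mpoly)"
        by (simp add: power_add mult.commute)
    qed simp
    also have "\<dots> = (\<Prod>j\<le>d. X j ^ c j) * X k"
      using k by (simp add: prod.distrib prod.delta)
    finally show ?thesis .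
  qed
  thus ?thesis by blast
qed

section \<open>Tuples without common factor\<close>

lemma cop_unit: "p * p = 1 \<Longrightarrow> cop q p"
  unfolding cop_def by (metis dvd_mult mult.assoc mult_1)

text \<open>At an index \<open>k\<close> where \<open>f x\<close> has exponent 0, the power
  \<open>f x ^ e x 0\<close> is coprime to \<open>F k\<close>. Since it divides
  \<open>F 0 * R k = F k * R 0\<close>, it divides \<open>R 0\<close>. Together these powers make
  \<open>F 0\<close> a divisor of \<open>R 0\<close>, and the quotient is \<open>h\<close>.\<close>

lemma reduced_tuple:
  fixes f :: "'i \<Rightarrow> 'a::idom" and e :: "'i \<Rightarrow> nat \<Rightarrow> nat"
  assumes S: "finite S" "\<And>x y. x \<in> S \<Longrightarrow> y \<in> S \<Longrightarrow> x \<noteq> y \<Longrightarrow> cop (f x) (f y)" "\<And>x. x \<in> S \<Longrightarrow> f x \<noteq> 0"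
    and u: "\<And>k. k \<le> d \<Longrightarrow> u k * u k = 1"
    and e: "\<And>x. x \<in> S \<Longrightarrow> \<exists>k\<le>d. e x k = 0"
    and F: "\<And>k. k \<le> d \<Longrightarrow> F k = u k * (\<Prod>x\<in>S. f x ^ e x k)"
    and R: "proportional d F R"
  shows "\<exists>h. \<forall>j\<le>d. R j = h * F j"
proof -
  have F0: "F k \<noteq> 0" if "k \<le> d" for k
    using F[OF that] u[OF that] S(1,3) by auto
  have "f x ^ e x 0 dvd R 0" if x: "x \<in> S" for x
  proof -
    obtain k where k: "k \<le> d" "e x k = 0" using e x by blast
    have "cop (f x ^ e x 0) (f z ^ e z k)" if z: "z \<in> S" for z
      using S x z k(2) by (cases "z = x") (auto intro: cop_power)
    hence co: "cop (f x ^ e x 0) (F k)"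
      unfolding F[OF k(1)] by (intro cop_mult_right[OF cop_unit[OF u[OF k(1)]]] cop_prod_right)
    have "f x ^ e x 0 dvd F 0"
      unfolding F[OF le0] using S(1) x by (intro dvd_mult dvd_prodI)
    moreover have "F k * R 0 = F 0 * R k" using R k(1) unfolding proportional_def by blast
    ultimately have "f x ^ e x 0 dvd F k * R 0" by simp
    thus ?thesis by (rule copD[OF co])
  qed
  hence "(\<Prod>x\<in>S. f x ^ e x 0) dvd R 0"
    using S by (intro cop_prod_dvd) (auto intro: cop_power)
  hence "F 0 dvd u 0 * R 0" unfolding F[OF le0] by (rule mult_dvd_mono[OF dvd_refl])
  hence "F 0 dvd u 0 * (u 0 * R 0)" by (rule dvd_mult)
  hence "F 0 dvd R 0" using u[of 0] by (simp flip: mult.assoc)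
  then obtain h where h: "R 0 = F 0 * h" by (auto elim: dvdE)
  have "R j = h * F j" if "j \<le> d" for j
  proof -
    have "F 0 * R j = F j * (F 0 * h)" using R that unfolding h[symmetric] proportional_def by blast
    thus ?thesis using F0[OF le0] by (simp add: mult.left_commute mult.commute)
  qed
  thus ?thesis by blast
qed

text \<open>The cofactor \<open>p\<close> need not be a form; the component of degree
  \<open>m\<close> of the product would vanish if \<open>n > m\<close>.\<close>

lemma form_degree_mono:
  fixes p q :: "'k::idom mpoly"
  assumes "is_form d n q" "is_form d m (p * q)" "p * q \<noteq> 0"
  shows "n \<le> m"
proof (rule ccontr)
  assume "\<not> n \<le> m"
  moreover have "hcomp d m (q * p) = (if n \<le> m then q * hcomp d (m - n) p else 0)"
    using assms(1) by (intro hcomp_mult) (simp add: is_form_iff)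
  moreover have "hcomp d m (q * p) = q * p"
    using assms(2) by (subst hcomp_hform[of d m]) (auto simp: is_form_iff mult.commute)
  ultimately show False using assms(3) by (simp add: mult.commute)
qed

text \<open>Dividing \<open>F\<close> by a common factor \<open>p\<close> gives a proportional
  tuple, hence by \<open>red\<close> a multiple of \<open>F\<close>, so \<open>p\<close> is a unit.
  Any other representative without common factor is \<open>F\<close> times a unit, and the degrees
  bound each other.\<close>

lemma rat_degree_eq:
  fixes F :: "nat \<Rightarrow> 'k::idom mpoly"
  assumes F: "\<And>k. k \<le> d \<Longrightarrow> is_form d n (F k)" "F 0 \<noteq> 0"
    and red: "\<And>R. proportional d F R \<Longrightarrow> \<exists>h. \<forall>j\<le>d. R j = h * F j"
  shows "rat_degree d (ratmap_of d F) = n"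
  unfolding rat_degree_def
proof (rule the_equality)
  have "no_common_factor d F"
    unfolding no_common_factor_def
  proof (intro allI impI)
    fix p assume "\<forall>j\<le>d. p dvd F j"
    hence "\<forall>j. \<exists>r. j \<le> d \<longrightarrow> F j = p * r" by (auto simp: dvd_def)
    from choice[OF this] obtain R where R: "\<And>j. j \<le> d \<Longrightarrow> F j = p * R j" by blast
    have "proportional d F R" unfolding proportional_def
    proof (intro allI impI)
      fix i j assume "i \<le> d" "j \<le> d"
      thus "F i * R j = F j * R i" by (simp only: R mult_ac)
    qed
    then obtain h where "R 0 = h * F 0" using red by blast
    hence "F 0 = (p * h) * F 0" using R[OF le0] by (simp only: mult.assoc)
    hence "p * h = 1" using F(2) mult_cancel_right1[of "F 0" "p * h"] by blast
    thus "p dvd 1" by (metis dvd_triv_left)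
  qed
  moreover have "F \<in> ratmap_of d F" using F by (intro ratmap_of_self form_tuplesI) auto
  ultimately show "\<exists>F'\<in>ratmap_of d F. no_common_factor d F' \<and> (\<forall>j\<le>d. is_form d n (F' j))"
    using F by blast
next
  fix m assume "\<exists>F'\<in>ratmap_of d F. no_common_factor d F' \<and> (\<forall>j\<le>d. is_form d m (F' j))"
  then obtain F' where F': "F' \<in> ratmap_of d F" "no_common_factor d F'" "\<And>j. j \<le> d \<Longrightarrow> is_form d m (F' j)"
    by blast
  obtain h where h: "\<And>j. j \<le> d \<Longrightarrow> F' j = h * F j" using F'(1) red by (auto simp: ratmap_of_iff)
  have "h dvd 1" using F'(2) h unfolding no_common_factor_def by simp
  then obtain h' where h': "h * h' = 1" by (metis dvdE)
  hence nz: "h * F 0 \<noteq> 0" using F(2) by auto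
  have "n \<le> m" using form_degree_mono[of d n "F 0" m h] F F'(3)[of 0] h[of 0] nz by auto
  moreover have "F 0 = h' * F' 0" using h[of 0] h' by (simp add: mult.commute[of h'] mult.assoc[symmetric])
  hence "m \<le> n" using form_degree_mono[OF F'(3)[OF le0], of n h'] F(1)[OF le0] F(2) by metis
  ultimately show "m = n" by simp
qed

section \<open>The iterates\<close>

text \<open>
  The signs come from the relation \<open>b\<^sub>d + (-1)^d b\<^sub>0 = 2 x\<^sub>d\<close>: for odd \<open>d\<close> no rescaling of the forms
  \<open>b\<^sub>i\<close> removes the sign of the last coordinate of \<open>ghat\<close>.
\<close>

primrec sgn_it :: "nat \<Rightarrow> int mat \<Rightarrow> nat \<Rightarrow> nat \<Rightarrow> 'a::comm_ring_1" where
  "sgn_it d A 0 = (\<lambda>k. 1)"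
| "sgn_it d A (Suc n) = (\<lambda>k. \<Prod>l\<le>d. ((if n = 0 then 1 else sgn_d d l) * sgn_it d A n l) ^ expo d (A *\<^sub>v ray d l) k)"

text \<open>Here \<open>s\<close> counts the applications of h_A since the atom of level
  \<open>m\<close> first appeared.\<close>

definition lev :: "nat \<Rightarrow> int mat \<Rightarrow> nat \<Rightarrow> nat \<Rightarrow> nat \<Rightarrow> nat \<Rightarrow> nat" where
  "lev d A s m i k = expo d ((A ^\<^sub>m s) *\<^sub>v level_vec d m i) k"

text \<open>
  \<open>atom d A n 0, \<dots>, atom d A n d\<close> are, for \<open>n > 0\<close>, the strict transforms of the hyperplanes
  \<open>b\<^sub>i = 0\<close> under \<open>h\<^sub>A \<circ> f^(n - 1)\<close>. The \<open>m\<close>-th ones are mapped by \<open>h\<^sub>A \<circ> f^(n - 1)\<close> to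
  the boundary with the orders \<open>A^(n - m) v\<^sub>i\<close>.
\<close>

function atom :: "nat \<Rightarrow> int mat \<Rightarrow> nat \<Rightarrow> nat \<Rightarrow> 'k::field mpoly" where
  "atom d A n i = (if n = 0 then X i else
     (\<Sum>k\<le>d. C (B_mat d $$ (i, k)) *
        (sgn_it d A n k * (\<Prod>m<n. \<Prod>j\<le>d. atom d A m j ^ lev d A (n - m) m j k))))"
  by pat_completeness auto
termination by (relation "measure (\<lambda>(d, A, n, i). n)") auto

declare atom.simps [simp del]

text \<open>This is \<open>D_n\<close>; the summand \<open>m = 0\<close>, where
  \<open>atom_deg\<close> is 1, is the term \<open>c_n\<close>.\<close>

fun atom_deg :: "nat \<Rightarrow> int mat \<Rightarrow> nat \<Rightarrow> nat" where
  "atom_deg d A n = (if n = 0 then 1 else (\<Sum>m<n. atom_deg d A m * weight d (A ^\<^sub>m (n - m)) m))"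

declare atom_deg.simps [simp del]

text \<open>For \<open>n > 0\<close> this stands for h_A o f^(n-1), while
  \<open>it_tup d A n\<close> stands for f^n. Both are given directly by normalised exponents;
  \<open>F_mono_tup\<close> and \<open>F_pos\<close> prove that they arise from one another.\<close>

definition pre_tup :: "nat \<Rightarrow> int mat \<Rightarrow> nat \<Rightarrow> nat \<Rightarrow> 'k::field mpoly" where
  "pre_tup d A n k = (if k \<le> d then sgn_it d A n k * (\<Prod>m<n. \<Prod>j\<le>d. atom d A m j ^ lev d A (n - m) m j k) else X k)"

definition it_tup :: "nat \<Rightarrow> int mat \<Rightarrow> nat \<Rightarrow> nat \<Rightarrow> 'k::field mpoly" where
  "it_tup d A n k = (if k \<le> d then (if n = 0 then 1 else sgn_d d k) * sgn_it d A n k *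
     (\<Prod>m\<le>n. \<Prod>j\<le>d. atom d A m j ^ lev d A (n - m) m j k) else X k)"

inductive atom_prod :: "nat \<Rightarrow> int mat \<Rightarrow> nat \<Rightarrow> 'k::field mpoly \<Rightarrow> bool" for d A n where
  unit: "p * p = 1 \<Longrightarrow> atom_prod d A n p"
| atom: "m < n \<Longrightarrow> i \<le> d \<Longrightarrow> atom_prod d A n (atom d A m i)"
| mult: "atom_prod d A n p \<Longrightarrow> atom_prod d A n q \<Longrightarrow> atom_prod d A n (p * q)"

lemma atom_prod_1: "atom_prod d A n 1"
  by (rule atom_prod.unit) simp

lemma atom_prod_power: "atom_prod d A n p \<Longrightarrow> atom_prod d A n (p ^ e)"
  by (induction e) (auto intro: atom_prod_1 atom_prod.mult)

lemma atom_prod_prod: "(\<And>x. x \<in> S \<Longrightarrow> atom_prod d A n (f x)) \<Longrightarrow> atom_prod d A n (prod f S)"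
  by (induction S rule: infinite_finite_induct) (auto intro: atom_prod_1 atom_prod.mult)

lemma atom_prod_mono: "atom_prod d A n p \<Longrightarrow> n \<le> n' \<Longrightarrow> atom_prod d A n' p"
  by (induction rule: atom_prod.induct) (auto intro: atom_prod.intros)

lemma prod_square_1: "(\<And>x. x \<in> S \<Longrightarrow> f x * f x = 1) \<Longrightarrow> prod f S * prod f S = (1 :: 'a::comm_monoid_mult)"
  by (simp flip: prod.distrib)

lemma power_square_1: "a * a = 1 \<Longrightarrow> a ^ n * a ^ n = (1 :: 'a::comm_monoid_mult)"
  by (simp flip: power_mult_distrib)

lemma mult_square_1: "a * a = 1 \<Longrightarrow> b * b = 1 \<Longrightarrow> (a * b) * (a * b) = (1 :: 'a::comm_monoid_mult)"
  by (metis mult.left_commute mult.assoc mult_1_right)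

lemma sgn_it_square: "sgn_it d A n k * sgn_it d A n k = 1"
proof (induction n arbitrary: k)
  case (Suc n)
  have "((if n = 0 then 1 else sgn_d d l) * sgn_it d A n l) * ((if n = 0 then 1 else sgn_d d l) * sgn_it d A n l) = (1 :: 'a)" for l
    by (intro mult_square_1 Suc) (simp add: sgn_d_square)
  thus ?case unfolding sgn_it.simps by (intro prod_square_1 power_square_1)
qed simp

lemma sgn_it_C: "C (sgn_it d A n k) = sgn_it d A n k"
proof (induction n arbitrary: k)
  case (Suc n)
  have pw: "C (a ^ e) = C a ^ e" for a :: 'a and e by (induction e) (simp_all add: C_mult)
  have pr: "C (prod f S) = (\<Prod>x\<in>S. C (f x))" for f :: "nat \<Rightarrow> 'a" and S
    by (induction S rule: infinite_finite_induct) (simp_all add: C_mult)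
  show ?case by (simp add: pr pw C_mult Suc sgn_d_C if_distrib[of C] cong: if_cong)
qed simp

lemma is_form_unit_mult:
  "is_form d n p \<Longrightarrow> is_form d n (sgn_it d A m k * p)" "is_form d n p \<Longrightarrow> is_form d n (sgn_d d k * p)"
  by (metis is_form_C_mult sgn_it_C, metis is_form_C_mult sgn_d_C)

lemma prod_atMost_split: "(\<Prod>m\<le>n. f m) = (\<Prod>m<n. f m) * (f n :: 'a::comm_monoid_mult)" for n :: nat
  by (simp add: lessThan_Suc_atMost[symmetric])

lemma pow_mat_add:
  assumes "A \<in> carrier_mat d d"
  shows "A ^\<^sub>m (m + n) = A ^\<^sub>m m * A ^\<^sub>m n"
proof (induction n)
  case (Suc n)
  have "A ^\<^sub>m (m + Suc n) = (A ^\<^sub>m m * A ^\<^sub>m n) * A" by (simp add: Suc)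
  also have "\<dots> = A ^\<^sub>m m * (A ^\<^sub>m n * A)"
    using assms by (intro assoc_mult_mat) auto
  finally show ?case by simp
qed (use assms in simp)

lemma pow_mat_Suc_left: "A \<in> carrier_mat d d \<Longrightarrow> A ^\<^sub>m Suc n = A * A ^\<^sub>m n"
  using pow_mat_add[of A d 1 n] by simp

text \<open>The minimum is required to be unique only from \<open>s = 1\<close> on: at
  \<open>s = 0\<close> every level vector attains it at least twice.\<close>

locale iteration =
  fixes d :: nat and A A' :: "int mat" and ty :: "'k::field itself"
  assumes two: "(2 :: 'k) \<noteq> 0" and d2: "d \<ge> 2"
    and A: "A \<in> carrier_mat d d" and A': "A' \<in> carrier_mat d d"
    and AA': "A * A' = 1\<^sub>m d" and A'A: "A' * A = 1\<^sub>m d"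
    and generic: "\<And>s m i. s \<ge> 1 \<Longrightarrow> i \<le> d \<Longrightarrow> \<exists>!k. k \<le> d \<and> lev d A s m i k = 0"
begin

abbreviation Q :: "nat \<Rightarrow> nat \<Rightarrow> 'k mpoly" where "Q \<equiv> atom d A"
abbreviation G :: "nat \<Rightarrow> nat \<Rightarrow> 'k mpoly" where "G \<equiv> pre_tup d A"
abbreviation F :: "nat \<Rightarrow> nat \<Rightarrow> 'k mpoly" where "F \<equiv> it_tup d A"
abbreviation M :: "nat \<Rightarrow> 'k mpoly \<Rightarrow> bool" where "M \<equiv> atom_prod d A"

lemma d1: "d \<ge> 1" using d2 by simp

lemma Apow: "A ^\<^sub>m s \<in> carrier_mat d d"
  using A by simp

lemma pow_Suc_mult: "w \<in> carrier_vec d \<Longrightarrow> A *\<^sub>v ((A ^\<^sub>m s) *\<^sub>v w) = (A ^\<^sub>m Suc s) *\<^sub>v w"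
  unfolding pow_mat_Suc_left[OF A] by (rule assoc_mult_mat_vec[OF A Apow, symmetric])

lemma lev_attained: "\<exists>k\<le>d. lev d A s m i k = 0"
  unfolding lev_def by (rule expo_attained)

lemma Q_0: "Q 0 i = X i"
  by (simp add: atom.simps)

lemma Q_pos: "n > 0 \<Longrightarrow> i \<le> d \<Longrightarrow> Q n i = mpoly_subst (G n) (bform d i)"
  by (simp add: subst_lin, subst atom.simps, simp add: pre_tup_def)

lemma lev_0_0: "i \<le> d \<Longrightarrow> k \<le> d \<Longrightarrow> lev d A 0 0 i k = (if i = k then 1 else 0)"
  using d1 A by (simp add: lev_def level_vec_def expo_ray)

lemma lev_0_pos: "m > 0 \<Longrightarrow> i \<le> d \<Longrightarrow> k \<le> d \<Longrightarrow> lev d A 0 m i k = (if i = k \<or> i = nxt d k then 0 else 1)"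
  using A by (simp add: lev_def level_vec_def expo_v_vec)

lemma prod_if_eq: "k \<le> d \<Longrightarrow> (\<Prod>j\<le>d. f j ^ (if j = k then 1 else 0)) = (f k :: 'a::comm_monoid_mult)"
proof -
  assume "k \<le> d"
  have "(\<Prod>j\<le>d. f j ^ (if j = k then 1 else 0)) = (\<Prod>j\<le>d. if j = k then f j else 1)"
    by (intro prod.cong) auto
  thus ?thesis using \<open>k \<le> d\<close> by (simp add: prod.delta)
qed

lemma F_0: "F 0 = X"
proof
  fix k show "F 0 k = X k"
  proof (cases "k \<le> d")
    case True
    have "(\<Prod>j\<le>d. X j ^ lev d A 0 0 j k) = (\<Prod>j\<le>d. X j ^ (if j = k then 1 else 0) :: 'k mpoly)"
      using True by (intro prod.cong refl) (simp add: lev_0_0)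
    thus ?thesis using True by (simp add: it_tup_def Q_0 prod_if_eq del: power_0 power_Suc)
  qed (simp add: it_tup_def)
qed

text \<open>By \<open>expo_v_vec\<close>, the new atoms in \<open>F n k\<close> are those whose
  forms \<open>bform d j\<close> occur in \<open>ghat d k\<close>.\<close>

lemma F_pos:
  assumes "n > 0" "k \<le> d"
  shows "F n k = mpoly_subst (G n) (ghat d k)"
proof -
  have "(\<Prod>j\<le>d. Q n j ^ lev d A 0 n j k) = (\<Prod>j\<in>{..d} - {k, nxt d k}. Q n j)"
    using assms by (intro prod.mono_neutral_cong_right) (auto simp: lev_0_pos)
  hence "F n k = sgn_d d k * G n k * (\<Prod>j\<in>{..d} - {k, nxt d k}. Q n j)"
    using assms by (simp add: it_tup_def pre_tup_def prod_atMost_split mult.assoc)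
  also have "\<dots> = mpoly_subst (G n) (ghat d k)"
  proof -
    have "mpoly_subst (G n) (sgn_d d k) = sgn_d d k"
      using subst_C[of "G n" "sgn_d d k"] by (simp only: sgn_d_C)
    moreover have "(\<Prod>j\<in>{..d} - {k, nxt d k}. mpoly_subst (G n) (bform d j)) = (\<Prod>j\<in>{..d} - {k, nxt d k}. Q n j)"
      using assms by (intro prod.cong) (auto simp: Q_pos)
    ultimately show ?thesis using assms by (simp add: ghat_le)
  qed
  finally show ?thesis .
qed

lemma sum_lev:
  assumes "n > 0" "k \<le> d"
  shows "(\<Sum>m<n. \<Sum>j\<le>d. lev d A (n - m) m j k * atom_deg d A m) = atom_deg d A n"
proof -
  have "(\<Sum>j\<le>d. lev d A (n - m) m j k * atom_deg d A m) = atom_deg d A m * weight d (A ^\<^sub>m (n - m)) m" for m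
  proof -
    have "(\<Sum>j\<le>d. lev d A (n - m) m j k * atom_deg d A m) = (\<Sum>j\<le>d. lev d A (n - m) m j k) * atom_deg d A m"
      by (rule sum_distrib_right[symmetric])
    thus ?thesis using sum_expo[OF Apow assms(2) d1] by (simp add: lev_def)
  qed
  thus ?thesis unfolding atom_deg.simps[of d A n] using assms by simp
qed

lemma G_gt: "k > d \<Longrightarrow> G n k = X k" and F_gt: "k > d \<Longrightarrow> F n k = X k"
  by (simp_all add: pre_tup_def it_tup_def)

lemma atom_forms: "i \<le> d \<Longrightarrow> is_form d (atom_deg d A n) (Q n i)"
proof (induction n arbitrary: i rule: less_induct)
  case (less n)
  show ?case
  proof (cases "n = 0")
    case True
    thus ?thesis using is_form_X[of i d] less.prems by (simp add: Q_0 atom_deg.simps)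
  next
    case False
    have "is_form d (atom_deg d A n) (\<Prod>m<n. \<Prod>j\<le>d. Q m j ^ lev d A (n - m) m j k)" if k: "k \<le> d" for k
    proof -
      have "is_form d (\<Sum>m<n. \<Sum>j\<le>d. lev d A (n - m) m j k * atom_deg d A m)
          (\<Prod>m<n. \<Prod>j\<le>d. Q m j ^ lev d A (n - m) m j k)"
        using less.IH by (intro is_form_prod is_form_power) auto
      thus ?thesis using False k by (simp add: sum_lev)
    qed
    thus ?thesis using False unfolding atom.simps[of d A n i] by (auto intro!: is_form_sum is_form_C_mult is_form_unit_mult)
  qed
qed

lemma is_form_G: "n > 0 \<Longrightarrow> k \<le> d \<Longrightarrow> is_form d (atom_deg d A n) (G n k)"
proof -
  assume n: "n > 0" and k: "k \<le> d"
  have "is_form d (\<Sum>m<n. \<Sum>j\<le>d. lev d A (n - m) m j k * atom_deg d A m)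
      (\<Prod>m<n. \<Prod>j\<le>d. Q m j ^ lev d A (n - m) m j k)"
    by (intro is_form_prod is_form_power atom_forms) auto
  thus ?thesis using n k by (simp add: pre_tup_def is_form_unit_mult sum_lev)
qed

lemma is_form_F:
  assumes "k \<le> d"
  shows "is_form d (if n = 0 then 1 else d * atom_deg d A n) (F n k)"
proof (cases "n = 0")
  case True
  thus ?thesis using is_form_X[OF assms] by (simp add: F_0)
next
  case False
  hence "is_form d (d * atom_deg d A n) (mpoly_subst (G n) (ghat d k))"
    by (intro is_form_subst[OF is_form_ghat[OF two d1 assms]] is_form_G) auto
  thus ?thesis using False assms by (simp add: F_pos)
qed

lemma tuple_ext_G: "n > 0 \<Longrightarrow> tuple_ext d (G n)"
  unfolding tuple_ext_def using is_form_G[of n] G_gt[of _ n] by blast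

lemma tuple_ext_F: "tuple_ext d (F n)"
  unfolding tuple_ext_def using is_form_F[of _ n] F_gt[of _ n] by blast

text \<open>\<open>expo_compose\<close> is applied to each atom separately: its orders are
  multiplied by \<open>A\<close>, up to a shift independent of the coordinate. \<open>K\<close>
  collects the shifts, so it is a product of atoms of level at most \<open>n\<close>.\<close>

lemma F_mono_tup:
  "\<exists>K. M (Suc n) K \<and> (\<exists>r. is_form d r K) \<and> (\<forall>k\<le>d. K * G (Suc n) k = mpoly_subst (F n) (mono_tup d A k))"
proof -
  have "\<exists>c. \<forall>k\<le>d. (\<Sum>l\<le>d. expo d (A *\<^sub>v ray d l) k * lev d A s m j l) = lev d A (Suc s) m j k + c" for s m j
    using expo_compose[OF A, of "(A ^\<^sub>m s) *\<^sub>v level_vec d m j"] Apow[of s] pow_Suc_mult[of "level_vec d m j" s]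
    by (simp add: lev_def mult_mat_vec_carrier[of _ d d] del: pow_mat.simps)
  then obtain c where c: "\<And>s m j k. k \<le> d \<Longrightarrow>
      (\<Sum>l\<le>d. expo d (A *\<^sub>v ray d l) k * lev d A s m j l) = lev d A (Suc s) m j k + c s m j"
    by metis
  define K where "K = (\<Prod>m\<le>n. \<Prod>j\<le>d. Q m j ^ c (n - m) m j)"
  have "M (Suc n) K"
    unfolding K_def by (intro atom_prod_prod atom_prod_power atom_prod.atom) auto
  moreover have "is_form d (\<Sum>m\<le>n. \<Sum>j\<le>d. c (n - m) m j * atom_deg d A m) K"
    unfolding K_def by (intro is_form_prod is_form_power atom_forms) auto
  moreover have "mpoly_subst (F n) (mono_tup d A k) = K * G (Suc n) k" if k: "k \<le> d" for k
  proof -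
    let ?s = "\<lambda>l. (if n = 0 then 1 else sgn_d d l) * sgn_it d A n l"
    let ?e = "\<lambda>l. expo d (A *\<^sub>v ray d l) k"
    have "mpoly_subst (F n) (mono_tup d A k) = (\<Prod>l\<le>d. F n l ^ ?e l)"
      using k by (simp add: mono_tup_le)
    also have "\<dots> = (\<Prod>l\<le>d. ?s l ^ ?e l * (\<Prod>m\<le>n. \<Prod>j\<le>d. Q m j ^ (?e l * lev d A (n - m) m j l)))"
      by (intro prod.cong)
        (simp_all add: it_tup_def power_mult_distrib prod_power_distrib mult.commute flip: power_mult)
    also have "\<dots> = sgn_it d A (Suc n) k * (\<Prod>l\<le>d. \<Prod>m\<le>n. \<Prod>j\<le>d. Q m j ^ (?e l * lev d A (n - m) m j l))"
      by (simp add: prod.distrib)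
    \<comment> \<open>The product over \<open>l\<close> is moved innermost, so that the exponents of
      a fixed atom add up.\<close>
    also have "(\<Prod>l\<le>d. \<Prod>m\<le>n. \<Prod>j\<le>d. Q m j ^ (?e l * lev d A (n - m) m j l))
        = (\<Prod>m\<le>n. \<Prod>l\<le>d. \<Prod>j\<le>d. Q m j ^ (?e l * lev d A (n - m) m j l))"
      by (rule prod.swap)
    also have "\<dots> = (\<Prod>m\<le>n. \<Prod>j\<le>d. \<Prod>l\<le>d. Q m j ^ (?e l * lev d A (n - m) m j l))"
      by (intro prod.cong refl prod.swap)
    also have "\<dots> = (\<Prod>m\<le>n. \<Prod>j\<le>d. Q m j ^ lev d A (Suc n - m) m j k * Q m j ^ c (n - m) m j)"
      by (intro prod.cong refl) (simp only: power_sum[symmetric] c[OF k] power_add Suc_diff_le atMost_iff)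
    also have "\<dots> = (\<Prod>m\<le>n. \<Prod>j\<le>d. Q m j ^ lev d A (Suc n - m) m j k) * K"
      by (simp add: prod.distrib K_def)
    finally show ?thesis
      using k by (simp add: pre_tup_def lessThan_Suc_atMost mult_ac del: sgn_it.simps)
  qed
  ultimately show ?thesis by (intro exI[of _ K] conjI allI impI) (auto simp: exI)
qed

end

section \<open>Inverses of the iterates and coprimality of the atoms\<close>

lemma atom_prod_nonzero:
  assumes "atom_prod d A n p" "\<And>m i. m < n \<Longrightarrow> i \<le> d \<Longrightarrow> atom d A m i \<noteq> (0 :: 'k::field mpoly)"
  shows "p \<noteq> (0 :: 'k::field mpoly)"
  using assms by (induction rule: atom_prod.induct) auto

lemma pseudo_inv_mono: "pseudo_inv d M T H \<Longrightarrow> (\<And>p. M p \<Longrightarrow> M' p) \<Longrightarrow> pseudo_inv d M' T H"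
  unfolding pseudo_inv_def by meson

context iteration
begin

lemma tuple_ext_ghat: "tuple_ext d (ghat d :: nat \<Rightarrow> 'k mpoly)"
  using is_form_ghat[OF two d1] by (auto simp: tuple_ext_def ghat_def[of d "_ :: nat"] intro: exI[of _ d])

lemma tuple_ext_mono_tup: "B \<in> carrier_mat d d \<Longrightarrow> tuple_ext d (mono_tup d B :: nat \<Rightarrow> 'k mpoly)"
  using is_form_mono_tup[of B d] d1 by (auto simp: tuple_ext_def mono_tup_def[of d B "_ :: nat"] intro: exI[of _ "weight d B 0"])

lemma M_F:
  assumes "k \<le> d"
  shows "M (Suc n) (F n k)"
proof -
  have "M (Suc n) ((if n = 0 then 1 else sgn_d d k) * sgn_it d A n k)"
    by (intro atom_prod.unit mult_square_1) (simp_all add: sgn_d_square sgn_it_square)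
  moreover have "M (Suc n) (\<Prod>m\<le>n. \<Prod>j\<le>d. Q m j ^ lev d A (n - m) m j k)"
    by (intro atom_prod_prod atom_prod_power atom_prod.atom) auto
  ultimately show ?thesis using assms by (simp only: it_tup_def if_True atom_prod.mult)
qed

lemma pseudo_inv_F_0: "pseudo_inv d (M (Suc 0)) (F 0) X"
proof -
  have "tuple_ext d (X :: nat \<Rightarrow> 'k mpoly)"
    using is_form_X[of _ d] unfolding tuple_ext_def by blast
  moreover have "\<forall>k\<le>d. 1 * mpoly_subst X (X k) = 1 * (X k :: 'k mpoly)" by simp
  ultimately show ?thesis
    unfolding pseudo_inv_def F_0
    by (intro conjI exI[of _ 1]) (simp_all add: mult.commute atom_prod_1)
qed

text \<open>\<open>pseudo_inv_step\<close> with \<open>S = mono_tup d A\<close>. The error factor is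
  a monomial in the \<open>X j\<close>, which pulls back to a product of coordinates of
  \<open>F n\<close>, hence of atoms and signs.\<close>

lemma pseudo_inv_G_Suc:
  assumes "pseudo_inv d (M (Suc n)) (F n) H" and nz: "\<And>m i. m \<le> n \<Longrightarrow> i \<le> d \<Longrightarrow> Q m i \<noteq> 0"
  shows "\<exists>H. pseudo_inv d (M (Suc n)) (G (Suc n)) H"
proof -
  have M0: "p \<noteq> 0" if "M (Suc n) p" for p
    using that nz by (rule atom_prod_nonzero) auto
  obtain c c' where
    c: "\<And>k. k \<le> d \<Longrightarrow> mpoly_subst (mono_tup d A) (mono_tup d A' k) = (\<Prod>j\<le>d. X j ^ c j) * (X k :: 'k mpoly)"
    and c': "\<And>k. k \<le> d \<Longrightarrow> mpoly_subst (mono_tup d A') (mono_tup d A k) = (\<Prod>j\<le>d. X j ^ c' j) * (X k :: 'k mpoly)"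
    using mono_tup_inverse[OF A A' A'A d1, where ?'k = 'k] mono_tup_inverse[OF A' A AA' d1, where ?'k = 'k] by blast
  obtain K r where K: "M (Suc n) K" "is_form d r K" "\<And>k. k \<le> d \<Longrightarrow> K * G (Suc n) k = mpoly_subst (F n) (mono_tup d A k)"
    using F_mono_tup[of n] by blast
  have "mpoly_subst (F n) (\<Prod>j\<le>d. X j ^ c j) = (\<Prod>j\<le>d. F n j ^ c j)" by simp
  moreover have "M (Suc n) (\<Prod>j\<le>d. F n j ^ c j)"
    by (intro atom_prod_prod atom_prod_power M_F) simp
  ultimately have "M (Suc n) (mpoly_subst (F n) (\<Prod>j\<le>d. X j ^ c j))" by simp
  hence "pseudo_inv d (M (Suc n)) (G (Suc n)) (\<lambda>k. mpoly_subst (mono_tup d A') (H k))"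
    by (intro pseudo_inv_step[OF assms(1) atom_prod.mult M0 atom_prod_1 tuple_ext_G tuple_ext_mono_tup[OF A]
        tuple_ext_mono_tup[OF A'] K(3,1,2) c _ _ c']) (auto simp: mono_tup_nonzero)
  thus ?thesis by blast
qed

text \<open>\<open>pseudo_inv_step\<close> with the involution \<open>ghat\<close> as
  \<open>S\<close> and \<open>S'\<close>. The error factor pulls back to a power of the product of
  all \<open>Q n i\<close>, which is why the level rises from \<open>n\<close> to
  \<open>Suc n\<close>.\<close>

lemma pseudo_inv_F:
  assumes "pseudo_inv d (M n) (G n) H" and n: "n > 0" and nz: "\<And>m i. m \<le> n \<Longrightarrow> i \<le> d \<Longrightarrow> Q m i \<noteq> 0"
  shows "\<exists>H. pseudo_inv d (M (Suc n)) (F n) H"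
proof -
  let ?\<sigma> = "(\<Prod>i\<le>d. bform d i) ^ (d - 1) :: 'k mpoly"
  have M0: "p \<noteq> 0" if "M (Suc n) p" for p
    using that nz by (rule atom_prod_nonzero) auto
  have inv: "pseudo_inv d (M (Suc n)) (G n) H"
    using assms(1) by (rule pseudo_inv_mono) (auto intro: atom_prod_mono)
  have "mpoly_subst (G n) ?\<sigma> = (\<Prod>i\<le>d. Q n i) ^ (d - 1)" using n by (simp add: Q_pos)
  moreover have "M (Suc n) ((\<Prod>i\<le>d. Q n i) ^ (d - 1))"
    by (intro atom_prod_power atom_prod_prod atom_prod.atom) auto
  ultimately have M\<sigma>: "M (Suc n) (mpoly_subst (G n) ?\<sigma>)" by simp
  have one: "is_form d 0 (1 :: 'k mpoly)" by (simp add: is_form_iff)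
  have "?\<sigma> \<noteq> 0" using bform_nonzero[OF two d1] by simp
  note step = pseudo_inv_step[where \<kappa> = 1, OF inv atom_prod.mult M0 atom_prod_1 tuple_ext_F tuple_ext_ghat tuple_ext_ghat
      _ atom_prod_1 one ghat_ghat[OF two d1] this M\<sigma> ghat_ghat[OF two d1] this ghat_nonzero[OF two d1]]
  have "pseudo_inv d (M (Suc n)) (F n) (\<lambda>k. mpoly_subst (ghat d) (H k))"
    by (rule step) (simp_all add: F_pos[OF n])
  thus ?thesis by blast
qed

lemma pseudo_inv_G:
  assumes "\<And>m i. m \<le> n \<Longrightarrow> i \<le> d \<Longrightarrow> Q m i \<noteq> 0"
  shows "\<exists>H. pseudo_inv d (M (Suc n)) (G (Suc n)) H"
  using assms
proof (induction n)
  case 0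
  thus ?case using pseudo_inv_G_Suc[OF pseudo_inv_F_0] by auto
next
  case (Suc n)
  then obtain H where "pseudo_inv d (M (Suc n)) (G (Suc n)) H" by auto
  from pseudo_inv_F[OF this] Suc.prems obtain H' where "pseudo_inv d (M (Suc (Suc n))) (F (Suc n)) H'" by auto
  from pseudo_inv_G_Suc[OF this] Suc.prems show ?case by auto
qed

lemma B_mat_nonzero: "i \<le> d \<Longrightarrow> k \<le> d \<Longrightarrow> B_mat d $$ (i, k) \<noteq> (0 :: 'k)"
  by (simp add: B_mat_def)

text \<open>
  Modulo an earlier atom \<open>Q m j\<close> only one summand of \<open>Q n i = \<Sum>\<^sub>k B\<^sub>i\<^sub>k G\<^sub>k\<close> survives, because exactly one
  of the orders \<open>lev d A (n - m) m j k\<close> vanishes; hence that atom is coprime to \<open>Q n i\<close>. Atoms of the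
  same level are pullbacks of distinct hyperplanes under a map whose inverse is controlled by
  earlier atoms.
\<close>

lemma atoms_coprime:
  "(\<forall>i\<le>d. Q n i \<noteq> 0) \<and> (\<forall>m<n. \<forall>j\<le>d. \<forall>i\<le>d. cop (Q m j) (Q n i)) \<and>
   (\<forall>i\<le>d. \<forall>j\<le>d. i \<noteq> j \<longrightarrow> cop (Q n i) (Q n j))"
proof (induction n rule: less_induct)
  case (less n)
  show ?case
  proof (cases "n = 0")
    case True
    thus ?thesis by (simp add: Q_0 cop_X)
  next
    case False
    hence n: "n > 0" by simp
    have nz: "Q m i \<noteq> 0" if "m < n" "i \<le> d" for m i using less.IH that by blast
    have co: "cop (Q m j) (Q m' j')" if "m < n" "m' < n" "j \<le> d" "j' \<le> d" "(m, j) \<noteq> (m', j')" for m j m' j'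
      using that less.IH nz by (cases m m' rule: linorder_cases) (auto intro: cop_sym)
    have b: "cop (Q m j) (Q n i)" if m: "m < n" and j: "j \<le> d" and i: "i \<le> d" for m j i
    proof -
      from m have "n - m \<ge> 1" by simp
      from generic[OF this j, of m] obtain k0 where k0: "k0 \<le> d" "lev d A (n - m) m j k0 = 0"
        and k0': "\<And>k. k \<le> d \<Longrightarrow> lev d A (n - m) m j k = 0 \<Longrightarrow> k = k0" by blast
      have "cop (Q m j) (Q m' j' ^ lev d A (n - m') m' j' k0)" if "m' < n" "j' \<le> d" for m' j'
        using co[OF m that(1) j that(2)] k0(2) by (cases "(m, j) = (m', j')") (auto intro: cop_power_right)
      hence "cop (Q m j) (sgn_it d A n k0 * (\<Prod>m'<n. \<Prod>j'\<le>d. Q m' j' ^ lev d A (n - m') m' j' k0))"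
        by (intro cop_mult_right[OF cop_unit[OF sgn_it_square]] cop_prod_right) simp
      hence "cop (Q m j) (G n k0)" using k0(1) by (simp only: pre_tup_def if_True)
      moreover have "cop (Q m j) (C (B_mat d $$ (i, k0)))"
        unfolding cop_def
      proof (intro allI impI)
        fix a assume "Q m j dvd C (B_mat d $$ (i, k0)) * a"
        hence "Q m j dvd C (1 / B_mat d $$ (i, k0)) * (C (B_mat d $$ (i, k0)) * a)" by (rule dvd_mult)
        thus "Q m j dvd a"
          using B_mat_nonzero[OF i k0(1)] by (simp flip: mult.assoc C_mult)
      qed
      ultimately have c0: "cop (Q m j) (C (B_mat d $$ (i, k0)) * G n k0)"
        by (intro cop_mult_right)
      have "Q m j dvd G n k" if k: "k \<le> d" "k \<noteq> k0" for k
      proof -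
        have "lev d A (n - m) m j k \<noteq> 0" using k0' k by blast
        hence "Q m j dvd Q m j ^ lev d A (n - m) m j k" by (simp add: dvd_power)
        also have "\<dots> dvd (\<Prod>j\<le>d. Q m j ^ lev d A (n - m) m j k)"
          using j by (intro dvd_prodI) auto
        also have "\<dots> dvd (\<Prod>m<n. \<Prod>j\<le>d. Q m j ^ lev d A (n - m) m j k)"
          using m by (intro dvd_prodI[of _ _ "\<lambda>m. \<Prod>j\<le>d. Q m j ^ lev d A (n - m) m j k"]) auto
        finally show ?thesis using k by (simp add: pre_tup_def)
      qed
      hence "Q m j dvd (\<Sum>k\<in>{..d} - {k0}. C (B_mat d $$ (i, k)) * G n k)"
        by (intro dvd_sum dvd_mult) auto
      then obtain s where s: "(\<Sum>k\<in>{..d} - {k0}. C (B_mat d $$ (i, k)) * G n k) = Q m j * s" by (auto elim: dvdE)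
      have "Q n i = C (B_mat d $$ (i, k0)) * G n k0 + Q m j * s"
        using n i k0(1) by (simp add: Q_pos subst_lin sum.remove[of "{..d}" k0] s)
      with c0 show ?thesis by (rule cop_congruent)
    qed
    \<comment> \<open>Zero is divisible by \<open>Q 0 0 = X 0\<close>, so coprimality to that atom
      would make \<open>X 0\<close> a unit.\<close>
    have a: "Q n i \<noteq> 0" if "i \<le> d" for i
    proof
      assume "Q n i = 0"
      hence "Q 0 0 dvd Q n i * 1" by simp
      hence "Q 0 0 dvd 1" using b[OF n le0 that] copD by blast
      thus False by (simp add: Q_0 X_not_unit)
    qed
    have "cop (Q n i) (Q n j)" if ij: "i \<le> d" "j \<le> d" "i \<noteq> j" for i j
    proof -
      obtain n' where n': "n = Suc n'" using n by (cases n) auto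
      obtain H where H: "pseudo_inv d (M n) (G n) H" using pseudo_inv_G[of n'] nz n' by auto
      \<comment> \<open>The inverse \<open>H\<close> introduces only signs and atoms of level below
        \<open>n\<close>, and the latter are covered by \<open>b\<close>.\<close>
      have "cop (Q n i) p" if "M n p" for p
        using that
      proof (induction rule: atom_prod.induct)
        case (unit p)
        thus ?case by (rule cop_unit)
      next
        case (atom m j)
        show ?case by (rule cop_sym[OF b[OF atom(1,2) ij(1)] nz[OF atom(1,2)]])
      next
        case (mult p q)
        show ?case by (rule cop_mult_right[OF mult(3,4)])
      qed
      hence "cop (mpoly_subst (G n) (bform d i)) (mpoly_subst (G n) (bform d j))"
        using ij n by (intro pseudo_inv_cop[OF H] is_form_lin bform_cop[OF two d1]) (auto simp: Q_pos)
      thus ?thesis using ij n by (simp add: Q_pos)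
    qed
    thus ?thesis using a b by blast
  qed
qed

lemma Q_nonzero: "i \<le> d \<Longrightarrow> Q n i \<noteq> 0"
  using atoms_coprime by blast

lemma Q_cop: "(m, i) \<noteq> (n, j) \<Longrightarrow> i \<le> d \<Longrightarrow> j \<le> d \<Longrightarrow> cop (Q m i) (Q n j)"
  using atoms_coprime Q_nonzero by (cases m n rule: linorder_cases) (auto intro: cop_sym)

section \<open>Degrees of the iterates\<close>

lemma F_nonzero: "k \<le> d \<Longrightarrow> F n k \<noteq> 0"
  by (rule atom_prod_nonzero[OF M_F]) (assumption, rule Q_nonzero)

lemma F_reduced:
  assumes "proportional d (F n) R"
  shows "\<exists>h. \<forall>j\<le>d. R j = h * F n j"
proof (rule reduced_tuple[where S = "{..n} \<times> {..d}" and f = "\<lambda>(m, j). Q m j"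
      and e = "\<lambda>(m, j) k. lev d A (n - m) m j k" and u = "\<lambda>k. (if n = 0 then 1 else sgn_d d k) * sgn_it d A n k"])
  fix k assume "k \<le> d"
  show "((if n = 0 then 1 else sgn_d d k) * sgn_it d A n k) * ((if n = 0 then 1 else sgn_d d k) * sgn_it d A n k) = (1 :: 'k mpoly)"
    by (intro mult_square_1) (simp_all add: sgn_d_square sgn_it_square)
  show "F n k = (if n = 0 then 1 else sgn_d d k) * sgn_it d A n k *
    (\<Prod>x\<in>{..n} \<times> {..d}. (case x of (m, j) \<Rightarrow> Q m j) ^ (case x of (m, j) \<Rightarrow> \<lambda>k. lev d A (n - m) m j k) k)"
    using \<open>k \<le> d\<close> by (simp add: it_tup_def prod.cartesian_product case_prod_unfold)
next
  fix x y assume xy: "x \<in> {..n} \<times> {..d}" "y \<in> {..n} \<times> {..d}" "x \<noteq> y"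
  thus "cop (case x of (m, j) \<Rightarrow> Q m j) (case y of (m, j) \<Rightarrow> Q m j)"
    by (cases x; cases y) (auto intro!: Q_cop)
next
  fix x assume "x \<in> {..n} \<times> {..d}"
  thus "\<exists>k\<le>d. (case x of (m, j) \<Rightarrow> \<lambda>k. lev d A (n - m) m j k) k = 0"
    by (cases x) (use lev_attained in auto)
qed (use assms Q_nonzero in auto)

lemma rat_degree_F: "rat_degree d (ratmap_of d (F n)) = (if n = 0 then 1 else d * atom_deg d A n)"
  by (rule rat_degree_eq[OF is_form_F]) (auto simp: F_nonzero F_reduced)

lemma F_form_tuples: "F n \<in> form_tuples d"
  by (rule form_tuplesI[OF is_form_F, where i = 0]) (auto simp: F_nonzero)

text \<open>The factor \<open>K\<close> of \<open>F_mono_tup\<close> is raised to the power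
  \<open>d\<close>, the degree of the forms \<open>ghat d k\<close>.\<close>

lemma F_Suc: "\<exists>K. K \<noteq> 0 \<and> (\<forall>k\<le>d. mpoly_subst (F n) (mpoly_subst (mono_tup d A) (ghat d k)) = K * F (Suc n) k)"
proof -
  obtain K where K: "M (Suc n) K" "\<And>k. k \<le> d \<Longrightarrow> K * G (Suc n) k = mpoly_subst (F n) (mono_tup d A k)"
    using F_mono_tup[of n] by blast
  have "mpoly_subst (F n) (mpoly_subst (mono_tup d A) (ghat d k)) = K ^ d * F (Suc n) k" if k: "k \<le> d" for k
  proof -
    have "mpoly_subst (F n) (mpoly_subst (mono_tup d A) (ghat d k)) = mpoly_subst (\<lambda>i. mpoly_subst (F n) (mono_tup d A i)) (ghat d k)"
      by (rule subst_subst)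
    also have "\<dots> = K ^ d * mpoly_subst (G (Suc n)) (ghat d k)"
      using K(2) by (intro subst_scale_form[OF is_form_ghat[OF two d1 k]]) simp
    finally show ?thesis using k by (simp add: F_pos)
  qed
  moreover have "K \<noteq> 0" by (rule atom_prod_nonzero[OF K(1)]) (rule Q_nonzero)
  hence "K ^ d \<noteq> 0" by (rule power_not_zero)
  ultimately show ?thesis by blast
qed

abbreviation f_map :: "'k ratmap" where "f_map \<equiv> rat_comp d (g_map d) (monomial_map d A)"

lemma f_map_eq:
  shows "f_map = ratmap_of d (\<lambda>k. mpoly_subst (mono_tup d A) (ghat d k))" (is ?eq)
    and "(\<lambda>k. mpoly_subst (mono_tup d A) (ghat d k) :: 'k mpoly) \<in> form_tuples d" (is ?ft)
proof -
  have g: "(ghat d :: nat \<Rightarrow> 'k mpoly) \<in> form_tuples d"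
    by (rule form_tuplesI[OF is_form_ghat[OF two d1], where i = 0]) (auto simp: ghat_nonzero[OF two d1])
  have m: "(mono_tup d A :: nat \<Rightarrow> 'k mpoly) \<in> form_tuples d"
    by (rule form_tuplesI[OF is_form_mono_tup[OF A d1], where i = 0]) (auto simp: mono_tup_nonzero)
  \<comment> \<open>Since \<open>F 0\<close> is the identity, the composite at \<open>n = 0\<close>
    is a non-zero multiple of the non-zero form \<open>F 1 0\<close>.\<close>
  have "mpoly_subst (mono_tup d A) (ghat d 0) \<noteq> (0 :: 'k mpoly)"
  proof -
    obtain K where "K \<noteq> 0" "mpoly_subst (mono_tup d A) (ghat d 0) = K * F (Suc 0) 0"
      using F_Suc[of 0] unfolding F_0 subst_id by blast
    thus ?thesis using F_nonzero[OF le0, of "Suc 0"] by (metis mult_eq_0_iff)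
  qed
  hence nz: "\<exists>j\<le>d. mpoly_subst (mono_tup d A) (ghat d j) \<noteq> (0 :: 'k mpoly)" by blast
  show ?eq unfolding g_map_eq[OF two d1] monomial_map_eq[OF A d1] by (rule rat_comp_ratmap_of[OF g m nz])
  show ?ft by (rule form_tuples_subst[OF g m nz])
qed

lemma rat_iterate_eq: "rat_iterate d f_map n = ratmap_of d (F n)"
proof (induction n)
  case 0
  show ?case by (simp add: rat_iterate_def rat_id_def F_0)
next
  case (Suc n)
  obtain K where K: "K \<noteq> 0" "\<And>k. k \<le> d \<Longrightarrow> mpoly_subst (F n) (mpoly_subst (mono_tup d A) (ghat d k)) = K * F (Suc n) k"
    using F_Suc[of n] by blast
  have nz: "\<exists>j\<le>d. mpoly_subst (F n) (mpoly_subst (mono_tup d A) (ghat d j)) \<noteq> 0"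
    using K(1) K(2)[OF le0] F_nonzero[OF le0, of "Suc n"] by (metis le0 mult_eq_0_iff)
  have "rat_iterate d f_map (Suc n) = rat_comp d f_map (ratmap_of d (F n))"
    using Suc by (simp add: rat_iterate_def)
  also have "\<dots> = ratmap_of d (\<lambda>k. mpoly_subst (F n) (mpoly_subst (mono_tup d A) (ghat d k)))"
    unfolding f_map_eq(1) by (rule rat_comp_ratmap_of[OF f_map_eq(2) F_form_tuples nz])
  also have "\<dots> = ratmap_of d (F (Suc n))"
  proof (rule ratmap_of_eqI[OF _ nz])
    show "proportional d (\<lambda>k. mpoly_subst (F n) (mpoly_subst (mono_tup d A) (ghat d k))) (F (Suc n))"
      unfolding proportional_def
    proof (intro allI impI)
      fix i j assume "i \<le> d" "j \<le> d"
      thus "mpoly_subst (F n) (mpoly_subst (mono_tup d A) (ghat d i)) * F (Suc n) j =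
        mpoly_subst (F n) (mpoly_subst (mono_tup d A) (ghat d j)) * F (Suc n) i"
        by (simp only: K(2) mult_ac)
    qed
    show "\<exists>k\<le>d. F (Suc n) k \<noteq> 0" using F_nonzero by blast
  qed
  finally show ?case .
qed

lemma degree_iterate: "n > 0 \<Longrightarrow> rat_degree d (rat_iterate d f_map n) = d * atom_deg d A n"
  by (simp add: rat_iterate_eq rat_degree_F)

text \<open>A coordinate other than that of the unique minimum has a positive exponent. This
  supplies the bounds \<open>P j \<ge> 1\<close> and \<open>c j \<ge> 1\<close> of the renewal
  argument.\<close>

lemma weight_pos:
  assumes "s \<ge> 1"
  shows "weight d (A ^\<^sub>m s) m > 0"
proof -
  obtain k0 where k0: "\<And>k. k \<le> d \<Longrightarrow> lev d A s m 0 k = 0 \<Longrightarrow> k = k0"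
    using generic[OF assms le0, of m] by blast
  obtain k where k: "k \<le> d" "k \<noteq> k0" using d1 by (metis le0 le_antisym not_one_le_zero)
  have "lev d A s m 0 k > 0" using k0 k by blast
  also have "lev d A s m 0 k \<le> (\<Sum>i\<le>d. lev d A s m i k)" by (intro member_le_sum) auto
  also have "\<dots> = weight d (A ^\<^sub>m s) m"
    using sum_expo[OF Apow k(1) d1] by (simp add: lev_def)
  finally show ?thesis .
qed

end

section \<open>Renewal equations\<close>

text \<open>A ratio test over \<open>k\<close> steps: the terms past index \<open>k\<close> sum to
  at most \<open>\<theta>\<close> times the whole partial sum and can be absorbed.\<close>

lemma ratio_summable:
  fixes a :: "nat \<Rightarrow> real"
  assumes "\<And>j. a j \<ge> 0" "\<And>j. j \<ge> 1 \<Longrightarrow> a (j + k) \<le> \<theta> * a j" "\<theta> < 1" "\<theta> \<ge> 0"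
  shows "summable a"
proof (rule bounded_imp_summable)
  fix n
  have "sum a {..n} \<le> sum a {..k} + \<theta> * sum a {..n}"
  proof -
    have "sum a {..n} \<le> sum a ({..k} \<union> (\<lambda>j. j + k) ` {1..n})"
      using assms(1) by (intro sum_mono2) (auto simp: image_iff intro!: bexI[of _ "_ - k"])
    also have "\<dots> \<le> sum a {..k} + sum a ((\<lambda>j. j + k) ` {1..n})"
      using assms(1) by (subst sum_Un) (auto intro: sum_nonneg)
    also have "sum a ((\<lambda>j. j + k) ` {1..n}) = (\<Sum>j=1..n. a (j + k))"
      by (subst sum.reindex) auto
    also have "\<dots> \<le> (\<Sum>j=1..n. \<theta> * a j)"
      using assms(2) by (intro sum_mono) auto
    also have "\<dots> \<le> \<theta> * sum a {..n}"
      using assms(1,4) by (simp add: sum_distrib_left[symmetric]) (intro mult_left_mono sum_mono2, auto)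
    finally show ?thesis by simp
  qed
  hence "(1 - \<theta>) * sum a {..n} \<le> sum a {..k}" by (simp add: algebra_simps)
  thus "sum a {..n} \<le> sum a {..k} / (1 - \<theta>)"
    using assms(3) by (simp add: field_simps)
qed (use assms in auto)

section \<open>The root of the power series with coefficients \<open>P\<close>\<close>

context
  fixes P :: "nat \<Rightarrow> real" and K :: real
  assumes P1: "\<And>j. j \<ge> 1 \<Longrightarrow> P j \<ge> 1" and P0: "P 0 = 0"
    and sub: "\<And>m n. m \<ge> 1 \<Longrightarrow> n \<ge> 1 \<Longrightarrow> P (m + n) \<le> K * P m * P n" and K: "K > 0"
begin

lemma P_nonneg: "P j \<ge> 0"
  using P1[of j] P0 by (cases "j = 0") auto

text \<open>
  \<open>zroot\<close> will be the solution of \<open>\<Sum>\<^sub>j P\<^sub>j z\<^sup>j = 1\<close>, that is, \<open>1 / \<lambda>\<close>.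
\<close>

definition good :: "real set" where
  "good = {z. z \<ge> 0 \<and> (\<forall>n. (\<Sum>j<n. P j * z ^ j) \<le> 1)}"

lemma good_le_1: "z \<in> good \<Longrightarrow> z \<le> 1"
proof -
  assume z: "z \<in> good"
  hence "(\<Sum>j<2. P j * z ^ j) \<le> 1" "z \<ge> 0" by (auto simp: good_def)
  hence "P 1 * z \<le> 1" by (simp add: numeral_2_eq_2 P0)
  moreover have "1 * z \<le> P 1 * z" using P1[of 1] \<open>z \<ge> 0\<close> by (intro mult_right_mono) auto
  ultimately show ?thesis by simp
qed

lemma good_0: "0 \<in> good"
proof -
  have "(\<Sum>j<n. P j * 0 ^ j) = 0" for n by (intro sum.neutral) (auto simp: P0 power_0_left)
  thus ?thesis by (simp add: good_def)
qed

lemma good_bdd: "bdd_above good"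
  using good_le_1 by (intro bdd_aboveI) auto

lemma good_downward: "z \<in> good \<Longrightarrow> 0 \<le> y \<Longrightarrow> y \<le> z \<Longrightarrow> y \<in> good"
proof -
  assume z: "z \<in> good" and y: "0 \<le> y" "y \<le> z"
  have "(\<Sum>j<n. P j * y ^ j) \<le> (\<Sum>j<n. P j * z ^ j)" for n
    using y P_nonneg by (intro sum_mono mult_left_mono power_mono) auto
  thus ?thesis using z y by (auto simp: good_def intro: order_trans)
qed

definition zroot :: real where "zroot = Sup good"

lemma zroot_nonneg: "zroot \<ge> 0"
  unfolding zroot_def by (rule cSup_upper[OF good_0 good_bdd])

lemma below_zroot: "0 \<le> z \<Longrightarrow> z < zroot \<Longrightarrow> z \<in> good"
  unfolding zroot_def using good_0 good_downward by (metis empty_iff less_cSupD less_imp_le)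

lemma above_zroot: "z > zroot \<Longrightarrow> z \<notin> good"
  unfolding zroot_def using cSup_upper[OF _ good_bdd] by fastforce

text \<open>Each partial sum is continuous, so its bound passes to the limit from the left.\<close>

lemma zroot_good: "zroot \<in> good"
proof (cases "zroot = 0")
  case False
  hence pos: "zroot > 0" using zroot_nonneg by simp
  have "(\<Sum>j<n. P j * zroot ^ j) \<le> 1" for n
  proof (rule tendsto_upperbound)
    show "((\<lambda>z. \<Sum>j<n. P j * z ^ j) \<longlongrightarrow> (\<Sum>j<n. P j * zroot ^ j)) (at_left zroot)"
      by (intro tendsto_intros)
    have "eventually (\<lambda>z. z \<in> {0<..<zroot}) (at_left zroot)"
      by (rule eventually_at_leftI[of 0]) (use pos in auto)
    thus "\<forall>\<^sub>F z in at_left zroot. (\<Sum>j<n. P j * z ^ j) \<le> 1"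
      by eventually_elim (use below_zroot in \<open>auto simp: good_def\<close>)
  qed simp
  thus ?thesis using zroot_nonneg by (simp add: good_def)
qed (simp add: good_0)

lemma zroot_summable: "summable (\<lambda>j. P j * zroot ^ j)" and zroot_sum_le: "(suminf (\<lambda>j. P j * zroot ^ j)) \<le> 1"
proof -
  have nn: "P j * zroot ^ j \<ge> 0" for j using P_nonneg zroot_nonneg by simp
  have le: "(\<Sum>j<n. P j * zroot ^ j) \<le> 1" for n using zroot_good by (simp add: good_def)
  show s: "summable (\<lambda>j. P j * zroot ^ j)"
    using le[of "Suc _"] by (intro bounded_imp_summable[OF nn]) (simp add: lessThan_Suc_atMost)
  show "(suminf (\<lambda>j. P j * zroot ^ j)) \<le> 1"
    using le by (intro suminf_le_const[OF s]) auto
qed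

text \<open>
  The terms of the convergent series tend to \<open>0\<close>, so by submultiplicativity they decay geometrically.
\<close>

lemma zroot_summable_beyond: "\<exists>z>zroot. summable (\<lambda>j. P j * z ^ j)"
proof -
  have "(\<lambda>j. K * (P j * zroot ^ j)) \<longlonglongrightarrow> K * 0"
    by (intro tendsto_intros summable_LIMSEQ_zero zroot_summable)
  hence "eventually (\<lambda>j. K * (P j * zroot ^ j) < 1) sequentially"
    by (rule order_tendstoD(2)) simp
  moreover have "eventually (\<lambda>j::nat. j \<ge> 1) sequentially" by (rule eventually_ge_at_top)
  ultimately have "eventually (\<lambda>j. j \<ge> 1 \<and> K * (P j * zroot ^ j) < 1) sequentially"
    by eventually_elim simp
  then obtain k where k: "k \<ge> 1" "K * (P k * zroot ^ k) < 1" by (auto simp: eventually_sequentially)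
  have "((\<lambda>z. K * (P k * z ^ k)) \<longlongrightarrow> K * (P k * zroot ^ k)) (at_right zroot)"
    by (intro tendsto_intros)
  hence "eventually (\<lambda>z. K * (P k * z ^ k) < 1) (at_right zroot)"
    using k(2) by (rule order_tendstoD(2))
  moreover have "eventually (\<lambda>z. z > zroot) (at_right zroot)" by (rule eventually_at_right_less)
  ultimately have "eventually (\<lambda>z. z > zroot \<and> K * (P k * z ^ k) < 1) (at_right zroot)"
    by eventually_elim simp
  from eventually_happens'[OF trivial_limit_at_right_real this]
  obtain z where z: "z > zroot" "K * (P k * z ^ k) < 1" by blast
  have z0: "z \<ge> 0" using z zroot_nonneg by simp
  have "summable (\<lambda>j. P j * z ^ j)"
  proof (rule ratio_summable[of _ k "K * (P k * z ^ k)"])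
    fix j :: nat assume j: "j \<ge> 1"
    have "P (j + k) * z ^ (j + k) \<le> (K * P j * P k) * z ^ (j + k)"
      using sub[OF j k(1)] z0 by (intro mult_right_mono) auto
    thus "P (j + k) * z ^ (j + k) \<le> K * (P k * z ^ k) * (P j * z ^ j)"
      by (simp add: power_add mult_ac)
  qed (use z z0 K P_nonneg in auto)
  thus ?thesis using z by blast
qed

text \<open>The series still converges slightly beyond \<open>zroot\<close> and is continuous there;
  a sum below 1 would give a larger element of \<open>good\<close>.\<close>

lemma zroot_sums: "(\<lambda>j. P j * zroot ^ j) sums 1"
proof -
  have "\<not> (suminf (\<lambda>j. P j * zroot ^ j)) < 1"
  proof
    assume lt: "(suminf (\<lambda>j. P j * zroot ^ j)) < 1"
    obtain y where y: "y > zroot" "summable (\<lambda>j. P j * y ^ j)" using zroot_summable_beyond by blast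
    have "isCont (\<lambda>z. suminf (\<lambda>j. P j * z ^ j)) zroot"
      using y zroot_nonneg by (intro isCont_powser[OF y(2)]) auto
    hence "((\<lambda>z. suminf (\<lambda>j. P j * z ^ j)) \<longlongrightarrow> (suminf (\<lambda>j. P j * zroot ^ j))) (at_right zroot)"
      unfolding isCont_def by (rule filterlim_mono) (auto intro: at_le)
    hence "eventually (\<lambda>z. (suminf (\<lambda>j. P j * z ^ j)) < 1) (at_right zroot)"
      using lt by (rule order_tendstoD(2))
    moreover have "eventually (\<lambda>z. z \<in> {zroot<..<y}) (at_right zroot)"
      by (rule eventually_at_rightI[of _ y]) (use y in auto)
    ultimately have "eventually (\<lambda>z. z \<in> {zroot<..<y} \<and> (suminf (\<lambda>j. P j * z ^ j)) < 1) (at_right zroot)"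
      by eventually_elim simp
    from eventually_happens'[OF trivial_limit_at_right_real this]
    obtain z where z: "z > zroot" "z < y" "(suminf (\<lambda>j. P j * z ^ j)) < 1" by auto
    have s: "summable (\<lambda>j. P j * z ^ j)"
      using z zroot_nonneg by (intro powser_inside[OF y(2)]) auto
    have "(\<Sum>j<n. P j * z ^ j) \<le> (suminf (\<lambda>j. P j * z ^ j))" for n
      using z zroot_nonneg P_nonneg by (intro sum_le_suminf[OF s]) auto
    hence "z \<in> good" using z zroot_nonneg by (auto simp: good_def intro: order_trans less_imp_le)
    thus False using above_zroot z by blast
  qed
  hence "(suminf (\<lambda>j. P j * zroot ^ j)) = 1" using zroot_sum_le by simp
  thus ?thesis using zroot_summable by (simp add: sums_iff)
qed

lemma zroot_pos: "zroot > 0"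
proof (rule ccontr)
  assume "\<not> zroot > 0"
  hence "zroot = 0" using zroot_nonneg by simp
  hence "(\<lambda>j. P j * zroot ^ j) = (\<lambda>_. 0)" by (auto simp: P0 power_0_left)
  thus False using zroot_sums sums_unique2[of "\<lambda>_. 0 :: real" 1 0] by simp
qed

section \<open>Exponential growth of the renewal sequence\<close>

context
  fixes c D :: "nat \<Rightarrow> real" and C0 :: real
  assumes c: "\<And>n. n \<ge> 1 \<Longrightarrow> c n \<ge> 1" "\<And>n. n \<ge> 1 \<Longrightarrow> c n \<le> C0 * P n"
    and D: "\<And>n. n \<ge> 1 \<Longrightarrow> D n = c n + (\<Sum>m=1..<n. D m * P (n - m))"
begin

lemma D_ge_1: "n \<ge> 1 \<Longrightarrow> D n \<ge> 1"
proof (induction n rule: less_induct)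
  case (less n)
  have "(\<Sum>m=1..<n. D m * P (n - m)) \<ge> 0"
    using less.IH P_nonneg by (intro sum_nonneg mult_nonneg_nonneg) (auto intro: order_trans[of 0 1])
  thus ?case using D[OF less.prems] c(1)[OF less.prems] by simp
qed

lemma renewal_reverse: "(\<Sum>m=1..<n. g m * h (n - m)) = (\<Sum>j=1..<n. g (n - j) * h j :: real)" for n :: nat
  by (rule sum.reindex_bij_witness[of _ "\<lambda>j. n - j" "\<lambda>j. n - j"]) auto

lemma D_scaled: "n \<ge> 1 \<Longrightarrow> D n * z ^ n = c n * z ^ n + (\<Sum>j=1..<n. (D (n - j) * z ^ (n - j)) * (P j * z ^ j))"
proof -
  assume n: "n \<ge> 1"
  have "(\<Sum>m=1..<n. D m * P (n - m)) * z ^ n = (\<Sum>m=1..<n. (D m * z ^ m) * (P (n - m) * z ^ (n - m)))"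
    unfolding sum_distrib_right by (intro sum.cong) (auto simp: mult_ac simp flip: power_add)
  also have "\<dots> = (\<Sum>j=1..<n. (D (n - j) * z ^ (n - j)) * (P j * z ^ j))"
    by (rule renewal_reverse)
  finally show ?thesis by (subst D[OF n]) (simp add: ring_distribs)
qed

text \<open>By induction \<open>D n * zroot ^ n\<close> is at most \<open>C0\<close> times a partial
  sum of the series, and these are at most 1.\<close>

lemma D_upper: "n \<ge> 1 \<Longrightarrow> D n * zroot ^ n \<le> C0"
proof (induction n rule: less_induct)
  case (less n)
  let ?a = "\<lambda>j. P j * zroot ^ j"
  have C0: "C0 \<ge> 0"
  proof (rule ccontr)
    assume "\<not> C0 \<ge> 0"
    hence "C0 * P 1 \<le> 0" using P_nonneg[of 1] by (intro mult_nonpos_nonneg) auto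
    thus False using c[of 1] by simp
  qed
  have "D n * zroot ^ n \<le> C0 * ?a n + (\<Sum>j=1..<n. C0 * ?a j)"
    unfolding D_scaled[OF less.prems]
  proof (intro add_mono sum_mono)
    show "c n * zroot ^ n \<le> C0 * ?a n"
      using c(2)[OF less.prems] zroot_nonneg by (simp add: mult_right_mono flip: mult.assoc)
    fix j assume "j \<in> {1..<n}"
    thus "D (n - j) * zroot ^ (n - j) * ?a j \<le> C0 * ?a j"
      using less.IH[of "n - j"] P_nonneg zroot_nonneg by (intro mult_right_mono) auto
  qed
  also have "\<dots> = C0 * (\<Sum>j=1..n. ?a j)"
    using less.prems by (simp add: sum.last_plus sum_distrib_left atLeastLessThanSuc_atLeastAtMost[symmetric] distrib_left)
  also have "(\<Sum>j=1..n. ?a j) \<le> (\<Sum>j<Suc n. ?a j)"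
    using P_nonneg zroot_nonneg by (intro sum_mono2) auto
  also have "\<dots> \<le> 1" using zroot_good unfolding good_def by blast
  finally show ?case using C0 by (simp add: mult_left_mono)
qed

text \<open>Beyond \<open>zroot\<close> some partial sum up to \<open>J\<close> exceeds 1, so from
  \<open>n = J\<close> on the recursion preserves a lower bound \<open>e\<close>.\<close>

lemma D_lower:
  assumes "z > zroot"
  shows "\<exists>e>0. \<forall>n\<ge>1. D n * z ^ n \<ge> e"
proof -
  have z0: "z > 0" using assms zroot_nonneg by simp
  obtain J where J: "(\<Sum>j<J. P j * z ^ j) > 1"
    using above_zroot[OF assms] z0 by (auto simp: good_def not_le)
  \<comment> \<open>A lower bound for \<open>z ^ n\<close> with \<open>n < J\<close>, whether
    \<open>z\<close> is below 1 or not; it suffices there because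
    \<open>D n \<ge> 1\<close>.\<close>
  define e where "e = min 1 (z ^ J)"
  have e: "e > 0" using z0 by (simp add: e_def)
  have "D n * z ^ n \<ge> e" if "n \<ge> 1" for n
    using that
  proof (induction n rule: less_induct)
    case (less n)
    show ?case
    proof (cases "n < J")
      case True
      have "e \<le> z ^ n"
      proof (cases "z \<ge> 1")
        case True thus ?thesis by (simp add: e_def min.coboundedI1 one_le_power)
      next
        case False thus ?thesis using \<open>n < J\<close> z0 by (simp add: e_def min.coboundedI2 power_decreasing)
      qed
      also have "\<dots> \<le> D n * z ^ n" using D_ge_1[OF less.prems] z0 by simp
      finally show ?thesis .
    next
      case False
      have "e * 1 \<le> e * (\<Sum>j<J. P j * z ^ j)" using J e by (intro mult_left_mono) auto
      also have "(\<Sum>j<J. P j * z ^ j) \<le> (\<Sum>j=1..<n. P j * z ^ j)"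
      proof -
        have "(\<Sum>j<J. P j * z ^ j) = (\<Sum>j=1..<J. P j * z ^ j)"
          by (intro sum.mono_neutral_right) (auto simp: P0 not_le)
        also have "\<dots> \<le> (\<Sum>j=1..<n. P j * z ^ j)"
          using False P_nonneg z0 by (intro sum_mono2) auto
        finally show ?thesis .
      qed
      hence "e * (\<Sum>j<J. P j * z ^ j) \<le> (\<Sum>j=1..<n. e * (P j * z ^ j))"
        using e by (simp add: sum_distrib_left[symmetric])
      also have "\<dots> \<le> (\<Sum>j=1..<n. (D (n - j) * z ^ (n - j)) * (P j * z ^ j))"
        using less.IH P_nonneg z0 by (intro sum_mono mult_right_mono) auto
      also have "\<dots> \<le> D n * z ^ n"
        unfolding D_scaled[OF less.prems] using c(1)[OF less.prems] z0 by simp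
      finally show ?thesis by simp
    qed
  qed
  thus ?thesis using e by blast
qed

lemma geometric_less:
  fixes a b e :: real
  assumes "0 < a" "a < b" "e > 0"
  shows "eventually (\<lambda>n. a ^ n < e * b ^ n) sequentially"
proof -
  have "(\<lambda>n. (a / b) ^ n) \<longlonglongrightarrow> 0" using assms by (intro LIMSEQ_realpow_zero) auto
  hence "eventually (\<lambda>n. (a / b) ^ n < e) sequentially" using assms by (intro order_tendstoD)
  thus ?thesis by eventually_elim (use assms in \<open>simp add: power_divide field_simps\<close>)
qed

lemma root_less: "n > 0 \<Longrightarrow> a \<ge> 0 \<Longrightarrow> x < a ^ n \<Longrightarrow> root n x < a"
  and less_root: "n > 0 \<Longrightarrow> a \<ge> 0 \<Longrightarrow> a ^ n < x \<Longrightarrow> a < root n (x :: real)"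
  by (metis real_root_less_iff real_root_power_cancel)+

text \<open>Bounds by geometric sequences with ratios arbitrarily close to \<open>1 / zroot\<close>;
  the constants are absorbed by a slight change of the ratio.\<close>

lemma D_root_limit:
  assumes q: "q > 0"
  shows "(\<lambda>n. root n (q * D n)) \<longlonglongrightarrow> 1 / zroot"
proof (rule order_tendstoI)
  have pos: "eventually (\<lambda>n::nat. n \<ge> 1) sequentially" by (rule eventually_ge_at_top)
  note z = zroot_pos
  {
    fix a assume a: "a < 1 / zroot"
    have "max a 0 < 1 / zroot" using a z by simp
    then obtain l where l: "max a 0 < l" "l < 1 / zroot" using dense by blast
    hence "l > 0" by simp
    note l = l this
    have "1 / l > zroot" using l z by (simp add: field_simps)
    then obtain e where e: "e > 0" "\<And>n. n \<ge> 1 \<Longrightarrow> D n * (1 / l) ^ n \<ge> e" using D_lower by blast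
    obtain a' where "max a 0 < a'" "a' < l" using l(1) dense by blast
    hence a': "0 < a'" "a' < l" "a < a'" by auto
    have "eventually (\<lambda>n. a' ^ n < (q * e) * l ^ n) sequentially"
      using a' q e by (intro geometric_less) auto
    with pos show "eventually (\<lambda>n. a < root n (q * D n)) sequentially"
    proof eventually_elim
      case (elim n)
      have "e * l ^ n \<le> D n" using e(2)[OF elim(1)] l by (simp add: power_divide field_simps)
      hence "q * e * l ^ n \<le> q * D n" using q by (simp add: mult.assoc)
      hence "a' < root n (q * D n)" using elim a' by (intro less_root) auto
      thus ?case using a' by simp
    qed
  next
    fix a assume a: "1 / zroot < a"
    have "1 * zroot \<le> D 1 * zroot" using D_ge_1[of 1] z by (intro mult_right_mono) auto
    moreover have "D 1 * zroot \<le> C0" using D_upper[of 1] by simp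
    ultimately have C0: "C0 > 0" using z by linarith
    have "eventually (\<lambda>n. (1 / zroot) ^ n < (1 / (q * C0)) * a ^ n) sequentially"
      using a q C0 z by (intro geometric_less) auto
    with pos show "eventually (\<lambda>n. root n (q * D n) < a) sequentially"
    proof eventually_elim
      case (elim n)
      have "D n \<le> C0 * (1 / zroot) ^ n" using D_upper[OF elim(1)] z by (simp add: power_divide field_simps)
      hence "q * D n \<le> q * C0 * (1 / zroot) ^ n" using q by (simp add: mult.assoc)
      also have "\<dots> < a ^ n" using elim(2) q C0 by (simp add: field_simps)
      finally show ?case using elim a z by (intro root_less) (auto intro: order_trans[of _ "1 / zroot"] less_imp_le)
    qed
  }
qed

end

end

lemma renewal_root_limit:
  fixes P c D :: "nat \<Rightarrow> real"
  assumes "\<And>j. j \<ge> 1 \<Longrightarrow> P j \<ge> 1" and "K > 0"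
    and "\<And>m n. m \<ge> 1 \<Longrightarrow> n \<ge> 1 \<Longrightarrow> P (m + n) \<le> K * P m * P n"
    and "\<And>n. n \<ge> 1 \<Longrightarrow> c n \<ge> 1" "\<And>n. n \<ge> 1 \<Longrightarrow> c n \<le> C0 * P n"
    and "\<And>n. n \<ge> 1 \<Longrightarrow> D n = c n + (\<Sum>m=1..<n. D m * P (n - m))"
    and "q > 0"
  shows "\<exists>lam>0. (\<lambda>n. root n (q * D n)) \<longlonglongrightarrow> lam \<and> (\<lambda>j. P (Suc j) / lam ^ Suc j) sums 1"
proof -
  \<comment> \<open>The recursion and the resulting series involve \<open>P j\<close> only for
    \<open>j \<ge> 1\<close>; with the value 0 at 0, the power series starts at
    \<open>P 1\<close>.\<close>
  define P' where "P' = (\<lambda>j. if j = 0 then 0 else P j)"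
  have P': "P' j = P j" if "j \<ge> 1" for j using that by (simp add: P'_def)
  have a: "\<And>j. j \<ge> 1 \<Longrightarrow> P' j \<ge> 1" "P' 0 = 0"
    "\<And>m n. m \<ge> 1 \<Longrightarrow> n \<ge> 1 \<Longrightarrow> P' (m + n) \<le> K * P' m * P' n"
    using assms(1,3) by (auto simp: P'_def)
  have b: "\<And>n. n \<ge> 1 \<Longrightarrow> c n \<le> C0 * P' n"
    "\<And>n. n \<ge> 1 \<Longrightarrow> D n = c n + (\<Sum>m=1..<n. D m * P' (n - m))"
    using assms(5,6) by (auto simp: P'_def intro!: sum.cong)
  note z = zroot_pos[OF a assms(2)] zroot_sums[OF a assms(2)]
  have "(\<lambda>j. P' (Suc j) * zroot P' ^ Suc j) sums 1"
    using z(2) a(2) by (subst sums_Suc_iff) simp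
  hence "(\<lambda>j. P (Suc j) / (1 / zroot P') ^ Suc j) sums 1"
    by (simp add: P'_def power_divide)
  moreover have "(\<lambda>n. root n (q * D n)) \<longlonglongrightarrow> 1 / zroot P'"
    by (rule D_root_limit[OF a assms(2,4) b assms(7)])
  moreover have "1 / zroot P' > 0" using z(1) by simp
  ultimately show ?thesis by blast
qed

section \<open>Zeros of 3-adic binomial series\<close>

text \<open>Hansel's elementary proof of the Skolem-Mahler-Lech theorem, with the prime \<open>3\<close>.\<close>

lemma prime_three: "prime (3 :: nat)"
  by simp

lemma fact_three_times:
  "\<exists>u. \<not> 3 dvd u \<and> (fact (3 * q) :: nat) = 3 ^ q * fact q * u"
proof (induction q)
  case 0
  show ?case by (intro exI[of _ 1]) simp
next
  case (Suc q)
  then obtain u where u: "\<not> 3 dvd u" "(fact (3 * q) :: nat) = 3 ^ q * fact q * u" by blast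
  have "(fact (3 * Suc q) :: nat) = (3 * q + 3) * ((3 * q + 2) * ((3 * q + 1) * fact (3 * q)))"
    by (simp add: numeral_3_eq_3 algebra_simps)
  also have "\<dots> = 3 ^ Suc q * fact (Suc q) * ((3 * q + 2) * ((3 * q + 1) * u))"
    unfolding u(2) by (simp add: algebra_simps)
  finally have eq: "(fact (3 * Suc q) :: nat) = 3 ^ Suc q * fact (Suc q) * ((3 * q + 2) * ((3 * q + 1) * u))" .
  have "\<not> 3 dvd 3 * q + 2" "\<not> 3 dvd 3 * q + 1" by presburger+
  hence "\<not> 3 dvd (3 * q + 2) * ((3 * q + 1) * u)"
    using u(1) prime_dvd_multD[OF prime_three] by blast
  with eq show ?case by blast
qed

text \<open>Legendre's bound: \<open>v\<close> is at most half of \<open>n\<close>, so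
  \<open>3 ^ i / i!\<close> has 3-adic order at least \<open>i / 2\<close>. For the prime 2 the
  exponent in \<open>n!\<close> can be as large as \<open>n - 1\<close>.\<close>

lemma fact_three_part: "\<exists>v u. \<not> 3 dvd u \<and> (fact n :: nat) = 3 ^ v * u \<and> 2 * v \<le> n"
proof (induction n rule: less_induct)
  case (less n)
  show ?case
  proof (cases "n = 0")
    case True
    thus ?thesis by (intro exI[of _ 0] exI[of _ 1]) simp
  next
    case False
    define q r where "q = n div 3" and "r = n mod 3"
    have n: "n = 3 * q + r" and r: "r < 3" by (simp_all add: q_def r_def)
    obtain v u where vu: "\<not> 3 dvd u" "(fact q :: nat) = 3 ^ v * u" "2 * v \<le> q"
      using less.IH[of q] False by (auto simp: q_def)
    obtain w where w: "\<not> 3 dvd w" "(fact (3 * q) :: nat) = 3 ^ q * fact q * w"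
      using fact_three_times by blast
    have "\<exists>t. \<not> 3 dvd t \<and> (fact n :: nat) = t * fact (3 * q)"
    proof -
      have nd: "\<not> 3 dvd Suc (Suc (3 * q))" "\<not> 3 dvd Suc (3 * q)" by presburger+
      consider "r = 0" | "r = 1" | "r = 2" using r by linarith
      thus ?thesis
      proof cases
        case 1 thus ?thesis by (intro exI[of _ 1]) (simp add: n)
      next
        case 2 thus ?thesis using nd(2) by (intro exI[of _ "Suc (3 * q)"]) (simp add: n)
      next
        case 3
        hence n': "n = Suc (Suc (3 * q))" using n by simp
        have "\<not> 3 dvd Suc (Suc (3 * q)) * Suc (3 * q)" using nd prime_dvd_multD[OF prime_three] by blast
        moreover have "(fact n :: nat) = (Suc (Suc (3 * q)) * Suc (3 * q)) * fact (3 * q)"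
          unfolding n' fact_Suc of_nat_id mult.assoc ..
        ultimately show ?thesis by blast
      qed
    qed
    then obtain t where t: "\<not> 3 dvd t" and "(fact n :: nat) = t * fact (3 * q)" by blast
    note this(2)
    also have "\<dots> = 3 ^ (q + v) * (t * w * u)"
      unfolding w(2) vu(2) by (simp add: power_add algebra_simps)
    finally have eq: "(fact n :: nat) = 3 ^ (q + v) * (t * w * u)" .
    have "\<not> 3 dvd t * w * u"
      using t w(1) vu(1) prime_dvd_multD[OF prime_three] by blast
    moreover have "2 * (q + v) \<le> n" using vu(3) n by simp
    ultimately show ?thesis using eq by blast
  qed
qed

text \<open>Synthetic division: \<open>coeff q j\<close> is the next coefficient of the product plus
  \<open>z * coeff q (Suc j)\<close>, so divisibility descends from the top, where the coefficients
  vanish.\<close>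

lemma coeff_root_quotient:
  fixes q :: "'a::idom poly"
  assumes "\<And>j. j \<ge> Suc k \<Longrightarrow> m dvd coeff ([:-z, 1:] * q) j"
  shows "j \<ge> k \<Longrightarrow> m dvd coeff q j"
proof (induction "Suc (degree q) - j" arbitrary: j)
  case 0
  hence "coeff q j = 0" by (intro coeff_eq_0) simp
  thus ?case by simp
next
  case (Suc l)
  have "m dvd coeff q (Suc j)" using Suc by (intro Suc(1)) auto
  moreover have "m dvd coeff ([:-z, 1:] * q) (Suc j)" using Suc.prems by (intro assms) simp
  moreover have "coeff q j = coeff ([:-z, 1:] * q) (Suc j) + z * coeff q (Suc j)" by simp
  ultimately show ?case by (metis dvd_add dvd_mult)
qed

text \<open>Dividing out one root lowers by one the index from which \<open>m\<close> divides all
  coefficients; for \<open>k = 0\<close> it divides all coefficients of the quotient.\<close>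

lemma coeff_roots_quotient:
  fixes p :: "'a::idom poly"
  assumes "finite Z" "\<And>z. z \<in> Z \<Longrightarrow> poly p z = 0" "\<And>j. j \<ge> k + card Z \<Longrightarrow> m dvd coeff p j"
  shows "\<exists>q. p = (\<Prod>z\<in>Z. [:-z, 1:]) * q \<and> (\<forall>j\<ge>k. m dvd coeff q j)"
  using assms
proof (induction Z arbitrary: p rule: finite_induct)
  case empty
  thus ?case by (intro exI[of _ p]) simp
next
  case (insert z Z)
  have "poly p z = 0" using insert.prems by simp
  then obtain p' where p': "p = [:-z, 1:] * p'" by (auto simp: poly_eq_0_iff_dvd elim: dvdE)
  have "m dvd coeff ([:-z, 1:] * p') i" if "i \<ge> Suc (k + card Z)" for i
    using insert.prems(2)[of i] insert.hyps that unfolding p' by simp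
  hence *: "m dvd coeff p' j" if "j \<ge> k + card Z" for j
    using coeff_root_quotient[of "k + card Z" m z p'] that by blast
  have "poly p' y = 0" if "y \<in> Z" for y
  proof -
    have "poly p y = 0" using insert.prems(1) that by blast
    moreover have "y \<noteq> z" using insert.hyps that by blast
    ultimately show ?thesis by (simp add: p')
  qed
  from insert.IH[OF this *] obtain q where "p' = (\<Prod>z\<in>Z. [:-z, 1:]) * q" "\<forall>j\<ge>k. m dvd coeff q j" by blast
  thus ?case using insert.hyps by (intro exI[of _ q]) (simp add: p' algebra_simps)
qed

lemma dvd_poly_all_coeffs:
  fixes q :: "'a::comm_ring_1 poly"
  assumes "\<And>j. m dvd coeff q j"
  shows "m dvd poly q x"
  unfolding poly_altdef by (intro dvd_sum dvd_mult2 assms)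

definition ff_poly :: "nat \<Rightarrow> int poly" where
  "ff_poly i = (\<Prod>j<i. [:- int j, 1:])"

lemma degree_ff_poly: "degree (ff_poly i) \<le> i"
  using degree_prod_sum_le[of "{..<i}" "\<lambda>j. [:- int j, 1:]"] by (simp add: ff_poly_def o_def)

lemma poly_ff_poly: "poly (ff_poly i) (int t) = int (fact i * (t choose i))"
proof (induction i)
  case (Suc i)
  have "Suc i * (t choose Suc i) = (t - i) * (t choose i)"
    by (metis binomial_absorb_comp binomial_absorption mult.commute times_binomial_minus1_eq zero_less_Suc diff_Suc_1)
  moreover have "fact (Suc i) * (t choose Suc i) = fact i * (Suc i * (t choose Suc i))"
    by (simp only: fact_Suc of_nat_id mult_ac)
  ultimately have eq: "fact (Suc i) * (t choose Suc i) = (t - i) * (fact i * (t choose i))"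
    by (simp only: mult_ac)
  have "poly (ff_poly (Suc i)) (int t) = poly (ff_poly i) (int t) * (int t - int i)"
    by (simp add: ff_poly_def poly_prod algebra_simps)
  also have "\<dots> = int (fact i * (t choose i)) * (int t - int i)" by (simp only: Suc)
  also have "\<dots> = int ((t - i) * (fact i * (t choose i)))"
    by (cases "i \<le> t") (simp_all add: of_nat_diff)
  finally show ?case unfolding eq .
qed (simp add: ff_poly_def)

text \<open>After multiplication by \<open>N!\<close> the truncated series is an integer polynomial
  whose coefficients from index \<open>2 * k\<close> on are divisible by \<open>3 ^ (e + k)\<close>,
  with \<open>3 ^ e\<close> the part of 3 in \<open>N!\<close>. Dividing out \<open>2 * k\<close> of
  the zeros leaves only such coefficients, so \<open>3 ^ k\<close> divides \<open>b t\<close>, for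
  every \<open>k\<close>.\<close>

lemma hansel:
  fixes c :: "nat \<Rightarrow> int" and b :: "nat \<Rightarrow> int"
  assumes b: "\<And>t. b t = (\<Sum>i\<le>t. int (t choose i) * 3 ^ i * c i)"
    and inf: "infinite {t. b t = 0}"
  shows "b t = 0"
proof -
  have "3 ^ k dvd b t" for k
  proof -
    obtain Z where Z: "Z \<subseteq> {t. b t = 0}" "finite Z" "card Z = 2 * k"
      using infinite_arbitrarily_large[OF inf] by blast
    define N where "N = Max (insert t Z)"
    have N: "t \<le> N" "\<And>z. z \<in> Z \<Longrightarrow> z \<le> N" using Z(2) by (auto simp: N_def)
    \<comment> \<open>The factor \<open>N!\<close> clears the denominators \<open>i!\<close> of the
      binomial polynomials; at arguments up to \<open>N\<close> the truncation changes
      nothing.\<close>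
    define R where "R = (\<Sum>i\<le>N. Polynomial.smult (int (fact N div fact i) * 3 ^ i * c i) (ff_poly i))"
    have R: "poly R (int s) = fact N * b s" if "s \<le> N" for s
    proof -
      have "poly R (int s) = (\<Sum>i\<le>N. int (fact N div fact i) * 3 ^ i * c i * int (fact i * (s choose i)))"
        unfolding R_def poly_sum poly_smult poly_ff_poly ..
      also have "\<dots> = (\<Sum>i\<le>N. fact N * (int (s choose i) * 3 ^ i * c i))"
      proof (rule sum.cong)
        fix i assume "i \<in> {..N}"
        hence "(fact N div fact i) * fact i = (fact N :: nat)" by (simp add: fact_dvd)
        hence "int (fact N div fact i) * int (fact i) = fact N" by (metis of_nat_mult of_nat_fact)
        thus "int (fact N div fact i) * 3 ^ i * c i * int (fact i * (s choose i)) = fact N * (int (s choose i) * 3 ^ i * c i)"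
          by (simp add: mult_ac)
      qed simp
      also have "\<dots> = (\<Sum>i\<le>s. fact N * (int (s choose i) * 3 ^ i * c i))"
        using that by (intro sum.mono_neutral_right) (auto simp: not_le)
      finally show ?thesis by (simp add: b sum_distrib_left)
    qed
    obtain e u where eu: "\<not> 3 dvd u" "(fact N :: nat) = 3 ^ e * u" using fact_three_part by blast
    \<comment> \<open>Only summands with \<open>i \<ge> j \<ge> 2 * k\<close> contribute. There
      \<open>3 ^ i * N! / i!\<close> is divisible by \<open>3 ^ (e + i - v)\<close>, and
      \<open>2 * v \<le> i\<close> gives \<open>i - v \<ge> k\<close>.\<close>
    have dv: "3 ^ (e + k) dvd coeff R j" if j: "j \<ge> 2 * k" for j
      unfolding R_def coeff_sum
    proof (rule dvd_sum)
      fix i assume i: "i \<in> {..N}"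
      show "3 ^ (e + k) dvd coeff (Polynomial.smult (int (fact N div fact i) * 3 ^ i * c i) (ff_poly i)) j"
      proof (cases "j \<le> i")
        case False
        hence "coeff (ff_poly i) j = 0" using degree_ff_poly[of i] by (intro coeff_eq_0) simp
        thus ?thesis by simp
      next
        case True
        obtain v w where vw: "\<not> 3 dvd w" "(fact i :: nat) = 3 ^ v * w" "2 * v \<le> i"
          using fact_three_part by blast
        define g :: nat where "g = fact N div fact i"
        have "g * (3 ^ v * w) = 3 ^ e * u"
          unfolding g_def vw(2)[symmetric] eu(2)[symmetric] using i by (simp add: fact_dvd)
        hence "3 ^ e dvd (g * 3 ^ v) * w" by (simp add: mult.assoc)
        moreover have "coprime (3 ^ e) w"
          using vw(1) prime_imp_coprime_nat[OF prime_three] by simp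
        ultimately have "3 ^ e dvd g * 3 ^ v"
          by (simp only: coprime_dvd_mult_left_iff)
        hence "3 ^ e * 3 ^ (i - v) dvd g * 3 ^ v * 3 ^ (i - v)" by (rule mult_dvd_mono) simp
        also have "g * 3 ^ v * 3 ^ (i - v) = g * 3 ^ i"
          unfolding mult.assoc power_add[symmetric] using vw(3) by simp
        finally have "3 ^ e * 3 ^ (i - v) dvd g * 3 ^ i" .
        moreover have "(3 :: nat) ^ (e + k) dvd 3 ^ e * 3 ^ (i - v)"
          unfolding power_add[symmetric] using vw(3) True j by (intro le_imp_power_dvd) simp
        ultimately have "3 ^ (e + k) dvd (fact N div fact i) * (3 :: nat) ^ i"
          unfolding g_def using dvd_trans by blast
        hence "int (3 ^ (e + k)) dvd int ((fact N div fact i) * 3 ^ i)" by (simp only: of_nat_dvd_iff)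
        hence "3 ^ (e + k) dvd int (fact N div fact i) * 3 ^ i" by simp
        thus ?thesis by simp
      qed
    qed
    obtain q where q: "R = (\<Prod>z\<in>int ` Z. [:-z, 1:]) * q" "\<And>j. 3 ^ (e + k) dvd coeff q j"
    proof -
      have "\<exists>q. R = (\<Prod>z\<in>int ` Z. [:-z, 1:]) * q \<and> (\<forall>j\<ge>0. 3 ^ (e + k) dvd coeff q j)"
        using Z N R dv by (intro coeff_roots_quotient) (auto simp: card_image subset_iff)
      thus ?thesis using that by blast
    qed
    have "3 ^ (e + k) dvd poly R (int t)"
      unfolding q(1) poly_mult by (intro dvd_mult dvd_poly_all_coeffs q(2))
    hence "3 ^ e * 3 ^ k dvd 3 ^ e * (int u * b t)"
      using R[OF N(1)] arg_cong[OF eu(2), of int] by (simp add: power_add mult.assoc)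
    hence "3 ^ k dvd int u * b t" by simp
    moreover have "coprime (3 ^ k) (int u)"
    proof -
      have "coprime (3 ^ k) u"
        using eu(1) prime_imp_coprime_nat[OF prime_three] by simp
      thus ?thesis by (metis coprime_int_iff of_nat_numeral of_nat_power)
    qed
    ultimately show ?thesis by (simp add: coprime_dvd_mult_right_iff)
  qed
  note dv = this
  show ?thesis
  proof (rule ccontr)
    assume nz: "b t \<noteq> 0"
    hence "3 ^ nat \<bar>b t\<bar> \<le> \<bar>b t\<bar>" using dvd_imp_le_int[OF nz dv] by (simp add: power_abs)
    moreover have "int (nat \<bar>b t\<bar>) < 3 ^ nat \<bar>b t\<bar>"
    proof -
      have "nat \<bar>b t\<bar> < 3 ^ nat \<bar>b t\<bar>" by (rule power_gt_expt) simp
      thus ?thesis by (metis of_nat_less_iff of_nat_numeral of_nat_power)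
    qed
    ultimately show False by simp
  qed
qed

section \<open>Linear recurrences with irreducible characteristic polynomial\<close>

text \<open>The linear functional on polynomials that sends the power \<open>x^i\<close> to
  \<open>u i\<close>.\<close>

definition seq_app :: "'a::comm_ring_1 poly \<Rightarrow> (nat \<Rightarrow> 'a) \<Rightarrow> 'a" where
  "seq_app p u = (\<Sum>i\<le>degree p. coeff p i * u i)"

lemma seq_app_upto: "degree p \<le> n \<Longrightarrow> seq_app p u = (\<Sum>i\<le>n. coeff p i * u i)"
  unfolding seq_app_def by (rule sum.mono_neutral_left) (auto simp: coeff_eq_0)

lemma seq_app_add: "seq_app (p + q) u = seq_app p u + seq_app q u"
proof -
  let ?n = "max (degree p) (degree q)"
  have "degree (p + q) \<le> ?n" by (rule degree_add_le_max)
  thus ?thesis by (simp add: seq_app_upto[of _ ?n] ring_distribs sum.distrib)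
qed

lemma seq_app_smult: "seq_app (Polynomial.smult c p) u = c * seq_app p u"
  using degree_smult_le[of c p] by (simp add: seq_app_upto[of _ "degree p"] sum_distrib_left mult.assoc)

lemma seq_app_0 [simp]: "seq_app 0 u = 0"
  by (simp add: seq_app_def)

lemma seq_app_pCons: "seq_app (pCons a p) u = a * u 0 + seq_app p (\<lambda>i. u (Suc i))"
proof -
  have "degree (pCons a p) \<le> Suc (degree p)" by (simp add: degree_pCons_le)
  from seq_app_upto[OF this]
  have "seq_app (pCons a p) u = (\<Sum>i\<le>Suc (degree p). coeff (pCons a p) i * u i)" .
  thus ?thesis by (simp add: sum.atMost_Suc_shift seq_app_def del: sum.atMost_Suc)
qed

lemma seq_app_mult_monom: "seq_app (p * Polynomial.monom 1 n) u = seq_app p (\<lambda>i. u (n + i))"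
proof (induction n arbitrary: u)
  case (Suc n)
  have "p * Polynomial.monom 1 (Suc n) = pCons 0 (p * Polynomial.monom 1 n)" by (simp add: monom_Suc)
  thus ?case by (simp add: seq_app_pCons Suc)
qed (simp add: monom_0)

text \<open>\<open>p\<close>, as a polynomial in the shift operator, annihilates \<open>u\<close>;
  such polynomials form an ideal.\<close>

definition kills :: "'a::comm_ring_1 poly \<Rightarrow> (nat \<Rightarrow> 'a) \<Rightarrow> bool" where
  "kills p u \<longleftrightarrow> (\<forall>n. seq_app p (\<lambda>i. u (n + i)) = 0)"

lemma kills_shift: "kills p u \<Longrightarrow> kills p (\<lambda>i. u (m + i))"
  unfolding kills_def
proof
  fix n assume "\<forall>n. seq_app p (\<lambda>i. u (n + i)) = 0"
  from spec[OF this, of "m + n"] show "seq_app p (\<lambda>i. u (m + (n + i))) = 0" by (simp only: add.assoc)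
qed

lemma kills_mult: "kills p u \<Longrightarrow> kills (p * q) u"
proof (induction q arbitrary: u)
  case 0
  thus ?case by (simp add: kills_def)
next
  case (pCons a q)
  show ?case
    unfolding kills_def
  proof
    fix n
    have "kills (p * q) (\<lambda>i. u (Suc n + i))" using pCons.IH kills_shift[OF pCons.prems] by blast
    hence "seq_app (p * q) (\<lambda>i. u (n + Suc i)) = 0" unfolding kills_def by (auto dest: spec[of _ 0])
    moreover have "seq_app p (\<lambda>i. u (n + i)) = 0" using pCons.prems by (simp add: kills_def)
    ultimately show "seq_app (p * pCons a q) (\<lambda>i. u (n + i)) = 0"
      by (simp add: seq_app_add seq_app_smult seq_app_pCons)
  qed
qed

lemma kills_add: "kills p u \<Longrightarrow> kills q u \<Longrightarrow> kills (p + q) u"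
  by (simp add: kills_def seq_app_add)

lemma kills_1: "kills 1 u \<longleftrightarrow> (\<forall>n. u n = 0)"
  by (simp add: kills_def seq_app_def)

lemma irreducible_bezout:
  fixes p q :: "rat poly"
  assumes "irreducible q" "p \<noteq> 0" "degree p < degree q"
  shows "\<exists>a b. a * p + b * q = 1"
proof -
  have "prime_elem q" using assms(1) by (rule irreducible_imp_prime_elem_gcd)
  moreover have "\<not> q dvd p" using assms(2,3) by (auto dest: dvd_imp_degree_le)
  ultimately have "coprime q p" by (rule prime_elem_imp_coprime)
  hence "gcd p q = 1" by (simp add: coprime_iff_gcd_eq_1 gcd.commute)
  thus ?thesis using bezout_coefficients_fst_snd[of p q] by (intro exI) auto
qed

text \<open>By Bezout the ideal of annihilating polynomials contains 1.\<close>

lemma irreducible_kills: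
  fixes p q :: "rat poly"
  assumes "irreducible q" "p \<noteq> 0" "degree p < degree q" "kills p u" "kills q u"
  shows "u n = 0"
proof -
  obtain a b where "a * p + b * q = 1" using irreducible_bezout[OF assms(1-3)] by blast
  moreover have "kills (a * p + b * q) u"
    using kills_mult[OF assms(4), of a] kills_mult[OF assms(5), of b] by (intro kills_add) (simp_all add: mult.commute)
  ultimately show ?thesis by (simp add: kills_1)
qed

text \<open>In characteristic 0 the derivative is non-zero of smaller degree, so by Bezout it has no
  root in common with \<open>q\<close>.\<close>

lemma irreducible_complex_roots:
  fixes q :: "rat poly"
  assumes "irreducible q" "poly (map_poly complex_of_rat q) a = 0"
  shows "poly (pderiv (map_poly of_rat q)) a \<noteq> 0"
proof
  assume 0: "poly (pderiv (map_poly of_rat q)) a = 0"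
  have "degree q \<noteq> 0"
  proof
    assume "degree q = 0"
    then obtain c where c: "q = [:c:]" by (metis degree_0_id)
    have "q \<noteq> 0" "\<not> is_unit q" using assms(1) by (auto simp: irreducible_def)
    thus False using c by (simp add: is_unit_pCons_iff)
  qed
  moreover have "degree (pderiv q) = degree q - 1" by (rule degree_pderiv)
  moreover have "pderiv q \<noteq> 0" using \<open>degree q \<noteq> 0\<close> by (simp add: pderiv_eq_0_iff)
  ultimately obtain r s where rs: "r * pderiv q + s * q = 1"
    using irreducible_bezout[OF assms(1), of "pderiv q"] by auto
  interpret h: map_poly_idom_hom "of_rat :: rat \<Rightarrow> complex" ..
  have "map_poly complex_of_rat (r * pderiv q + s * q)
    = map_poly of_rat r * pderiv (map_poly of_rat q) + map_poly of_rat s * map_poly of_rat q"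
    by (simp add: of_rat_hom.map_poly_pderiv h.hom_add h.hom_mult)
  hence "poly (map_poly complex_of_rat (r * pderiv q + s * q)) a = 0"
    by (simp only: poly_add poly_mult 0 assms(2) mult_zero_right add_0)
  thus False unfolding rs by simp
qed

lemma poly_eq_const_plus: "\<exists>t. (p :: 'a::idom poly) = [:poly p x:] + [:-x, 1:] * t"
proof -
  have "poly (p - [:poly p x:]) x = 0" by simp
  then obtain t where "p - [:poly p x:] = [:-x, 1:] * t"
    unfolding poly_eq_0_iff_dvd dvd_def by blast
  hence "p = [:poly p x:] + [:-x, 1:] * t" by (simp only: diff_eq_eq add.commute)
  thus ?thesis by blast
qed

text \<open>
  A rational sequence that is killed by a complex polynomial of degree less than \<open>n\<close> has a
  singular \<open>n \<times> n\<close> Hankel matrix, whence a rational polynomial of degree less than \<open>n\<close> kills it.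
\<close>

lemma kills_descend:
  fixes u :: "nat \<Rightarrow> rat" and c q :: "_ poly"
  assumes c: "kills c (\<lambda>i. complex_of_rat (u i))" "c \<noteq> 0" "degree c < degree q"
    and q: "kills q u" "lead_coeff q = 1"
  shows "\<exists>p. p \<noteq> 0 \<and> degree p < degree q \<and> kills p u"
proof -
  define n where "n = degree q"
  define H where "H = mat n n (\<lambda>(i, j). u (i + j))"
  have H: "H \<in> carrier_mat n n" by (simp add: H_def)
  define w where "w = vec n (coeff c)"
  have "map_mat complex_of_rat H *\<^sub>v w = 0\<^sub>v n"
  proof (rule eq_vecI)
    fix i assume "i < dim_vec (0\<^sub>v n :: complex vec)"
    hence i: "i < n" by simp
    have "(map_mat complex_of_rat H *\<^sub>v w) $ i = (\<Sum>j<n. coeff c j * of_rat (u (i + j)))"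
      using i by (simp add: H_def w_def scalar_prod_def atLeast0LessThan mult.commute)
    also have "\<dots> = (\<Sum>j\<le>n - 1. coeff c j * of_rat (u (i + j)))"
      using c(3) by (intro sum.cong) (auto simp: n_def)
    also have "\<dots> = seq_app c (\<lambda>j. of_rat (u (i + j)))"
      using c(3) by (intro seq_app_upto[symmetric]) (auto simp: n_def)
    finally show "(map_mat complex_of_rat H *\<^sub>v w) $ i = 0\<^sub>v n $ i"
      using c(1) i by (simp add: kills_def)
  qed (simp add: H_def)
  moreover have "w \<noteq> 0\<^sub>v n"
  proof
    assume "w = 0\<^sub>v n"
    hence "w $ degree c = 0" using c(3) by (simp add: n_def)
    thus False using c(2,3) by (simp add: w_def n_def)
  qed
  moreover have "w \<in> carrier_vec n" by (simp add: w_def)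
  ultimately have "det (map_mat complex_of_rat H) = 0"
    using det_0_iff_vec_prod_zero_field[of "map_mat complex_of_rat H" n] H by auto
  hence "det H = 0" by (simp add: of_rat_hom.hom_det)
  then obtain v where v: "v \<in> carrier_vec n" "v \<noteq> 0\<^sub>v n" "H *\<^sub>v v = 0\<^sub>v n"
    using det_0_iff_vec_prod_zero_field[OF H] by blast
  define p where "p = (\<Sum>j<n. Polynomial.monom (v $ j) j)"
  have cp: "coeff p j = (if j < n then v $ j else 0)" for j
    by (simp add: p_def coeff_sum sum.delta)
  have "n > 0" using c(3) by (simp add: n_def)
  have deg: "degree p \<le> n - 1" using cp by (intro degree_le) auto
  have p0: "p \<noteq> 0"
  proof
    assume "p = 0"
    hence "v $ j = 0" if "j < n" for j using cp[of j] that by simp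
    thus False using v(1,2) by (metis carrier_vecD eq_vecI index_zero_vec)
  qed
  \<comment> \<open>The Hankel kernel gives the first \<open>n\<close> values. As a combination of
    shifts of \<open>u\<close>, this sequence also obeys the monic recurrence \<open>q\<close>, so
    the later values vanish too.\<close>
  have zero: "seq_app p (\<lambda>i. u (k + i)) = 0" for k
  proof (induction k rule: less_induct)
    case (less k)
    show ?case
    proof (cases "k < n")
      case True
      have "seq_app p (\<lambda>i. u (k + i)) = (\<Sum>j\<le>n - 1. coeff p j * u (k + j))" by (rule seq_app_upto[OF deg])
      also have "\<dots> = (\<Sum>j<n. v $ j * u (k + j))"
        using \<open>n > 0\<close> by (intro sum.cong) (auto simp: cp)
      also have "\<dots> = (H *\<^sub>v v) $ k"
        using True v(1) by (simp add: H_def scalar_prod_def atLeast0LessThan mult.commute)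
      finally show ?thesis using True v(3) by simp
    next
      case False
      define y where "y = (\<lambda>k. seq_app p (\<lambda>i. u (k + i)))"
      have "(\<Sum>m\<le>n. coeff q m * y (k - n + m)) = 0"
      proof -
        have "(\<Sum>m\<le>n. coeff q m * y (k - n + m)) = (\<Sum>m\<le>n. \<Sum>i\<le>degree p. coeff q m * (coeff p i * u (k - n + m + i)))"
          by (simp add: y_def seq_app_def sum_distrib_left)
        also have "\<dots> = (\<Sum>i\<le>degree p. \<Sum>m\<le>n. coeff q m * (coeff p i * u (k - n + m + i)))" by (rule sum.swap)
        also have "\<dots> = (\<Sum>i\<le>degree p. coeff p i * seq_app q (\<lambda>m. u ((k - n + i) + m)))"
          by (simp add: seq_app_def n_def sum_distrib_left algebra_simps)
        also have "\<dots> = 0" using q(1) by (simp add: kills_def)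
        finally show ?thesis .
      qed
      moreover have "(\<Sum>m\<le>n. coeff q m * y (k - n + m)) = (\<Sum>m<n. coeff q m * y (k - n + m)) + y k"
        using False q(2) by (simp add: lessThan_Suc_atMost[symmetric] n_def)
      moreover have "(\<Sum>m<n. coeff q m * y (k - n + m)) = 0"
      proof (intro sum.neutral ballI)
        fix m assume "m \<in> {..<n}"
        hence "k - n + m < k" using False by simp
        from less.IH[OF this] show "coeff q m * y (k - n + m) = 0" by (simp only: y_def mult_zero_right)
      qed
      ultimately show ?thesis by (simp add: y_def)
    qed
  qed
  hence "kills p u" by (simp add: kills_def)
  moreover have "degree p < degree q" using deg \<open>n > 0\<close> by (simp add: n_def)
  ultimately show ?thesis using p0 by blast
qed

text \<open>
  With \<open>Q = (x - \<xi>) q\<^sub>1\<close>, the polynomial \<open>\<Prod>\<^sub>z (x\<^sup>M - z\<^sup>M)\<close> over the roots \<open>z\<close> of \<open>q\<^sub>1\<close> extracts the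
  \<open>\<xi>\<close>-component of \<open>u\<close> from its values on the progression. As this component vanishes, \<open>q\<^sub>1\<close> kills \<open>u\<close>.
\<close>

lemma progression_zero:
  fixes u :: "nat \<Rightarrow> rat" and q :: "rat poly" and xi :: complex
  assumes q: "irreducible q" "lead_coeff q = 1" "kills q u"
    and xi: "poly (map_poly of_rat q) xi = 0"
    and sep: "\<And>a. poly (map_poly of_rat q) a = 0 \<Longrightarrow> a \<noteq> xi \<Longrightarrow> a ^ M \<noteq> xi ^ M"
    and zero: "\<And>n. u (r + M * n) = 0" and xi0: "xi \<noteq> 0"
  shows "u n = 0"
proof -
  define Q where "Q = map_poly complex_of_rat q"
  define S where "S = {a. poly Q a = 0} - {xi}"
  have Q0: "Q \<noteq> 0" using q(2) by (auto simp: Q_def)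
  have finS: "finite S" unfolding S_def using poly_roots_finite[OF Q0] by simp
  have "rsquarefree Q" unfolding rsquarefree_roots
    using irreducible_complex_roots[OF q(1)] by (auto simp: Q_def)
  from complex_poly_decompose_rsquarefree[OF this]
  have "Polynomial.smult (lead_coeff Q) (\<Prod>z\<in>{z. poly Q z = 0}. [:-z, 1:]) = Q" .
  moreover have "lead_coeff Q = 1" using q(2) by (simp add: Q_def)
  moreover have "{z. poly Q z = 0} = insert xi S" using xi by (auto simp: S_def Q_def)
  moreover have "xi \<notin> S" by (simp add: S_def)
  ultimately have Q: "Q = [:-xi, 1:] * (\<Prod>z\<in>S. [:-z, 1:])" using finS by simp
  define q1 where "q1 = (\<Prod>z\<in>S. [:-z, 1:])"
  define s where "s = (\<Prod>z\<in>S. [:-(z ^ M), 1:])"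
  define sM where "sM = pcompose s (Polynomial.monom 1 M)"
  have psM: "poly sM x = (\<Prod>z\<in>S. x ^ M - z ^ M)" for x
    by (simp add: sM_def poly_pcompose s_def poly_prod poly_monom)
  \<comment> \<open>With modulus 1 this is division by the linear factors of the roots in
    \<open>S\<close>, at which \<open>sM\<close> vanishes.\<close>
  have "\<exists>t. sM = q1 * t \<and> (\<forall>j\<ge>0. 1 dvd coeff t j)"
    unfolding q1_def using finS by (intro coeff_roots_quotient) (auto simp: psM)
  then obtain t where t: "sM = q1 * t" by blast
  have "xi ^ M - z ^ M \<noteq> 0" if "z \<in> S" for z
  proof -
    have "z ^ M \<noteq> xi ^ M" using that by (intro sep) (auto simp: S_def Q_def)
    thus ?thesis by (metis eq_iff_diff_eq_0)
  qed
  hence "poly sM xi \<noteq> 0" unfolding psM using finS by simp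
  hence txi: "poly t xi \<noteq> 0" by (simp add: t)
  let ?U = "\<lambda>i. complex_of_rat (u i)"
  have QU: "kills Q ?U"
  proof -
    have "seq_app Q (\<lambda>i. ?U (n + i)) = of_rat (seq_app q (\<lambda>i. u (n + i)))" for n
      by (simp add: seq_app_def Q_def of_rat_sum of_rat_mult)
    thus ?thesis using q(3) by (simp add: kills_def)
  qed
  \<comment> \<open>Modulo \<open>Q\<close>, which kills the sequence, \<open>x * q1\<close> equals
    \<open>xi * q1\<close>; hence \<open>p\<close> acts on \<open>q1\<close> through its value at
    \<open>xi\<close>.\<close>
  have *: "seq_app (q1 * p) ?U = poly p xi * seq_app q1 ?U" for p
  proof -
    obtain t' where t': "p = [:poly p xi:] + [:-xi, 1:] * t'" using poly_eq_const_plus by blast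
    have "q1 * p = Polynomial.smult (poly p xi) q1 + Q * t'"
      by (subst t') (simp add: Q q1_def[symmetric] algebra_simps)
    moreover have "seq_app (Q * t') ?U = 0"
      using kills_mult[OF QU, of t'] unfolding kills_def by (auto dest: spec[of _ 0])
    ultimately show ?thesis by (simp add: seq_app_add seq_app_smult)
  qed
  \<comment> \<open>Only exponents of the form \<open>r + M * i\<close> occur in this polynomial,
    and there the sequence is zero.\<close>
  have "seq_app (sM * Polynomial.monom 1 r) ?U = 0"
  proof -
    have "sM = (\<Sum>i\<le>degree s. Polynomial.monom (coeff s i) (M * i))"
    proof -
      have "pcompose (Polynomial.monom c i) (Polynomial.monom 1 M) = Polynomial.monom c (M * i)" for c :: complex and i
        by (rule poly_ext) (simp add: poly_pcompose poly_monom power_mult)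
      thus ?thesis
        unfolding sM_def by (subst poly_as_sum_of_monoms[of s, symmetric]) (simp add: pcompose_sum)
    qed
    hence eq: "sM * Polynomial.monom 1 r = (\<Sum>i\<le>degree s. Polynomial.monom (coeff s i) (M * i + r))"
      by (simp add: sum_distrib_right mult_monom)
    have mono: "seq_app (Polynomial.monom c k) ?U = c * ?U k" for c k
      using degree_monom_le[of c k] by (subst seq_app_upto[of _ k]) (simp_all add: if_distrib[of "\<lambda>x. x * _"] sum.delta cong: if_cong)
    have sum: "seq_app (\<Sum>i\<le>k. f i) ?U = (\<Sum>i\<le>k. seq_app (f i) ?U)" for k :: nat and f
      by (induction k) (simp_all add: seq_app_add)
    show ?thesis unfolding eq sum mono using zero by (simp add: add.commute)
  qed
  also have "sM * Polynomial.monom 1 r = q1 * (t * Polynomial.monom 1 r)" by (simp add: t mult.assoc)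
  finally have "poly t xi * xi ^ r * seq_app q1 ?U = 0" unfolding * by (simp add: poly_monom)
  hence q1U: "seq_app q1 ?U = 0" using txi xi0 by simp
  have "kills q1 ?U"
    unfolding kills_def
  proof
    fix n
    have "seq_app (q1 * Polynomial.monom 1 n) ?U = 0" unfolding * q1U by simp
    also have "seq_app (q1 * Polynomial.monom 1 n) ?U = seq_app q1 (\<lambda>i. ?U (n + i))"
      by (rule seq_app_mult_monom)
    finally show "seq_app q1 (\<lambda>i. ?U (n + i)) = 0" .
  qed
  moreover have "q1 \<noteq> 0" using Q Q0 by (auto simp: q1_def)
  moreover have "degree q1 < degree q"
  proof -
    have "degree Q = degree [:-xi, 1:] + degree q1"
      unfolding Q using \<open>q1 \<noteq> 0\<close> by (subst degree_mult_eq) (auto simp: q1_def)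
    thus ?thesis by (simp add: Q_def)
  qed
  ultimately obtain p where "p \<noteq> 0" "degree p < degree q" "kills p u"
    using kills_descend[of q1 u q] q by blast
  thus ?thesis using irreducible_kills[OF q(1)] q(3) by blast
qed

section \<open>Orbits of integer matrices\<close>

lemma mult_mat_vec_nth:
  "M \<in> carrier_mat d d \<Longrightarrow> w \<in> carrier_vec d \<Longrightarrow> k < d \<Longrightarrow> (M *\<^sub>v w) $ k = (\<Sum>j<d. M $$ (k, j) * w $ j)"
  by (simp add: scalar_prod_def atLeast0LessThan)

lemma mult_mat_nth:
  "M \<in> carrier_mat d d \<Longrightarrow> N \<in> carrier_mat d d \<Longrightarrow> k < d \<Longrightarrow> j < d \<Longrightarrow>
   (M * N) $$ (k, j) = (\<Sum>i<d. M $$ (k, i) * N $$ (i, j))"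
  by (simp add: scalar_prod_def atLeast0LessThan)

lemma vec_eq_zeroI: "v \<in> carrier_vec d \<Longrightarrow> (\<And>j. j < d \<Longrightarrow> v $ j = 0) \<Longrightarrow> v = 0\<^sub>v d"
  by (rule eq_vecI) auto

lemma pow_mat_mult:
  assumes "A \<in> carrier_mat d d"
  shows "(A ^\<^sub>m m) ^\<^sub>m n = A ^\<^sub>m (m * n)"
proof (induction n)
  case (Suc n)
  thus ?case using pow_mat_add[OF assms, of "m * n" m] by (simp add: add.commute)
qed (use assms in simp)

lemma pow_mat_inverse:
  assumes A: "A \<in> carrier_mat d d" and B: "B \<in> carrier_mat d d" and AB: "A * B = 1\<^sub>m d"
  shows "A ^\<^sub>m n * B ^\<^sub>m n = 1\<^sub>m d"
proof (induction n)
  case (Suc n)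
  have "A ^\<^sub>m Suc n * B ^\<^sub>m Suc n = (A ^\<^sub>m n * A) * (B * B ^\<^sub>m n)"
    using pow_mat_Suc_left[OF B] by simp
  also have "\<dots> = A ^\<^sub>m n * (A * (B * B ^\<^sub>m n))"
    using A B by (intro assoc_mult_mat) auto
  also have "A * (B * B ^\<^sub>m n) = (A * B) * B ^\<^sub>m n"
    using A B by (intro assoc_mult_mat[symmetric]) auto
  also have "\<dots> = B ^\<^sub>m n" using AB B by simp
  finally show ?case using Suc by simp
qed (use A B in simp)

text \<open>Comparing coefficients in \<open>adj(x - T) * (x - T) = char_poly T\<close> and applying
  them to the vectors \<open>T^m v\<close> produces a telescoping sum.\<close>

lemma cayley_hamilton_orbit:
  fixes T :: "'a::comm_ring_1 mat"
  assumes T: "T \<in> carrier_mat d d" and v: "v \<in> carrier_vec d" and i: "i < d"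
  shows "seq_app (char_poly T) (\<lambda>m. ((T ^\<^sub>m m) *\<^sub>v v) $ i) = 0"
proof -
  define N where "N = adj_mat (char_poly_matrix T)"
  define y where "y = (\<lambda>m j. ((T ^\<^sub>m m) *\<^sub>v v) $ j)"
  have N: "N \<in> carrier_mat d d" and NT: "N * char_poly_matrix T = char_poly T \<cdot>\<^sub>m 1\<^sub>m d"
    using adj_mat[of "char_poly_matrix T" d] T by (auto simp: N_def char_poly_def)
  have y_Suc: "y (Suc m) k = (\<Sum>j<d. T $$ (k, j) * y m j)" if k: "k < d" for m k
  proof -
    have "(T ^\<^sub>m Suc m) *\<^sub>v v = T *\<^sub>v ((T ^\<^sub>m m) *\<^sub>v v)"
      unfolding pow_mat_Suc_left[OF T] using T v by (intro assoc_mult_mat_vec) auto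
    thus ?thesis
      using T v k mult_mat_vec_nth[OF T, of "(T ^\<^sub>m m) *\<^sub>v v" k] by (simp add: y_def mult_mat_vec_carrier[of _ d d] del: pow_mat.simps)
  qed
  have entry: "pCons 0 (N $$ (i, j)) - (\<Sum>k<d. Polynomial.smult (T $$ (k, j)) (N $$ (i, k)))
      = (if i = j then char_poly T else 0)" if j: "j < d" for j
  proof -
    have "(N * char_poly_matrix T) $$ (i, j) = (\<Sum>k<d. N $$ (i, k) * ((if k = j then [:0, 1:] else 0) + [:- (T $$ (k, j)):]))"
      using N T i j by (subst mult_mat_nth[of _ d]) (auto simp: char_poly_matrix_def intro!: sum.cong)
    also have "\<dots> = (\<Sum>k<d. (if k = j then pCons 0 (N $$ (i, k)) else 0) - Polynomial.smult (T $$ (k, j)) (N $$ (i, k)))"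
      by (intro sum.cong) (auto simp: algebra_simps)
    also have "\<dots> = pCons 0 (N $$ (i, j)) - (\<Sum>k<d. Polynomial.smult (T $$ (k, j)) (N $$ (i, k)))"
      using j by (simp add: sum_subtractf sum.delta)
    finally have "(N * char_poly_matrix T) $$ (i, j)
      = pCons 0 (N $$ (i, j)) - (\<Sum>k<d. Polynomial.smult (T $$ (k, j)) (N $$ (i, k)))" .
    moreover have "(N * char_poly_matrix T) $$ (i, j) = (if i = j then char_poly T else 0)"
      unfolding NT using i j by simp
    ultimately show ?thesis by (simp only:)
  qed
  \<comment> \<open>Entry \<open>i\<close> of the \<open>m\<close>-th coefficient matrix of
    \<open>x * adj(x - T)\<close>, applied to \<open>T^m v\<close>.\<close>
  define Z where "Z = (\<lambda>m. \<Sum>j<d. coeff (pCons 0 (N $$ (i, j))) m * y m j)"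
  have tele: "coeff (char_poly T) m * y m i = Z m - Z (Suc m)" for m
  proof -
    have "coeff (char_poly T) m * y m i = (\<Sum>j<d. if j = i then coeff (char_poly T) m * y m j else 0)"
      using i by (simp add: sum.delta)
    also have "\<dots> = (\<Sum>j<d. coeff (if i = j then char_poly T else 0) m * y m j)"
      by (intro sum.cong) auto
    also have "\<dots> = (\<Sum>j<d. coeff (pCons 0 (N $$ (i, j)) - (\<Sum>k<d. Polynomial.smult (T $$ (k, j)) (N $$ (i, k)))) m * y m j)"
      by (intro sum.cong) (auto simp: entry)
    also have "\<dots> = Z m - (\<Sum>j<d. \<Sum>k<d. T $$ (k, j) * coeff (N $$ (i, k)) m * y m j)"
      by (simp add: Z_def coeff_sum left_diff_distrib sum_subtractf sum_distrib_right)
    also have "(\<Sum>j<d. \<Sum>k<d. T $$ (k, j) * coeff (N $$ (i, k)) m * y m j)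
        = (\<Sum>k<d. \<Sum>j<d. T $$ (k, j) * coeff (N $$ (i, k)) m * y m j)" by (rule sum.swap)
    also have "\<dots> = Z (Suc m)"
      unfolding Z_def by (intro sum.cong) (auto simp: y_Suc sum_distrib_left mult_ac)
    finally show ?thesis .
  qed
  define L where "L = Suc (degree (char_poly T) + (\<Sum>j<d. degree (N $$ (i, j))))"
  have "Z 0 = 0" by (simp add: Z_def)
  moreover have "Z (Suc L) = 0"
  proof -
    have "coeff (N $$ (i, j)) L = 0" if "j < d" for j
    proof (rule coeff_eq_0)
      have "degree (N $$ (i, j)) \<le> (\<Sum>j<d. degree (N $$ (i, j)))" using that by (intro member_le_sum) auto
      thus "degree (N $$ (i, j)) < L" by (simp add: L_def)
    qed
    thus ?thesis by (simp add: Z_def)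
  qed
  moreover have "seq_app (char_poly T) (\<lambda>m. y m i) = (\<Sum>m\<le>L. Z m - Z (Suc m))"
    by (subst seq_app_upto[of _ L]) (auto simp: L_def tele)
  moreover have "(\<Sum>m\<le>L. Z m - Z (Suc m)) = Z 0 - Z (Suc L)" by (rule sum_telescope)
  ultimately show ?thesis by (simp add: y_def)
qed

text \<open>Two powers of \<open>T\<close> agree modulo 3 by the pigeonhole principle, and the
  inverse of the smaller one is again an integer matrix.\<close>

lemma pow_mod_3:
  fixes T :: "int mat"
  assumes T: "T \<in> carrier_mat d d" and Ti: "Ti \<in> carrier_mat d d" "Ti * T = 1\<^sub>m d"
  shows "\<exists>M B. M \<ge> 1 \<and> B \<in> carrier_mat d d \<and> T ^\<^sub>m M = 1\<^sub>m d + 3 \<cdot>\<^sub>m B"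
proof -
  define g where "g = (\<lambda>s. restrict (\<lambda>p. ((T ^\<^sub>m s) $$ p) mod 3) ({..<d} \<times> {..<d}))"
  have "g s \<in> ({..<d} \<times> {..<d}) \<rightarrow>\<^sub>E {0..<3}" for s by (auto simp: g_def)
  hence "g ` UNIV \<subseteq> ({..<d} \<times> {..<d}) \<rightarrow>\<^sub>E {0..<3}" by blast
  moreover have "finite (({..<d} \<times> {..<d}) \<rightarrow>\<^sub>E {0..<3::int})" by (intro finite_PiE) auto
  ultimately have "finite (g ` UNIV)" by (rule finite_subset)
  hence "\<not> inj g" using finite_imageD infinite_UNIV_nat by blast
  then obtain a b where ab: "a \<noteq> b" "g a = g b" by (auto simp: inj_def)
  obtain s M where s: "M \<ge> 1" "g s = g (s + M)"
  proof (cases "a < b")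
    case True thus ?thesis using that[of "b - a" a] ab by simp
  next
    case False thus ?thesis using that[of "a - b" b] ab by simp
  qed
  have Tp: "T ^\<^sub>m k \<in> carrier_mat d d" "Ti ^\<^sub>m k \<in> carrier_mat d d" for k using T Ti by auto
  define E where "E = mat d d (\<lambda>p. ((T ^\<^sub>m (s + M)) $$ p - (T ^\<^sub>m s) $$ p) div 3)"
  have E: "E \<in> carrier_mat d d" by (simp add: E_def)
  have TE: "T ^\<^sub>m (s + M) = T ^\<^sub>m s + 3 \<cdot>\<^sub>m E"
  proof (rule eq_matI)
    fix i j assume "i < dim_row (T ^\<^sub>m s + 3 \<cdot>\<^sub>m E)" "j < dim_col (T ^\<^sub>m s + 3 \<cdot>\<^sub>m E)"
    hence ij: "i < d" "j < d" using E by auto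
    have "((T ^\<^sub>m s) $$ (i, j)) mod 3 = ((T ^\<^sub>m (s + M)) $$ (i, j)) mod 3"
      using fun_cong[OF s(2), of "(i, j)"] ij by (simp add: g_def)
    hence "3 dvd (T ^\<^sub>m (s + M)) $$ (i, j) - (T ^\<^sub>m s) $$ (i, j)" by (metis mod_eq_dvd_iff)
    thus "(T ^\<^sub>m (s + M)) $$ (i, j) = (T ^\<^sub>m s + 3 \<cdot>\<^sub>m E) $$ (i, j)"
      using ij E Tp[of s] T by (simp add: E_def)
  qed (use E T in auto)
  define B where "B = Ti ^\<^sub>m s * E"
  have inv: "Ti ^\<^sub>m s * T ^\<^sub>m s = 1\<^sub>m d" by (rule pow_mat_inverse[OF Ti(1) T Ti(2)])
  have "T ^\<^sub>m M = (Ti ^\<^sub>m s * T ^\<^sub>m s) * T ^\<^sub>m M" unfolding inv by (rule left_mult_one_mat[OF Tp(1), symmetric])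
  also have "\<dots> = Ti ^\<^sub>m s * T ^\<^sub>m (s + M)"
    unfolding pow_mat_add[OF T] by (rule assoc_mult_mat[OF Tp(2) Tp(1) Tp(1)])
  also have "\<dots> = 1\<^sub>m d + 3 \<cdot>\<^sub>m B"
    unfolding TE B_def using Tp[of s] E inv
    by (simp add: mult_add_distrib_mat[of _ d d _ d] mult_smult_distrib[of _ d d _ d])
  finally show ?thesis using s(1) Tp[of s] E by (intro exI[of _ M] exI[of _ B]) (simp add: B_def)
qed

text \<open>The binomial theorem, by induction through
  \<open>R^(n+1) v = R^n v + 3 R^n (B v)\<close> for arbitrary \<open>v\<close>. It yields sequences
  of the form required by \<open>hansel\<close>.\<close>

lemma pow_one_plus:
  fixes B :: "int mat"
  assumes B: "B \<in> carrier_mat d d" and R: "R = 1\<^sub>m d + 3 \<cdot>\<^sub>m B" and v: "v \<in> carrier_vec d" and j: "j < d"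
  shows "((R ^\<^sub>m n) *\<^sub>v v) $ j = (\<Sum>i\<le>n. int (n choose i) * 3 ^ i * ((B ^\<^sub>m i) *\<^sub>v v) $ j)"
  using v
proof (induction n arbitrary: v)
  case 0
  have "R \<in> carrier_mat d d" using B by (simp add: R)
  thus ?case using 0 B by simp
next
  case (Suc n)
  have Rc: "R \<in> carrier_mat d d" "R ^\<^sub>m n \<in> carrier_mat d d" using B by (simp_all add: R)
  let ?w = "B *\<^sub>v v"
  have w: "?w \<in> carrier_vec d" using B Suc.prems by simp
  have Rv: "R *\<^sub>v v = v + 3 \<cdot>\<^sub>v ?w"
    using B Suc.prems w by (intro eq_vecI) (auto simp: R add_mult_distrib_mat_vec[of _ d d] scalar_prod_def sum_distrib_left mult.assoc)
  have eqR: "(R ^\<^sub>m Suc n) *\<^sub>v v = (R ^\<^sub>m n) *\<^sub>v (v + 3 \<cdot>\<^sub>v ?w)"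
    unfolding Rv[symmetric] pow_mat.simps using Rc Suc.prems by (intro assoc_mult_mat_vec) auto
  have "((R ^\<^sub>m Suc n) *\<^sub>v v) $ j = (\<Sum>l<d. (R ^\<^sub>m n) $$ (j, l) * (v + 3 \<cdot>\<^sub>v ?w) $ l)"
    unfolding eqR by (rule mult_mat_vec_nth[OF Rc(2) _ j]) (use Suc.prems w in simp)
  also have "\<dots> = (\<Sum>l<d. (R ^\<^sub>m n) $$ (j, l) * v $ l) + 3 * (\<Sum>l<d. (R ^\<^sub>m n) $$ (j, l) * ?w $ l)"
    using w B by (simp add: ring_distribs sum.distrib sum_distrib_left mult_ac del: index_mult_mat_vec)
  finally have "((R ^\<^sub>m Suc n) *\<^sub>v v) $ j = ((R ^\<^sub>m n) *\<^sub>v v) $ j + 3 * ((R ^\<^sub>m n) *\<^sub>v ?w) $ j"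
    by (simp only: mult_mat_vec_nth[OF Rc(2) w j] mult_mat_vec_nth[OF Rc(2) Suc.prems j])
  moreover have "(B ^\<^sub>m i) *\<^sub>v ?w = (B ^\<^sub>m Suc i) *\<^sub>v v" for i
    using B Suc.prems by (simp add: assoc_mult_mat_vec[of _ d d _ d])
  moreover define x where "x = (\<lambda>i. 3 ^ i * ((B ^\<^sub>m i) *\<^sub>v v) $ j)"
  ultimately have "((R ^\<^sub>m Suc n) *\<^sub>v v) $ j
    = (\<Sum>i\<le>n. int (n choose i) * x i) + (\<Sum>i\<le>n. int (n choose i) * x (Suc i))"
    using Suc.IH[OF Suc.prems] Suc.IH[OF w] by (simp add: x_def sum_distrib_left mult_ac del: pow_mat.simps index_mult_mat_vec)
  also have "(\<Sum>i\<le>n. int (n choose i) * x i) = (\<Sum>i\<le>Suc n. int (n choose i) * x i)" by simp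
  also have "\<dots> = x 0 + (\<Sum>i\<le>n. int (n choose Suc i) * x (Suc i))"
    by (subst sum.atMost_Suc_shift) simp
  also have "\<dots> + (\<Sum>i\<le>n. int (n choose i) * x (Suc i)) = (\<Sum>i\<le>Suc n. int (Suc n choose i) * x i)"
    by (subst sum.atMost_Suc_shift) (simp add: ring_distribs sum.distrib)
  finally show ?case by (simp add: x_def mult.assoc del: pow_mat.simps index_mult_mat_vec sum.atMost_Suc)
qed

section \<open>Orbits under a matrix with irreducible characteristic polynomial\<close>

locale irreducible_matrix =
  fixes d :: nat and T Ti :: "int mat" and xi :: complex
  assumes T: "T \<in> carrier_mat d d" and Ti: "Ti \<in> carrier_mat d d"
    and TiT: "Ti * T = 1\<^sub>m d"
    and irr: "irreducible (char_poly (map_mat rat_of_int T))"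
    and max_ev: "{\<mu>. eigenvalue (map_mat complex_of_int T) \<mu> \<and>
          (\<forall>\<nu>. eigenvalue (map_mat complex_of_int T) \<nu> \<longrightarrow> cmod \<nu> \<le> cmod \<mu>)} = {xi, cnj xi}"
    and xi_powers: "\<And>j::int. j \<noteq> 0 \<Longrightarrow> xi powi j \<notin> \<real>"
begin

abbreviation orb :: "int vec \<Rightarrow> nat \<Rightarrow> int vec" where
  "orb v n \<equiv> (T ^\<^sub>m n) *\<^sub>v v"

abbreviation chi :: "rat poly" where
  "chi \<equiv> char_poly (map_mat rat_of_int T)"

lemma Tpow: "T ^\<^sub>m n \<in> carrier_mat d d"
  using T by simp

lemma orb_carrier: "v \<in> carrier_vec d \<Longrightarrow> orb v n \<in> carrier_vec d"
  using Tpow by (rule mult_mat_vec_carrier)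

lemma orb_orb: "v \<in> carrier_vec d \<Longrightarrow> orb (orb v m) n = orb v (n + m)"
  unfolding pow_mat_add[OF T] by (rule assoc_mult_mat_vec[OF Tpow Tpow, symmetric])

lemma degree_chi: "degree chi = d" and monic_chi: "lead_coeff chi = 1"
  using degree_monic_char_poly[of "map_mat rat_of_int T" d] T by auto

lemma chi_roots: "poly (map_poly complex_of_rat chi) a = 0 \<longleftrightarrow> eigenvalue (map_mat complex_of_int T) a"
proof -
  have "map_mat complex_of_rat (map_mat rat_of_int T) = map_mat complex_of_int T"
    by (rule eq_matI) auto
  hence "map_poly complex_of_rat chi = char_poly (map_mat complex_of_int T)"
    using of_rat_hom.char_poly_hom[of "map_mat rat_of_int T" d, where ?'a = complex] T by simp
  thus ?thesis using eigenvalue_root_char_poly[of "map_mat complex_of_int T" d a] T by simp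
qed

lemma kills_orbit:
  assumes v: "v \<in> carrier_vec d"
  shows "kills chi (\<lambda>n. rat_of_int (\<Sum>j<d. w j * orb v n $ j))"
  unfolding kills_def
proof
  fix n
  have chi: "chi = map_poly rat_of_int (char_poly T)" using of_int_hom.char_poly_hom[OF T] .
  have deg: "degree chi = degree (char_poly T)" unfolding chi by simp
  have "(\<Sum>m\<le>degree (char_poly T). coeff (char_poly T) m * (\<Sum>j<d. w j * orb v (n + m) $ j))
    = (\<Sum>m\<le>degree (char_poly T). \<Sum>j<d. w j * (coeff (char_poly T) m * orb (orb v n) m $ j))"
    using v by (simp add: orb_orb sum_distrib_left mult_ac add.commute)
  also have "\<dots> = (\<Sum>j<d. \<Sum>m\<le>degree (char_poly T). w j * (coeff (char_poly T) m * orb (orb v n) m $ j))"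
    by (rule sum.swap)
  also have "\<dots> = (\<Sum>j<d. w j * seq_app (char_poly T) (\<lambda>m. orb (orb v n) m $ j))"
    by (simp add: seq_app_def sum_distrib_left)
  also have "\<dots> = 0"
    using cayley_hamilton_orbit[OF T orb_carrier[OF v]] by simp
  finally have zero: "(\<Sum>m\<le>degree (char_poly T). coeff (char_poly T) m * (\<Sum>j<d. w j * orb v (n + m) $ j)) = 0" .
  have "seq_app chi (\<lambda>i. rat_of_int (\<Sum>j<d. w j * orb v (n + i) $ j))
    = rat_of_int (\<Sum>m\<le>degree (char_poly T). coeff (char_poly T) m * (\<Sum>j<d. w j * orb v (n + m) $ j))"
    unfolding seq_app_def deg by (simp only: chi coeff_map_poly of_int_0 of_int_sum of_int_mult)
  thus "seq_app chi (\<lambda>i. rat_of_int (\<Sum>j<d. w j * orb v (n + i) $ j)) = 0"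
    unfolding zero of_int_0 .
qed

text \<open>A singular matrix of the first \<open>d\<close> orbit vectors would give a polynomial of
  degree below \<open>d\<close> killing the orbit, contradicting irreducibility. Its determinant and
  adjugate supply \<open>\<delta>\<close> and \<open>a\<close>, so the spanning property is stated
  over the integers.\<close>

lemma cyclic:
  assumes v: "v \<in> carrier_vec d" "v \<noteq> 0\<^sub>v d"
  shows "\<exists>\<delta> a. \<delta> \<noteq> 0 \<and> (\<forall>l<d. \<forall>j<d. (\<Sum>i<d. a i l * orb v i $ j) = (if j = l then \<delta> else 0))"
proof -
  define K where "K = mat d d (\<lambda>(j, i). orb v i $ j)"
  have K: "K \<in> carrier_mat d d" by (simp add: K_def)
  have "det K \<noteq> 0"
  proof
    assume "det K = 0"
    hence "det (map_mat rat_of_int K) = 0" by (simp add: of_int_hom.hom_det)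
    then obtain p where p: "p \<in> carrier_vec d" "p \<noteq> 0\<^sub>v d" "map_mat rat_of_int K *\<^sub>v p = 0\<^sub>v d"
      using det_0_iff_vec_prod_zero_field[of "map_mat rat_of_int K" d] K by auto
    have rel: "(\<Sum>i<d. p $ i * rat_of_int (orb v i $ j)) = 0" if j: "j < d" for j
    proof -
      have "(map_mat rat_of_int K *\<^sub>v p) $ j = (\<Sum>i<d. rat_of_int (orb v i $ j) * p $ i)"
        using K p(1) j by (subst mult_mat_vec_nth[of _ d]) (auto simp: K_def)
      thus ?thesis using p(3) j by (simp add: mult.commute)
    qed
    have rel': "(\<Sum>i<d. p $ i * rat_of_int (orb v (n + i) $ j)) = 0" if j: "j < d" for j n
    proof -
      have "(\<Sum>i<d. p $ i * rat_of_int (orb v (n + i) $ j))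
        = (\<Sum>i<d. \<Sum>l<d. rat_of_int ((T ^\<^sub>m n) $$ (j, l)) * (p $ i * rat_of_int (orb v i $ l)))"
      proof (intro sum.cong refl)
        fix i
        have "orb v (n + i) $ j = (\<Sum>l<d. (T ^\<^sub>m n) $$ (j, l) * orb v i $ l)"
          unfolding orb_orb[OF v(1), symmetric] by (rule mult_mat_vec_nth[OF Tpow orb_carrier[OF v(1)] j])
        thus "p $ i * rat_of_int (orb v (n + i) $ j)
          = (\<Sum>l<d. rat_of_int ((T ^\<^sub>m n) $$ (j, l)) * (p $ i * rat_of_int (orb v i $ l)))"
          by (simp add: sum_distrib_left mult_ac)
      qed
      also have "\<dots> = (\<Sum>l<d. \<Sum>i<d. rat_of_int ((T ^\<^sub>m n) $$ (j, l)) * (p $ i * rat_of_int (orb v i $ l)))"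
        by (rule sum.swap)
      also have "\<dots> = (\<Sum>l<d. rat_of_int ((T ^\<^sub>m n) $$ (j, l)) * (\<Sum>i<d. p $ i * rat_of_int (orb v i $ l)))"
        by (simp add: sum_distrib_left)
      finally show ?thesis using rel by simp
    qed
    define P where "P = (\<Sum>i<d. Polynomial.monom (p $ i) i)"
    have cP: "coeff P i = (if i < d then p $ i else 0)" for i
      by (simp add: P_def coeff_sum sum.delta)
    have P0: "P \<noteq> 0"
    proof
      assume "P = 0"
      hence "p $ i = 0" if "i < d" for i using cP[of i] that by simp
      thus False using p(2) vec_eq_zeroI[OF p(1)] by blast
    qed
    have "d > 0" using p(2) vec_eq_zeroI[OF p(1)] by (cases "d = 0") auto
    have "degree P \<le> d - 1" using cP by (intro degree_le) auto
    hence deg: "degree P < degree chi" using \<open>d > 0\<close> by (simp add: degree_chi)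
    have "v $ j = 0" if j: "j < d" for j
    proof -
      have "kills P (\<lambda>n. rat_of_int (orb v n $ j))"
        unfolding kills_def
      proof
        fix n
        have "seq_app P (\<lambda>i. rat_of_int (orb v (n + i) $ j)) = (\<Sum>i\<le>d - 1. coeff P i * rat_of_int (orb v (n + i) $ j))"
          by (rule seq_app_upto) fact
        also have "\<dots> = (\<Sum>i<d. p $ i * rat_of_int (orb v (n + i) $ j))"
          using \<open>d > 0\<close> by (intro sum.cong) (auto simp: cP)
        finally show "seq_app P (\<lambda>i. rat_of_int (orb v (n + i) $ j)) = 0" using rel'[OF j] by simp
      qed
      moreover have "kills chi (\<lambda>n. rat_of_int (orb v n $ j))"
      proof -
        have "(\<Sum>l<d. (if l = j then 1 else 0) * orb v n $ l) = orb v n $ j" for n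
          using j by (simp add: if_distrib[of "\<lambda>x. x * _"] sum.delta cong: if_cong)
        thus ?thesis using kills_orbit[OF v(1), of "\<lambda>l. if l = j then 1 else 0"] by simp
      qed
      ultimately have "rat_of_int (orb v 0 $ j) = 0" by (rule irreducible_kills[OF irr P0 deg])
      thus ?thesis using T v(1) by simp
    qed
    hence "v = 0\<^sub>v d" by (rule vec_eq_zeroI[OF v(1)])
    thus False using v(2) by contradiction
  qed
  moreover have "\<forall>l<d. \<forall>j<d. (\<Sum>i<d. adj_mat K $$ (i, l) * orb v i $ j) = (if j = l then det K else 0)"
  proof (intro allI impI)
    fix l j assume l: "l < d" and j: "j < d"
    have "(K * adj_mat K) $$ (j, l) = (\<Sum>i<d. K $$ (j, i) * adj_mat K $$ (i, l))"
      by (rule mult_mat_nth[OF K adj_mat(1)[OF K] j l])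
    also have "\<dots> = (\<Sum>i<d. adj_mat K $$ (i, l) * orb v i $ j)"
      using j by (intro sum.cong) (auto simp: K_def mult.commute)
    also have "(K * adj_mat K) $$ (j, l) = (if j = l then det K else 0)"
      unfolding adj_mat(2)[OF K] using l j by simp
    finally show "(\<Sum>i<d. adj_mat K $$ (i, l) * orb v i $ j) = (if j = l then det K else 0)"
      by (rule sym)
  qed
  ultimately show ?thesis by (intro exI[of _ "det K"] exI[of _ "\<lambda>i l. adj_mat K $$ (i, l)"] conjI)
qed

lemma max_eigenvalue_iff:
  "eigenvalue (map_mat complex_of_int T) \<mu> \<and> (\<forall>\<nu>. eigenvalue (map_mat complex_of_int T) \<nu> \<longrightarrow> cmod \<nu> \<le> cmod \<mu>)
   \<longleftrightarrow> \<mu> = xi \<or> \<mu> = cnj xi"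
  using max_ev by (simp add: set_eq_iff)

text \<open>Equal powers force \<open>a\<close> to have the modulus of \<open>xi\<close>, so
  \<open>a\<close> is its conjugate; then \<open>xi ^ M\<close> is real.\<close>

lemma xi_separated:
  assumes "poly (map_poly of_rat chi) a = 0" "a \<noteq> xi" "M \<ge> 1"
  shows "a ^ M \<noteq> xi ^ M"
proof
  assume eq: "a ^ M = xi ^ M"
  have "cmod a ^ M = cmod xi ^ M" using arg_cong[OF eq, of cmod] by (simp only: norm_power)
  hence "cmod a = cmod xi"
    by (rule power_eq_imp_eq_base) (use assms(3) in simp_all)
  moreover have "\<forall>\<nu>. eigenvalue (map_mat complex_of_int T) \<nu> \<longrightarrow> cmod \<nu> \<le> cmod xi"
    using max_eigenvalue_iff[of xi] by blast
  moreover have "eigenvalue (map_mat complex_of_int T) a" using assms(1) chi_roots by blast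
  ultimately have "a = xi \<or> a = cnj xi" unfolding max_eigenvalue_iff[of a, symmetric] by simp
  hence "a = cnj xi" using assms(2) by blast
  hence "cnj (xi ^ M) = xi ^ M" using eq by (simp only: complex_cnj_power)
  hence "xi ^ M \<in> \<real>" by (simp only: Reals_cnj_iff)
  thus False using xi_powers[of "int M"] assms(3) by simp
qed

text \<open>
  Since \<open>T\<^sup>M \<equiv> 1\<close> modulo \<open>3\<close> for some \<open>M\<close>, the sequence is a 3-adic binomial series along each
  progression modulo \<open>M\<close>, so infinitely many zeros force it to vanish on a whole progression.
\<close>

lemma orbit_zero_finite:
  assumes v: "v \<in> carrier_vec d" "v \<noteq> 0\<^sub>v d" and w: "l < d" "w l \<noteq> 0"
  shows "finite {n. (\<Sum>j<d. w j * orb v n $ j) = 0}"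
proof (rule ccontr)
  define u where "u = (\<lambda>n. \<Sum>j<d. w j * orb v n $ j)"
  assume "infinite {n. (\<Sum>j<d. w j * orb v n $ j) = 0}"
  hence inf: "infinite {n. u n = 0}" by (simp add: u_def)
  obtain M B where M: "M \<ge> 1" and B: "B \<in> carrier_mat d d" and TM: "T ^\<^sub>m M = 1\<^sub>m d + 3 \<cdot>\<^sub>m B"
    using pow_mod_3[OF T Ti TiT] by blast
  have "{n. u n = 0} \<subseteq> (\<Union>r<M. (\<lambda>n. r + M * n) ` {n. u (r + M * n) = 0})"
  proof
    fix n assume n: "n \<in> {n. u n = 0}"
    have "n = n mod M + M * (n div M)" by simp
    moreover have "n mod M < M" using M by simp
    ultimately show "n \<in> (\<Union>r<M. (\<lambda>n. r + M * n) ` {n. u (r + M * n) = 0})"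
      using n by (intro UN_I[of "n mod M"] image_eqI[of _ _ "n div M"]) auto
  qed
  hence "\<exists>r<M. infinite {n. u (r + M * n) = 0}"
    using inf by (meson finite_UN_I finite_imageI finite_lessThan finite_subset lessThan_iff)
  then obtain r where r: "infinite {n. u (r + M * n) = 0}" by blast
  \<comment> \<open>The functional \<open>w\<close> composed with \<open>T^r\<close>; the integers
    \<open>c i\<close> then form the binomial series of the progression.\<close>
  define g where "g = (\<lambda>j. \<Sum>l<d. w l * (T ^\<^sub>m r) $$ (l, j))"
  define c where "c = (\<lambda>i. \<Sum>j<d. g j * ((B ^\<^sub>m i) *\<^sub>v v) $ j)"
  have "u (r + M * n) = (\<Sum>i\<le>n. int (n choose i) * 3 ^ i * c i)" for n
  proof -
    define y where "y = ((T ^\<^sub>m M) ^\<^sub>m n) *\<^sub>v v"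
    have y: "y = orb v (M * n)" by (simp add: y_def pow_mat_mult[OF T])
    have "u (r + M * n) = (\<Sum>l<d. w l * (\<Sum>j<d. (T ^\<^sub>m r) $$ (l, j) * y $ j))"
      unfolding u_def y orb_orb[OF v(1), symmetric]
      by (intro sum.cong refl arg_cong2[where f = "(*)"] mult_mat_vec_nth[OF Tpow orb_carrier[OF v(1)]]) simp
    also have "\<dots> = (\<Sum>j<d. g j * y $ j)"
      unfolding g_def sum_distrib_left sum_distrib_right mult.assoc by (rule sum.swap)
    also have "\<dots> = (\<Sum>j<d. g j * (\<Sum>i\<le>n. int (n choose i) * 3 ^ i * ((B ^\<^sub>m i) *\<^sub>v v) $ j))"
      unfolding y_def by (intro sum.cong refl) (simp add: pow_one_plus[OF B TM v(1)])
    also have "\<dots> = (\<Sum>i\<le>n. int (n choose i) * 3 ^ i * c i)"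
      unfolding c_def sum_distrib_left by (subst sum.swap) (simp add: mult_ac)
    finally show ?thesis .
  qed
  from hansel[OF this r] have "u (r + M * n) = 0" for n .
  hence zero: "rat_of_int (u (r + M * n)) = 0" for n by simp
  have xi: "poly (map_poly of_rat chi) xi = 0"
    unfolding chi_roots using max_eigenvalue_iff[of xi] by blast
  have "xi \<noteq> 0" using xi_powers[of 1] by auto
  have "rat_of_int (u n) = 0" for n
    using progression_zero[of chi "\<lambda>n. rat_of_int (u n)" xi M r, OF irr monic_chi _ xi xi_separated zero \<open>xi \<noteq> 0\<close>]
      kills_orbit[OF v(1)] M by (simp add: u_def)
  hence u0: "u n = 0" for n by simp
  obtain \<delta> a where \<delta>: "\<delta> \<noteq> 0" "\<And>l j. l < d \<Longrightarrow> j < d \<Longrightarrow> (\<Sum>i<d. a i l * orb v i $ j) = (if j = l then \<delta> else 0)"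
    using cyclic[OF v] by blast
  \<comment> \<open>By cyclicity \<open>\<delta>\<close> times the \<open>l\<close>-th unit vector
    is a combination of orbit vectors, on all of which the functional vanishes.\<close>
  have "w l * \<delta> = (\<Sum>j<d. w j * (if j = l then \<delta> else 0))"
    using w(1) by (simp add: if_distrib[of "\<lambda>x. _ * x"] sum.delta cong: if_cong)
  also have "\<dots> = (\<Sum>j<d. w j * (\<Sum>i<d. a i l * orb v i $ j))"
    using \<delta>(2) w(1) by simp
  also have "\<dots> = (\<Sum>i<d. a i l * u i)"
    unfolding u_def sum_distrib_left by (subst sum.swap) (simp add: mult_ac)
  finally show False using u0 \<delta>(1) w(2) by simp
qed

end

section \<open>Growth of the exponents\<close>

definition mat_norm :: "nat \<Rightarrow> int mat \<Rightarrow> int" where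
  "mat_norm d M = (\<Sum>k<d. \<Sum>l<d. \<bar>M $$ (k, l)\<bar>)"

lemma row_le_mat_norm: "k < d \<Longrightarrow> (\<Sum>l<d. \<bar>M $$ (k, l)\<bar>) \<le> mat_norm d M"
  unfolding mat_norm_def by (rule member_le_sum[of k "{..<d}"]) (auto intro: sum_nonneg)

lemma mat_norm_nonneg: "mat_norm d M \<ge> 0"
  unfolding mat_norm_def by (intro sum_nonneg) auto

lemma mat_norm_mult:
  assumes "M \<in> carrier_mat d d" "N \<in> carrier_mat d d"
  shows "mat_norm d (M * N) \<le> mat_norm d M * mat_norm d N"
proof -
  have "mat_norm d (M * N) \<le> (\<Sum>k<d. \<Sum>j<d. \<Sum>i<d. \<bar>M $$ (k, i)\<bar> * \<bar>N $$ (i, j)\<bar>)"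
    unfolding mat_norm_def
  proof (intro sum_mono)
    fix k j assume "k \<in> {..<d}" "j \<in> {..<d}"
    hence "\<bar>(M * N) $$ (k, j)\<bar> = \<bar>\<Sum>i<d. M $$ (k, i) * N $$ (i, j)\<bar>"
      using mult_mat_nth[OF assms] by simp
    also have "\<dots> \<le> (\<Sum>i<d. \<bar>M $$ (k, i) * N $$ (i, j)\<bar>)" by (rule sum_abs)
    finally show "\<bar>(M * N) $$ (k, j)\<bar> \<le> (\<Sum>i<d. \<bar>M $$ (k, i)\<bar> * \<bar>N $$ (i, j)\<bar>)"
      by (simp add: abs_mult)
  qed
  also have "\<dots> = (\<Sum>k<d. \<Sum>i<d. \<bar>M $$ (k, i)\<bar> * (\<Sum>j<d. \<bar>N $$ (i, j)\<bar>))"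
    unfolding sum_distrib_left by (intro sum.cong refl sum.swap)
  also have "\<dots> \<le> (\<Sum>k<d. \<Sum>i<d. \<bar>M $$ (k, i)\<bar> * mat_norm d N)"
    by (intro sum_mono mult_left_mono row_le_mat_norm) auto
  also have "\<dots> = mat_norm d M * mat_norm d N"
    by (simp add: mat_norm_def sum_distrib_right)
  finally show ?thesis .
qed

lemma level_vec_abs: "j < d \<Longrightarrow> \<bar>level_vec d m i $ j\<bar> \<le> 1"
  by (auto simp: level_vec_def ray_def v_vec_def unit_vec_def epsilon_def)

lemma weight_le_mat_norm:
  assumes M: "M \<in> carrier_mat d d"
  shows "int (weight d M m) \<le> (int d + 1) * mat_norm d M"
proof -
  have "- cmin d (M *\<^sub>v level_vec d m i) \<le> mat_norm d M" for i
  proof -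
    let ?w = "level_vec d m i"
    obtain k where k: "k \<le> d" "cd (M *\<^sub>v ?w) k = cmin d (M *\<^sub>v ?w)" using cmin_attained by blast
    show ?thesis
    proof (cases k)
      case 0
      thus ?thesis using k(2) mat_norm_nonneg[of d M] by simp
    next
      case (Suc l)
      hence l: "l < d" using k by simp
      have "- cmin d (M *\<^sub>v ?w) = - (\<Sum>j<d. M $$ (l, j) * ?w $ j)"
        unfolding k(2)[symmetric] Suc cd_mult_mat_vec[OF M level_vec_carrier l] ..
      also have "\<dots> \<le> (\<Sum>j<d. \<bar>M $$ (l, j) * ?w $ j\<bar>)"
        by (simp add: sum_negf[symmetric]) (intro sum_mono, simp)
      also have "\<dots> \<le> (\<Sum>j<d. \<bar>M $$ (l, j)\<bar> * 1)"
        unfolding abs_mult by (intro sum_mono mult_left_mono level_vec_abs) auto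
      also have "\<dots> \<le> mat_norm d M" using row_le_mat_norm[OF l] by simp
      finally show ?thesis .
    qed
  qed
  hence "(\<Sum>i\<le>d. - cmin d (M *\<^sub>v level_vec d m i)) \<le> (\<Sum>i\<le>d. mat_norm d M)" by (intro sum_mono)
  thus ?thesis unfolding int_weight by (simp add: algebra_simps)
qed

lemma weight_level: "m > 0 \<Longrightarrow> weight d M m = weight d M 1"
  by (simp add: weight_def level_vec_def)

text \<open>The images of the \<open>v_i\<close> sum to zero, so the absolute values of a coordinate
  add up to twice its negative parts, which the minima control.\<close>

lemma coord_le_weight:
  assumes M: "M \<in> carrier_mat d d" and d: "d \<ge> 1" and i: "i \<le> d" and k: "k < d"
  shows "\<bar>(M *\<^sub>v v_vec d i) $ k\<bar> \<le> 2 * int (weight d M 1)"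
proof -
  define t where "t = (\<lambda>i. (M *\<^sub>v v_vec d i) $ k)"
  have t0: "(\<Sum>i\<le>d. t i) = 0" using sum_cd_v_vec[OF M, of "Suc k"] d k by (simp add: t_def del: index_mult_mat_vec)
  have "\<bar>t i\<bar> \<le> (\<Sum>i\<le>d. \<bar>t i\<bar>)" using i by (intro member_le_sum) auto
  also have "\<dots> = (\<Sum>i\<le>d. \<bar>t i\<bar> - t i)" using t0 by (simp add: sum_subtractf)
  also have "\<dots> \<le> (\<Sum>i\<le>d. 2 * (- cmin d (M *\<^sub>v v_vec d i)))"
  proof (rule sum_mono)
    fix i
    have "cmin d (M *\<^sub>v v_vec d i) \<le> t i" using cmin_le[of "Suc k" d "M *\<^sub>v v_vec d i"] k by (simp add: t_def del: index_mult_mat_vec)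
    thus "\<bar>t i\<bar> - t i \<le> 2 * (- cmin d (M *\<^sub>v v_vec d i))" using cmin_le_0[of d "M *\<^sub>v v_vec d i"] by linarith
  qed
  also have "\<dots> = 2 * int (weight d M 1)"
    unfolding int_weight sum_distrib_left by (simp add: level_vec_def)
  finally show ?thesis by (simp add: t_def)
qed

lemma nxt_cycle: "d \<ge> 2 \<Longrightarrow> i \<le> d \<Longrightarrow> \<exists>k\<le>d. i \<noteq> k \<and> i \<noteq> nxt d k"
  by (rule exI[of _ "nxt d i"]) (auto simp: nxt_def)

lemma level_vec_nonzero:
  assumes "d \<ge> 2" "i \<le> d"
  shows "level_vec d m i \<noteq> 0\<^sub>v d"
proof
  assume z: "level_vec d m i = 0\<^sub>v d"
  have "cd (0\<^sub>v d) k = 0" if "k \<le> d" for k using that by (cases k) auto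
  hence c: "expo d (level_vec d m i) k = expo d (level_vec d m i) l" if "k \<le> d" "l \<le> d" for k l
    using that unfolding z expo_def by simp
  show False
  proof (cases "m = 0")
    case True
    define k where "k = (if i = 0 then 1 else 0 :: nat)"
    have "k \<le> d" "k \<noteq> i" using assms by (auto simp: k_def)
    thus False using c[of i k] assms True by (simp add: level_vec_def expo_ray)
  next
    case False
    obtain k where "k \<le> d" "i \<noteq> k" "i \<noteq> nxt d k" using nxt_cycle[OF assms] by blast
    thus False using c[of i k] assms False by (simp add: level_vec_def expo_v_vec)
  qed
qed

context irreducible_matrix
begin

text \<open>By cyclicity an entry of \<open>T^n\<close>, times \<open>\<delta>\<close>, is a
  combination of coordinates of \<open>T^i (T^n v_0)\<close> with \<open>i < d\<close>. These are
  bounded through \<open>coord_le_weight\<close>, with constants independent of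
  \<open>n\<close>.\<close>

lemma mat_norm_le_weight:
  assumes d: "d \<ge> 2"
  shows "\<exists>K>0. \<forall>n. mat_norm d (T ^\<^sub>m n) \<le> K * int (weight d (T ^\<^sub>m n) 1)"
proof -
  let ?v = "v_vec d 0"
  have "?v \<noteq> 0\<^sub>v d" using level_vec_nonzero[OF d, of 0 1] by (simp add: level_vec_def)
  then obtain \<delta> a where \<delta>: "\<delta> \<noteq> 0" "\<And>l j. l < d \<Longrightarrow> j < d \<Longrightarrow> (\<Sum>i<d. a i l * orb ?v i $ j) = (if j = l then \<delta> else 0)"
    using cyclic[of ?v] by auto
  define c where "c = (\<lambda>k l. \<Sum>i<d. \<Sum>j<d. \<bar>a i l\<bar> * \<bar>(T ^\<^sub>m i) $$ (k, j)\<bar>)"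
  have entry: "\<bar>(T ^\<^sub>m n) $$ (k, l)\<bar> \<le> c k l * (2 * int (weight d (T ^\<^sub>m n) 1))" if k: "k < d" and l: "l < d" for n k l
  proof -
    let ?P = "2 * int (weight d (T ^\<^sub>m n) 1)"
    have "(T ^\<^sub>m n) $$ (k, l) * \<delta> = (\<Sum>j<d. (T ^\<^sub>m n) $$ (k, j) * (if j = l then \<delta> else 0))"
      using l by (simp add: if_distrib[of "\<lambda>x. _ * x"] sum.delta cong: if_cong)
    also have "\<dots> = (\<Sum>j<d. (T ^\<^sub>m n) $$ (k, j) * (\<Sum>i<d. a i l * orb ?v i $ j))"
      using \<delta>(2)[OF l] by simp
    also have "\<dots> = (\<Sum>i<d. a i l * (\<Sum>j<d. (T ^\<^sub>m n) $$ (k, j) * orb ?v i $ j))"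
      unfolding sum_distrib_left by (subst sum.swap) (simp add: mult_ac)
    also have "\<dots> = (\<Sum>i<d. a i l * orb (orb ?v n) i $ k)"
    proof (intro sum.cong refl arg_cong2[where f = "(*)"])
      fix i
      have "(\<Sum>j<d. (T ^\<^sub>m n) $$ (k, j) * orb ?v i $ j) = orb (orb ?v i) n $ k"
        by (rule mult_mat_vec_nth[OF Tpow orb_carrier[OF v_vec_carrier] k, symmetric])
      also have "orb (orb ?v i) n = orb (orb ?v n) i"
        by (simp only: orb_orb[OF v_vec_carrier] add.commute)
      finally show "(\<Sum>j<d. (T ^\<^sub>m n) $$ (k, j) * orb ?v i $ j) = orb (orb ?v n) i $ k" .
    qed
    finally have eq: "(T ^\<^sub>m n) $$ (k, l) * \<delta> = (\<Sum>i<d. a i l * orb (orb ?v n) i $ k)" .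
    have "\<bar>(T ^\<^sub>m n) $$ (k, l)\<bar> * 1 \<le> \<bar>(T ^\<^sub>m n) $$ (k, l)\<bar> * \<bar>\<delta>\<bar>"
      using \<delta>(1) by (intro mult_left_mono) auto
    also have "\<dots> = \<bar>\<Sum>i<d. a i l * orb (orb ?v n) i $ k\<bar>" by (simp only: abs_mult[symmetric] eq)
    also have "\<dots> \<le> (\<Sum>i<d. \<bar>a i l * orb (orb ?v n) i $ k\<bar>)" by (rule sum_abs)
    also have "\<dots> \<le> (\<Sum>i<d. \<bar>a i l\<bar> * ((\<Sum>j<d. \<bar>(T ^\<^sub>m i) $$ (k, j)\<bar>) * ?P))"
      unfolding abs_mult
    proof (intro sum_mono mult_left_mono)
      fix i
      have "\<bar>orb (orb ?v n) i $ k\<bar> = \<bar>\<Sum>j<d. (T ^\<^sub>m i) $$ (k, j) * orb ?v n $ j\<bar>"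
        by (simp only: mult_mat_vec_nth[OF Tpow orb_carrier[OF v_vec_carrier] k])
      also have "\<dots> \<le> (\<Sum>j<d. \<bar>(T ^\<^sub>m i) $$ (k, j) * orb ?v n $ j\<bar>)" by (rule sum_abs)
      also have "\<dots> \<le> (\<Sum>j<d. \<bar>(T ^\<^sub>m i) $$ (k, j)\<bar> * ?P)"
        unfolding abs_mult using d by (intro sum_mono mult_left_mono coord_le_weight Tpow) auto
      finally show "\<bar>orb (orb ?v n) i $ k\<bar> \<le> (\<Sum>j<d. \<bar>(T ^\<^sub>m i) $$ (k, j)\<bar>) * ?P"
        by (simp only: sum_distrib_right)
    qed auto
    also have "\<dots> = c k l * ?P"
      unfolding c_def sum_distrib_right sum_distrib_left mult.assoc ..
    finally show ?thesis by simp
  qed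
  define K where "K = 1 + 2 * (\<Sum>k<d. \<Sum>l<d. c k l)"
  have "mat_norm d (T ^\<^sub>m n) \<le> K * int (weight d (T ^\<^sub>m n) 1)" for n
  proof -
    have "mat_norm d (T ^\<^sub>m n) \<le> (\<Sum>k<d. \<Sum>l<d. c k l * (2 * int (weight d (T ^\<^sub>m n) 1)))"
      unfolding mat_norm_def by (intro sum_mono entry) auto
    also have "\<dots> = (2 * (\<Sum>k<d. \<Sum>l<d. c k l)) * int (weight d (T ^\<^sub>m n) 1)"
      by (simp add: sum_distrib_left sum_distrib_right mult_ac)
    also have "\<dots> \<le> K * int (weight d (T ^\<^sub>m n) 1)"
      unfolding K_def by (intro mult_right_mono) auto
    finally show ?thesis .
  qed
  moreover have "K > 0"
  proof -
    have "(\<Sum>k<d. \<Sum>l<d. c k l) \<ge> 0" unfolding c_def by (intro sum_nonneg mult_nonneg_nonneg) auto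
    thus ?thesis by (simp add: K_def)
  qed
  ultimately show ?thesis by blast
qed

lemma cd_eq_finite:
  assumes "v \<in> carrier_vec d" "v \<noteq> 0\<^sub>v d" "k \<le> d" "l \<le> d" "k < l"
  shows "finite {n. cd (orb v n) k = cd (orb v n) l}"
proof -
  \<comment> \<open>The functional \<open>cd y k - cd y l\<close>; it is non-zero because
    \<open>k < l\<close> makes its coefficient at \<open>l - 1\<close> equal to -1.\<close>
  define w where "w = (\<lambda>j. (if k = Suc j then 1 else 0) - (if l = Suc j then 1 else 0 :: int))"
  have pick: "(\<Sum>j<d. (if k = Suc j then 1 else 0) * y $ j) = cd y k" if "k \<le> d" for k and y :: "int vec"
  proof (cases k)
    case (Suc m)
    hence "(\<Sum>j<d. (if k = Suc j then 1 else 0) * y $ j) = (\<Sum>j<d. if j = m then y $ j else 0)"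
      by (intro sum.cong) auto
    thus ?thesis using Suc that by (simp add: sum.delta)
  qed simp
  have "(\<Sum>j<d. w j * y $ j) = cd y k - cd y l" for y
    unfolding w_def left_diff_distrib sum_subtractf using pick assms(3,4) by simp
  hence "{n. cd (orb v n) k = cd (orb v n) l} = {n. (\<Sum>j<d. w j * orb v n $ j) = 0}" by simp
  moreover have "w (l - 1) \<noteq> 0" "l - 1 < d" using assms(4,5) by (auto simp: w_def)
  ultimately show ?thesis using orbit_zero_finite[OF assms(1,2)] by presburger
qed

text \<open>Two vanishing exponents mean two equal entries. The level vectors depend only on
  \<open>i\<close> and on whether \<open>m\<close> is 0, so the bad exponents form a finite union of
  finite sets.\<close>

lemma generic_eventually:
  assumes d: "d \<ge> 2"
  shows "\<exists>N0. \<forall>n\<ge>N0. \<forall>m. \<forall>i\<le>d. \<exists>!k. k \<le> d \<and> expo d (orb (level_vec d m i) n) k = 0"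
proof -
  define bad where "bad = (\<Union>m\<in>{0, 1}. \<Union>i\<in>{..d}. \<Union>k\<in>{..d}. \<Union>l\<in>{k<..d}.
    {n. cd (orb (level_vec d m i) n) k = cd (orb (level_vec d m i) n) l})"
  have "finite bad"
    unfolding bad_def by (intro finite_UN_I cd_eq_finite level_vec_nonzero[OF d] level_vec_carrier) auto
  define N0 where "N0 = Suc (Max (insert 0 bad))"
  have "\<exists>!k. k \<le> d \<and> expo d (orb (level_vec d m i) n) k = 0" if n: "n \<ge> N0" and i: "i \<le> d" for n m i
  proof -
    let ?w = "\<lambda>m. orb (level_vec d m i) n"
    have "n \<notin> bad"
    proof
      assume "n \<in> bad"
      hence "n \<le> Max (insert 0 bad)" using \<open>finite bad\<close> by (intro Max_ge) auto
      thus False using n by (simp add: N0_def)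
    qed
    hence neq: "cd (?w m') k \<noteq> cd (?w m') l" if "m' \<in> {0, 1}" "k < l" "l \<le> d" for m' k l
      using i that unfolding bad_def by fastforce
    have "level_vec d m i = level_vec d (if m = 0 then 0 else 1) i" by (simp add: level_vec_def)
    hence neq: "cd (?w m) k \<noteq> cd (?w m) l" if "k < l" "l \<le> d" for k l
      using neq[of "if m = 0 then 0 else 1" k l] that by simp
    have "k = l" if kl: "k \<le> d" "l \<le> d" and "expo d (?w m) k = 0" "expo d (?w m) l = 0" for k l
    proof -
      have "cd (?w m) k = cd (?w m) l"
        using int_expo[OF kl(1), of "?w m"] int_expo[OF kl(2), of "?w m"] that(3,4) by simp
      thus ?thesis using neq[of k l] neq[of l k] kl by (cases k l rule: linorder_cases) auto
    qed
    thus ?thesis using expo_attained[of d "?w m"] by blast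
  qed
  thus ?thesis by (intro exI[of _ N0] allI impI)
qed

end

section \<open>The dynamical degree\<close>

theorem theorem1p2:
  fixes d :: nat and At :: "int mat" and xi :: complex
  assumes char_not_2: "(2 :: 'k::alg_closed_field) \<noteq> 0"
    and d_ge_2: "d \<ge> 2"
    and At_carrier: "At \<in> carrier_mat d d"
    and At_SL: "det At = 1"
    and At_irreducible: "irreducible (char_poly (map_mat rat_of_int At))"
    and At_max_eigenvalues:
      "{\<mu>. eigenvalue (map_mat complex_of_int At) \<mu> \<and>
          (\<forall>\<nu>. eigenvalue (map_mat complex_of_int At) \<nu> \<longrightarrow> cmod \<nu> \<le> cmod \<mu>)} = {xi, cnj xi}"
    and xi_powers: "\<And>j::int. j \<noteq> 0 \<Longrightarrow> xi powi j \<notin> \<real>"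
  shows "\<exists>N0. \<forall>N\<ge>N0.
    (let A = At ^\<^sub>m N;
         f = rat_comp d (g_map d) (monomial_map d A) :: 'k ratmap;
         lam = dynamical_degree d f
     in degree_growth d f \<longlonglongrightarrow> lam \<and>
        (\<lambda>j. real_of_int (Psi (U_set d) (V_set d) (A ^\<^sub>m (j + 1))) * lam powi (- int (j + 1))) sums 1)"
proof -
  \<comment> \<open>Determinant 1 makes the adjugate an inverse over the integers.\<close>
  define Ti where "Ti = adj_mat At"
  have adj: "Ti \<in> carrier_mat d d" "At * Ti = 1\<^sub>m d" "Ti * At = 1\<^sub>m d"
    using adj_mat[OF At_carrier] At_SL by (auto simp: Ti_def)
  interpret irreducible_matrix d At Ti xi
  proof (rule irreducible_matrix.intro)
    show "At \<in> carrier_mat d d" "Ti \<in> carrier_mat d d" "Ti * At = 1\<^sub>m d"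
      using At_carrier adj by blast+
  qed (fact At_irreducible, fact At_max_eigenvalues, fact xi_powers)
  from generic_eventually[OF d_ge_2] obtain N0 where
    N0: "\<forall>n\<ge>N0. \<forall>m. \<forall>i\<le>d. \<exists>!k. k \<le> d \<and> expo d (orb (level_vec d m i) n) k = 0"
    by (rule exE)
  hence gen: "\<exists>!k. k \<le> d \<and> expo d (orb (level_vec d m i) n) k = 0" if "n \<ge> N0" "i \<le> d" for n m i
    using that by simp
  obtain K0 where K0: "K0 > 0" "\<And>n. mat_norm d (At ^\<^sub>m n) \<le> K0 * int (weight d (At ^\<^sub>m n) 1)"
    using mat_norm_le_weight[OF d_ge_2] by blast
  have "degree_growth d f \<longlonglongrightarrow> dynamical_degree d f \<and>
      (\<lambda>j. real_of_int (Psi (U_set d) (V_set d) (A ^\<^sub>m (j + 1))) * dynamical_degree d f powi (- int (j + 1))) sums 1"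
    if N: "N \<ge> N0" and A_def: "A = At ^\<^sub>m N" and f_def: "f = rat_comp d (g_map d) (monomial_map d A)"
    for N A and f :: "'k ratmap"
  proof -
    have A_pow: "A ^\<^sub>m s = At ^\<^sub>m (N * s)" for s unfolding A_def by (rule pow_mat_mult[OF At_carrier])
    have A: "A \<in> carrier_mat d d" unfolding A_def by (rule Tpow)
    interpret iteration d A "Ti ^\<^sub>m N" "TYPE('k)"
    proof (rule iteration.intro)
      show "A * Ti ^\<^sub>m N = 1\<^sub>m d" unfolding A_def by (rule pow_mat_inverse[OF At_carrier adj(1,2)])
      show "Ti ^\<^sub>m N * A = 1\<^sub>m d" unfolding A_def by (rule pow_mat_inverse[OF adj(1) At_carrier adj(3)])
      show "\<exists>!k. k \<le> d \<and> lev d A s m i k = 0" if s: "s \<ge> 1" and i: "i \<le> d" for s m i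
      proof -
        \<comment> \<open>Every \<open>A^s\<close> with \<open>s \<ge> 1\<close> is a power of
          \<open>At\<close> with exponent at least \<open>N0\<close>, so one threshold serves all
          \<open>s\<close>.\<close>
        have "N0 \<le> N * s" using N mult_le_mono2[OF s, of N] by linarith
        from gen[OF this i, of m] show ?thesis by (simp only: lev_def A_pow)
      qed
    qed (use char_not_2 d_ge_2 A adj in auto)
    define P where "P = (\<lambda>j. real (weight d (A ^\<^sub>m j) 1))"
    define c where "c = (\<lambda>j. real (weight d (A ^\<^sub>m j) 0))"
    define D where "D = (\<lambda>n. real (atom_deg d A n))"
    have Ac: "A ^\<^sub>m s \<in> carrier_mat d d" for s using A by simp
    \<comment> \<open>Every weight of \<open>A^n\<close> is at most \<open>d + 1\<close> times its
      norm, hence at most \<open>K * P n\<close>. Estimating a product involves two norms, whence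
      the constant \<open>K * K0\<close> below.\<close>
    define K where "K = (int d + 1) * K0"
    have norm_le: "mat_norm d (A ^\<^sub>m s) \<le> K0 * int (weight d (A ^\<^sub>m s) 1)" for s
      unfolding A_pow by (rule K0)
    have "P j \<ge> 1" "c j \<ge> 1" if j: "j \<ge> 1" for j
      using weight_pos[OF j, of 1] weight_pos[OF j, of 0] by (simp_all add: P_def c_def)
    moreover have "real_of_int (K * K0) > 0" using K0 by (simp add: K_def)
    moreover have "P (m + n) \<le> real_of_int (K * K0) * P m * P n" for m n
    proof -
      have "int (weight d (A ^\<^sub>m (m + n)) 1) \<le> (int d + 1) * mat_norm d (A ^\<^sub>m m * A ^\<^sub>m n)"
        unfolding pow_mat_add[OF A] by (rule weight_le_mat_norm[OF mult_carrier_mat[OF Ac Ac]])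
      also have "\<dots> \<le> (int d + 1) * (mat_norm d (A ^\<^sub>m m) * mat_norm d (A ^\<^sub>m n))"
        by (intro mult_left_mono mat_norm_mult Ac) simp
      also have "\<dots> \<le> (int d + 1) * ((K0 * int (weight d (A ^\<^sub>m m) 1)) * (K0 * int (weight d (A ^\<^sub>m n) 1)))"
        using norm_le mat_norm_nonneg K0(1) by (intro mult_left_mono mult_mono) auto
      finally have "real_of_int (int (weight d (A ^\<^sub>m (m + n)) 1))
          \<le> real_of_int ((K * K0) * int (weight d (A ^\<^sub>m m) 1) * int (weight d (A ^\<^sub>m n) 1))"
        unfolding of_int_le_iff K_def by (simp add: mult_ac)
      thus ?thesis by (simp add: P_def)
    qed
    moreover have "c n \<le> real_of_int K * P n" for n
    proof -
      have "int (weight d (A ^\<^sub>m n) 0) \<le> (int d + 1) * mat_norm d (A ^\<^sub>m n)"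
        by (rule weight_le_mat_norm[OF Ac])
      also have "\<dots> \<le> (int d + 1) * (K0 * int (weight d (A ^\<^sub>m n) 1))"
        using norm_le by (intro mult_left_mono) auto
      finally have "real_of_int (int (weight d (A ^\<^sub>m n) 0)) \<le> real_of_int (K * int (weight d (A ^\<^sub>m n) 1))"
        unfolding of_int_le_iff K_def by (simp add: mult_ac)
      thus ?thesis by (simp add: c_def P_def)
    qed
    moreover have "D n = c n + (\<Sum>m=1..<n. D m * P (n - m))" if n: "n \<ge> 1" for n
    proof -
      have "atom_deg d A n = (\<Sum>m=0..<n. atom_deg d A m * weight d (A ^\<^sub>m (n - m)) m)"
        using n by (subst atom_deg.simps) (simp add: atLeast0LessThan)
      also have "\<dots> = weight d (A ^\<^sub>m n) 0 + (\<Sum>m=1..<n. atom_deg d A m * weight d (A ^\<^sub>m (n - m)) m)"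
        using n by (subst sum.atLeast_Suc_lessThan) (simp_all add: atom_deg.simps[of d A 0])
      also have "(\<Sum>m=1..<n. atom_deg d A m * weight d (A ^\<^sub>m (n - m)) m)
          = (\<Sum>m=1..<n. atom_deg d A m * weight d (A ^\<^sub>m (n - m)) 1)"
        by (intro sum.cong refl arg_cong2[where f = "(*)"] weight_level) simp
      finally show ?thesis by (simp add: D_def c_def P_def)
    qed
    \<comment> \<open>The factor \<open>q = d\<close> of the renewal limit is the degree of the
      forms of g; it disappears under the \<open>n\<close>-th root.\<close>
    moreover have "real d > 0" using d_ge_2 by simp
    ultimately have "\<exists>lam>0. (\<lambda>n. root n (real d * D n)) \<longlonglongrightarrow> lam \<and> (\<lambda>j. P (Suc j) / lam ^ Suc j) sums 1"
      by (intro renewal_root_limit[of P "real_of_int (K * K0)" c "real_of_int K" D "real d"])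
    then obtain lam where lam: "lam > 0" "(\<lambda>n. root n (real d * D n)) \<longlonglongrightarrow> lam"
      "(\<lambda>j. P (Suc j) / lam ^ Suc j) sums 1" by (elim exE conjE)
    have "degree_growth d f \<longlonglongrightarrow> lam"
    proof (rule Lim_transform_eventually[OF lam(2)])
      show "\<forall>\<^sub>F n in sequentially. root n (real d * D n) = degree_growth d f n"
        using eventually_gt_at_top[of 0]
        by eventually_elim (simp add: degree_growth_def f_def degree_iterate D_def)
    qed
    moreover from this have "dynamical_degree d f = lam"
      unfolding dynamical_degree_def by (rule limI)
    moreover have "real_of_int (Psi (U_set d) (V_set d) (A ^\<^sub>m (j + 1))) * lam powi (- int (j + 1))
        = P (Suc j) / lam ^ Suc j" for j
    proof -
      have "Psi (U_set d) (V_set d) (A ^\<^sub>m (j + 1)) = int (weight d (A ^\<^sub>m Suc j) 1)"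
        using Psi_eq[OF d_ge_2 Ac, of 1 "j + 1"] by simp
      moreover have "lam powi (- int (j + 1)) = inverse (lam ^ Suc j)"
        by (simp only: power_int_minus power_int_of_nat Suc_eq_plus1)
      ultimately show ?thesis by (simp only: P_def divide_inverse of_int_of_nat_eq)
    qed
    ultimately show ?thesis using lam(3) by (simp only:)
  qed
  thus ?thesis unfolding Let_def by blast
qed

end
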